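(* Let $R$ be a unital commutative ring and let $L$ be a perfect Leibniz superalgebra over $R$. Let $L \otimes L$ be the non-abelian tensor product of $L$ and let $\delta_2 \colon L \otimes L \to L$ be the homomorphism induced by $x \otimes y \mapsto [x,y]$. Then $\delta_2 \colon L \otimes L \to L$ is the universal central extension of $L$, and its kernel is $\mathrm{HL}_2(L)$.
   Context: $R$ is a fixed unital commutative ring; an $R$-supermodule is a $\mathbb{Z}_2$-graded $R$-module, $|x|$ denotes the degree of a homogeneous element $x$, and formulas involving degrees are for homogeneous elements and extended linearly. A Leibniz superalgebra $L$ is an $R$-supermodule with an even $R$-linear map $[-,-]\colon L\otimes_R L\to L$ satisfying $[x,[y,z]] = [[x,y],z] - (-1)^{|y||z|}[[x,z],y]$. Its commutator $[L,L]$ is the ideal generated by all $[x,y]$, and $L$ is perfect if $L=[L,L]$. Its centre $\mathrm{Z}(L)$ is the set of $z\in L$ with $[z,x]=[x,z]=0$ for all $x\in L$. A central extension of $L$ is a surjective homomorphism of Leibniz superalgebras $\phi\colon M\to L$ with $\mathrm{Ker}\,\phi\subseteq \mathrm{Z}(M)$. A central extension $\mathfrak{u}\colon U\to L$ is universal if for every central extension $\phi\colon M\to L$ there is a unique homomorphism $f\colon U\to M$ with $\mathfrak{u}=\phi\circ f$. Leibniz homology with trivial coefficients: $\delta_n\colon L^{\otimes n}\to L^{\otimes n-1}$ (tensor powers over $R$) is the $R$-linear map $$\delta_n(x_1\otimes\cdots\otimes x_n)=\sum_{i<j}(-1)^{n-j+|x_j|(|x_{i+1}|+\cdots+|x_{j-1}|)}\,x_1\otimes\cdots\otimes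 x_{i-1}\otimes[x_i,x_j]\otimes x_{i+1}\otimes\cdots\otimes\hat{x}_j\otimes\cdots\otimes x_n,$$ and $\mathrm{HL}_n(L)=\mathrm{Ker}\,\delta_n/\mathrm{Im}\,\delta_{n+1}$. In particular $\delta_2(x\otimes y)=[x,y]$ and $\delta_3(x\otimes y\otimes z)=-[x,y]\otimes z+x\otimes[y,z]+(-1)^{|y||z|}[x,z]\otimes y$. For $L$ perfect, the non-abelian tensor product of $L$ is $L\otimes L=(L\otimes_R L)/\mathrm{Im}\,\delta_3$, with bracket $[x\otimes y,x'\otimes y']=[x,y]\otimes[x',y']$. The map $\delta_2$ factors through it. *)

theory Defs
  imports "HOL.Hull" "HOL-Library.Z2" "HOL-Algebra.Module" "HOL-Algebra.AbelCoset"
begin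

text \<open>
  Modules are the carrier-based modules of HOL-Algebra. The ring fields mult and one inherited by
  the module record carry no meaning for a module and are left undefined in the constructions below.
  Elements of \<open>\<int>\<^sub>2\<close> are represented by the two-element field \<^typ>\<open>bit\<close>.
\<close>

section \<open>Linear maps, free modules, quotients\<close>

text \<open>All maps are extensional, so that equality of functions is equality of maps on the carrier.\<close>

definition linear_maps ::
    "('r, 'x) ring_scheme \<Rightarrow> ('r, 'a, 'y) module_scheme \<Rightarrow> ('r, 'b, 'z) module_scheme \<Rightarrow> ('a \<Rightarrow> 'b) set"
  where "linear_maps R M N =
    {f \<in> carrier M \<rightarrow>\<^sub>E carrier N.
       (\<forall>x \<in> carrier M. \<forall>y \<in> carrier M. f (x \<oplus>\<^bsub>M\<^esub> y) = f x \<oplus>\<^bsub>N\<^esub> f y) \<and>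
       (\<forall>r \<in> carrier R. \<forall>x \<in> carrier M. f (r \<odot>\<^bsub>M\<^esub> x) = r \<odot>\<^bsub>N\<^esub> f x)}"

definition bilinear_op ::
    "('r, 'x) ring_scheme \<Rightarrow> ('r, 'a, 'y) module_scheme \<Rightarrow> ('a \<Rightarrow> 'a \<Rightarrow> 'a) \<Rightarrow> bool"
  where "bilinear_op R M b \<longleftrightarrow>
    (\<forall>x \<in> carrier M. \<forall>y \<in> carrier M. b x y \<in> carrier M) \<and>
    (\<forall>x \<in> carrier M. \<forall>y \<in> carrier M. \<forall>z \<in> carrier M.
       b (x \<oplus>\<^bsub>M\<^esub> y) z = b x z \<oplus>\<^bsub>M\<^esub> b y z \<and> b z (x \<oplus>\<^bsub>M\<^esub> y) = b z x \<oplus>\<^bsub>M\<^esub> b z y) \<and>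
    (\<forall>r \<in> carrier R. \<forall>x \<in> carrier M. \<forall>y \<in> carrier M.
       b (r \<odot>\<^bsub>M\<^esub> x) y = r \<odot>\<^bsub>M\<^esub> b x y \<and> b x (r \<odot>\<^bsub>M\<^esub> y) = r \<odot>\<^bsub>M\<^esub> b x y)"

definition submodule_span ::
    "('r, 'x) ring_scheme \<Rightarrow> ('r, 'a, 'y) module_scheme \<Rightarrow> 'a set \<Rightarrow> 'a set"
  where "submodule_span R M A = (\<lambda>N. submodule N R M) hull A"

definition free_mod :: "('r, 'x) ring_scheme \<Rightarrow> 's set \<Rightarrow> ('r, 's \<Rightarrow> 'r) module"
  where "free_mod R S =
    \<lparr>carrier = {f. (\<forall>s. f s \<in> carrier R) \<and> finite {s. f s \<noteq> \<zero>\<^bsub>R\<^esub>} \<and> {s. f s \<noteq> \<zero>\<^bsub>R\<^esub>} \<subseteq> S},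
     mult = undefined, one = undefined,
     zero = (\<lambda>_. \<zero>\<^bsub>R\<^esub>), add = (\<lambda>f g s. f s \<oplus>\<^bsub>R\<^esub> g s), smult = (\<lambda>r f s. r \<otimes>\<^bsub>R\<^esub> f s)\<rparr>"

definition free_gen :: "('r, 'x) ring_scheme \<Rightarrow> 's \<Rightarrow> 's \<Rightarrow> 'r"
  where "free_gen R s = (\<lambda>t. if t = s then \<one>\<^bsub>R\<^esub> else \<zero>\<^bsub>R\<^esub>)"

definition quot_mod :: "('r, 'a, 'y) module_scheme \<Rightarrow> 'a set \<Rightarrow> ('r, 'a set) module"
  where "quot_mod M N =
    \<lparr>carrier = a_rcosets\<^bsub>M\<^esub> N, mult = undefined, one = undefined,
     zero = N, add = set_add M, smult = (\<lambda>r A. \<Union>x \<in> A. N +>\<^bsub>M\<^esub> (r \<odot>\<^bsub>M\<^esub> x))\<rparr>"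

section \<open>Supermodules\<close>

record ('r, 'a) supermodule = "('r, 'a) module" +
  grade :: "bit \<Rightarrow> 'a set"

locale supermodule = module R M
  for R :: "('r, 'x) ring_scheme" and M :: "('r, 'a, 'y) supermodule_scheme" +
  assumes grade_submodule: "submodule (grade M p) R M"
    and grade_sum: "carrier M = grade M 0 <+>\<^bsub>M\<^esub> grade M 1"
    and grade_inter: "grade M 0 \<inter> grade M 1 = {\<zero>\<^bsub>M\<^esub>}"

definition with_grade :: "('r, 'a) module \<Rightarrow> (bit \<Rightarrow> 'a set) \<Rightarrow> ('r, 'a) supermodule"
  where "with_grade M g = module.extend M (supermodule.fields g)"

definition sub_supermodule ::
    "('r, 'a, 'y) supermodule_scheme \<Rightarrow> 'a set \<Rightarrow> ('r, 'a) supermodule"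
  where "sub_supermodule M K =
    with_grade ((module.truncate M)\<lparr>carrier := K\<rparr>) (\<lambda>p. grade M p \<inter> K)"

definition quot_supermodule ::
    "('r, 'a, 'y) supermodule_scheme \<Rightarrow> 'a set \<Rightarrow> ('r, 'a set) supermodule"
  where "quot_supermodule M N =
    with_grade (quot_mod M N) (\<lambda>p. (\<lambda>x. N +>\<^bsub>M\<^esub> x) ` grade M p)"

text \<open>\<open>(-1)\<^sup>p\<close> in \<open>R\<close>.\<close>

definition super_sign :: "('r, 'x) ring_scheme \<Rightarrow> bit \<Rightarrow> 'r"
  where "super_sign R p = (if p = 0 then \<one>\<^bsub>R\<^esub> else \<ominus>\<^bsub>R\<^esub> \<one>\<^bsub>R\<^esub>)"

text \<open>
  The \<open>n\<close>-fold tensor power over \<open>R\<close>: the free module on the lists of length \<open>n\<close>, modulo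
  multilinearity. The degree of a homogeneous pure tensor is the sum of the degrees of its factors.
\<close>

definition tensor_lists :: "('r, 'a, 'y) module_scheme \<Rightarrow> nat \<Rightarrow> 'a list set"
  where "tensor_lists M n = {xs. set xs \<subseteq> carrier M \<and> length xs = n}"

definition tensor_rels ::
    "('r, 'x) ring_scheme \<Rightarrow> ('r, 'a, 'y) module_scheme \<Rightarrow> nat \<Rightarrow> ('a list \<Rightarrow> 'r) set"
  where "tensor_rels R M n =
    (let F = free_mod R (tensor_lists M n); e = free_gen R in
     submodule_span R F
      ({e (us @ [x \<oplus>\<^bsub>M\<^esub> y] @ vs) \<ominus>\<^bsub>F\<^esub> (e (us @ [x] @ vs) \<oplus>\<^bsub>F\<^esub> e (us @ [y] @ vs)) | us x y vs.
          us @ [x] @ vs \<in> tensor_lists M n \<and> y \<in> carrier M} \<union>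
       {e (us @ [r \<odot>\<^bsub>M\<^esub> x] @ vs) \<ominus>\<^bsub>F\<^esub> r \<odot>\<^bsub>F\<^esub> e (us @ [x] @ vs) | us r x vs.
          us @ [x] @ vs \<in> tensor_lists M n \<and> r \<in> carrier R}))"

definition pure_tensor ::
    "('r, 'x) ring_scheme \<Rightarrow> ('r, 'a, 'y) module_scheme \<Rightarrow> 'a list \<Rightarrow> ('a list \<Rightarrow> 'r) set"
  where "pure_tensor R M xs =
    tensor_rels R M (length xs) +>\<^bsub>free_mod R (tensor_lists M (length xs))\<^esub> free_gen R xs"

definition has_degrees :: "('r, 'a, 'y) supermodule_scheme \<Rightarrow> 'a list \<Rightarrow> bit list \<Rightarrow> bool"
  where "has_degrees M xs ps \<longleftrightarrow> list_all2 (\<lambda>x p. x \<in> grade M p) xs ps"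

definition tensor_power ::
    "('r, 'x) ring_scheme \<Rightarrow> ('r, 'a, 'y) supermodule_scheme \<Rightarrow> nat
      \<Rightarrow> ('r, ('a list \<Rightarrow> 'r) set) supermodule"
  where "tensor_power R M n =
    (let T = quot_mod (free_mod R (tensor_lists M n)) (tensor_rels R M n) in
     with_grade T
       (\<lambda>p. submodule_span R T
          {pure_tensor R M xs | xs ps. length xs = n \<and> has_degrees M xs ps \<and> sum_list ps = p}))"

section \<open>Leibniz superalgebras\<close>

record ('r, 'a) leibniz_superalgebra = "('r, 'a) supermodule" +
  bracket :: "'a \<Rightarrow> 'a \<Rightarrow> 'a"

locale leibniz_superalgebra = supermodule R L
  for R :: "('r, 'x) ring_scheme" and L :: "('r, 'a, 'y) leibniz_superalgebra_scheme" +
  assumes bracket_bilinear: "bilinear_op R L (bracket L)"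
    and bracket_even:
      "\<lbrakk>x \<in> grade L p; y \<in> grade L q\<rbrakk> \<Longrightarrow> bracket L x y \<in> grade L (p + q)"
    and leibniz_identity:
      "\<lbrakk>x \<in> grade L p; y \<in> grade L q; z \<in> grade L r\<rbrakk> \<Longrightarrow>
        bracket L x (bracket L y z) =
          bracket L (bracket L x y) z
            \<ominus>\<^bsub>L\<^esub> super_sign R (q * r) \<odot>\<^bsub>L\<^esub> bracket L (bracket L x z) y"

definition leibniz_homs ::
    "('r, 'x) ring_scheme \<Rightarrow> ('r, 'a, 'y) leibniz_superalgebra_scheme
      \<Rightarrow> ('r, 'b, 'z) leibniz_superalgebra_scheme \<Rightarrow> ('a \<Rightarrow> 'b) set"
  where "leibniz_homs R L M =
    {f \<in> linear_maps R L M.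
       (\<forall>p. f ` grade L p \<subseteq> grade M p) \<and>
       (\<forall>x \<in> carrier L. \<forall>y \<in> carrier L. f (bracket L x y) = bracket M (f x) (f y))}"

definition leibniz_ideal ::
    "('r, 'x) ring_scheme \<Rightarrow> ('r, 'a, 'y) leibniz_superalgebra_scheme \<Rightarrow> 'a set \<Rightarrow> bool"
  where "leibniz_ideal R L I \<longleftrightarrow>
    submodule I R L \<and>
    I = (grade L 0 \<inter> I) <+>\<^bsub>L\<^esub> (grade L 1 \<inter> I) \<and>
    (\<forall>x \<in> I. \<forall>y \<in> carrier L. bracket L x y \<in> I \<and> bracket L y x \<in> I)"

definition commutator ::
    "('r, 'x) ring_scheme \<Rightarrow> ('r, 'a, 'y) leibniz_superalgebra_scheme \<Rightarrow> 'a set"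
  where "commutator R L =
    leibniz_ideal R L hull {bracket L x y | x y. x \<in> carrier L \<and> y \<in> carrier L}"

definition perfect ::
    "('r, 'x) ring_scheme \<Rightarrow> ('r, 'a, 'y) leibniz_superalgebra_scheme \<Rightarrow> bool"
  where "perfect R L \<longleftrightarrow> carrier L = commutator R L"

definition leibniz_centre :: "('r, 'a, 'y) leibniz_superalgebra_scheme \<Rightarrow> 'a set"
  where "leibniz_centre L =
    {z \<in> carrier L. \<forall>x \<in> carrier L. bracket L z x = \<zero>\<^bsub>L\<^esub> \<and> bracket L x z = \<zero>\<^bsub>L\<^esub>}"

definition central_extension ::
    "('r, 'x) ring_scheme \<Rightarrow> ('r, 'm, 'y) leibniz_superalgebra_scheme
      \<Rightarrow> ('r, 'a, 'z) leibniz_superalgebra_scheme \<Rightarrow> ('m \<Rightarrow> 'a) \<Rightarrow> bool"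
  where "central_extension R M L \<phi> \<longleftrightarrow>
    leibniz_superalgebra R M \<and> leibniz_superalgebra R L \<and>
    \<phi> \<in> leibniz_homs R M L \<and> \<phi> ` carrier M = carrier L \<and>
    a_kernel M L \<phi> \<subseteq> leibniz_centre M"

text \<open>
  A definition cannot quantify over types, so the type \<^typ>\<open>'m\<close> of the elements of the competing
  extensions is a parameter; a theorem stated for a type variable \<^typ>\<open>'m\<close> covers all of them.
\<close>

definition universal_central_extension ::
    "'m itself \<Rightarrow> ('r, 'x) ring_scheme \<Rightarrow> ('r, 'u, 'y) leibniz_superalgebra_scheme
      \<Rightarrow> ('r, 'a, 'z) leibniz_superalgebra_scheme \<Rightarrow> ('u \<Rightarrow> 'a) \<Rightarrow> bool"
  where "universal_central_extension _ R U L u \<longleftrightarrow>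
    central_extension R U L u \<and>
    (\<forall>(M :: ('r, 'm) leibniz_superalgebra) \<phi>. central_extension R M L \<phi> \<longrightarrow>
       (\<exists>!f. f \<in> leibniz_homs R U M \<and> u = compose (carrier U) \<phi> f))"

section \<open>Leibniz homology with trivial coefficients\<close>

text \<open>
  The boundary of a homogeneous pure tensor with factors \<open>xs\<close> of degrees \<open>ps\<close>. Positions are
  counted from 0, so the exponent \<open>n - j\<close> of the usual formula becomes \<open>n - Suc j\<close>.
\<close>

definition leibniz_boundary_term ::
    "('r, 'x) ring_scheme \<Rightarrow> ('r, 'a, 'y) leibniz_superalgebra_scheme
      \<Rightarrow> 'a list \<Rightarrow> bit list \<Rightarrow> nat \<Rightarrow> nat \<Rightarrow> ('a list \<Rightarrow> 'r) set"
  where "leibniz_boundary_term R L xs ps i j =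
    (let n = length xs; ys = xs[i := bracket L (xs ! i) (xs ! j)] in
     super_sign R (of_nat (n - Suc j) + ps ! j * (\<Sum>k \<in> {i<..<j}. ps ! k))
       \<odot>\<^bsub>tensor_power R L (n - 1)\<^esub> pure_tensor R L (take j ys @ drop (Suc j) ys))"

definition leibniz_boundary ::
    "('r, 'x) ring_scheme \<Rightarrow> ('r, 'a, 'y) leibniz_superalgebra_scheme \<Rightarrow> nat
      \<Rightarrow> ('a list \<Rightarrow> 'r) set \<Rightarrow> ('a list \<Rightarrow> 'r) set"
  where "leibniz_boundary R L n =
    (THE d. d \<in> linear_maps R (tensor_power R L n) (tensor_power R L (n - 1)) \<and>
       (\<forall>xs ps. length xs = n \<longrightarrow> has_degrees L xs ps \<longrightarrow>
          d (pure_tensor R L xs) =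
            finsum (tensor_power R L (n - 1)) (\<lambda>(i, j). leibniz_boundary_term R L xs ps i j)
              {(i, j). i < j \<and> j < n}))"

definition leibniz_cycles ::
    "('r, 'x) ring_scheme \<Rightarrow> ('r, 'a, 'y) leibniz_superalgebra_scheme \<Rightarrow> nat
      \<Rightarrow> ('a list \<Rightarrow> 'r) set set"
  where "leibniz_cycles R L n =
    a_kernel (tensor_power R L n) (tensor_power R L (n - 1)) (leibniz_boundary R L n)"

definition leibniz_boundaries ::
    "('r, 'x) ring_scheme \<Rightarrow> ('r, 'a, 'y) leibniz_superalgebra_scheme \<Rightarrow> nat
      \<Rightarrow> ('a list \<Rightarrow> 'r) set set"
  where "leibniz_boundaries R L n =
    leibniz_boundary R L (Suc n) ` carrier (tensor_power R L (Suc n))"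

definition leibniz_homology ::
    "('r, 'x) ring_scheme \<Rightarrow> ('r, 'a, 'y) leibniz_superalgebra_scheme \<Rightarrow> nat
      \<Rightarrow> ('r, ('a list \<Rightarrow> 'r) set set) supermodule"
  where "leibniz_homology R L n =
    quot_supermodule (sub_supermodule (tensor_power R L n) (leibniz_cycles R L n))
      (leibniz_boundaries R L n)"

section \<open>The non-abelian tensor product of a perfect Leibniz superalgebra\<close>

definition nonab_tensor_supermodule ::
    "('r, 'x) ring_scheme \<Rightarrow> ('r, 'a, 'y) leibniz_superalgebra_scheme
      \<Rightarrow> ('r, ('a list \<Rightarrow> 'r) set set) supermodule"
  where "nonab_tensor_supermodule R L =
    quot_supermodule (tensor_power R L 2) (leibniz_boundaries R L 2)"

definition nonab_pure_tensor ::
    "('r, 'x) ring_scheme \<Rightarrow> ('r, 'a, 'y) leibniz_superalgebra_scheme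
      \<Rightarrow> 'a \<Rightarrow> 'a \<Rightarrow> ('a list \<Rightarrow> 'r) set set"
  where "nonab_pure_tensor R L x y =
    leibniz_boundaries R L 2 +>\<^bsub>tensor_power R L 2\<^esub> pure_tensor R L [x, y]"

definition nonab_bracket ::
    "('r, 'x) ring_scheme \<Rightarrow> ('r, 'a, 'y) leibniz_superalgebra_scheme
      \<Rightarrow> ('a list \<Rightarrow> 'r) set set \<Rightarrow> ('a list \<Rightarrow> 'r) set set \<Rightarrow> ('a list \<Rightarrow> 'r) set set"
  where "nonab_bracket R L =
    (let T = nonab_tensor_supermodule R L in
     THE b. b \<in> carrier T \<rightarrow>\<^sub>E (carrier T \<rightarrow>\<^sub>E carrier T) \<and> bilinear_op R T b \<and>
       (\<forall>x \<in> carrier L. \<forall>y \<in> carrier L. \<forall>x' \<in> carrier L. \<forall>y' \<in> carrier L.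
          b (nonab_pure_tensor R L x y) (nonab_pure_tensor R L x' y') =
            nonab_pure_tensor R L (bracket L x y) (bracket L x' y')))"

definition nonab_tensor ::
    "('r, 'x) ring_scheme \<Rightarrow> ('r, 'a, 'y) leibniz_superalgebra_scheme
      \<Rightarrow> ('r, ('a list \<Rightarrow> 'r) set set) leibniz_superalgebra"
  where "nonab_tensor R L =
    supermodule.extend (nonab_tensor_supermodule R L)
      (leibniz_superalgebra.fields (nonab_bracket R L))"

definition nonab_delta2 ::
    "('r, 'x) ring_scheme \<Rightarrow> ('r, 'a, 'y) leibniz_superalgebra_scheme
      \<Rightarrow> ('a list \<Rightarrow> 'r) set set \<Rightarrow> 'a"
  where "nonab_delta2 R L =
    (THE d. d \<in> linear_maps R (nonab_tensor R L) L \<and>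
       (\<forall>x \<in> carrier L. \<forall>y \<in> carrier L. d (nonab_pure_tensor R L x y) = bracket L x y))"

end

theory Submission
  imports Defs
begin

text \<open>
  Write \<open>U = L \<otimes> L\<close> and \<open>\<delta> : U \<rightarrow> L\<close> for the map induced by the bracket. The bracket of \<open>U\<close> can be
  written as \<open>[u, v] = \<delta> u \<otimes> \<delta> v\<close> (\<open>nonab_bracket\<close>), and everything follows from this formula. The
  relation expressing \<open>x \<otimes> [y, z]\<close> by \<open>[x, y] \<otimes> z\<close> and \<open>[x, z] \<otimes> y\<close> (\<open>nonab_balanced\<close>) turns into
  the Leibniz identity of \<open>U\<close>; an element killed by \<open>\<delta>\<close> is visibly central; and \<open>\<delta>\<close> is onto because a
  perfect \<open>L\<close> is spanned by its brackets (\<open>perfect_span\<close>).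

  Given a central extension \<open>\<phi> : E \<rightarrow> L\<close>, the bracket in \<open>E\<close> of lifts of \<open>x\<close> and \<open>y\<close> does not depend on
  the lifts, since these are determined up to central elements (\<open>central_extension_bracket_cong\<close>).
  Hence it is bilinear in \<open>x\<close> and \<open>y\<close> and, by the Leibniz identity of \<open>E\<close>, compatible with the
  relations of \<open>U\<close>, so that it defines a map \<open>U \<rightarrow> E\<close> over \<open>L\<close>. It is the only homomorphism over \<open>L\<close>,
  because every \<open>x \<otimes> y\<close> is a bracket in \<open>U\<close> (\<open>nonab_universal\<close>).

  Finally, \<open>\<delta>\<close> composed with the projection of the tensor square onto \<open>U\<close> is the boundary map in degree
  two, up to the identification of \<open>L\<close> with its first tensor power. The kernel of \<open>\<delta>\<close> thus consists of
  the cycles modulo the boundaries (\<open>nonab_kernel_eq_homology\<close>).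

  The maps involved come from the universal properties of the tensor powers
  (\<open>tensor_power_lift\<close>) and of \<open>U\<close> (\<open>nonab_lift\<close>). This includes the boundary maps, whose values are
  prescribed on homogeneous tensors only (\<open>leibniz_boundary_3\<close>), and the projections which show that
  the graded components of \<open>U\<close> form a direct sum (\<open>nonab_component\<close>).
\<close>

section \<open>Modules, linear maps and spans\<close>

lemma module_cong:
  assumes "module R M"
    and "carrier N = carrier M" "add N = add M" "zero N = zero M" "smult N = smult M"
  shows "module R N"
proof -
  interpret M: module R M by fact
  have "abelian_group N"
  proof (rule abelian_groupI)
    show "\<exists>y\<in>carrier N. y \<oplus>\<^bsub>N\<^esub> x = \<zero>\<^bsub>N\<^esub>" if "x \<in> carrier N" for x
      using that assms(2-4) M.l_neg[of x] M.a_inv_closed[of x] by auto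
    show "x \<oplus>\<^bsub>N\<^esub> y = y \<oplus>\<^bsub>N\<^esub> x" if "x \<in> carrier N" "y \<in> carrier N" for x y
      using that M.a_comm[of x y] unfolding assms(2-4) by simp
  qed (use assms in \<open>simp_all add: M.a_assoc\<close>)
  then show ?thesis
    by (intro moduleI M.is_cring)
      (simp_all add: assms(2-5) M.smult_l_distr M.smult_r_distr M.smult_assoc1)
qed

lemma (in module) minus_eq_zero_iff:
  assumes "x \<in> carrier M" "y \<in> carrier M"
  shows "x \<ominus>\<^bsub>M\<^esub> y = \<zero>\<^bsub>M\<^esub> \<longleftrightarrow> x = y"
  using assms by (metis M.add.inv_closed M.minus_equality M.minus_minus M.r_neg a_minus_def)

lemma (in module) submoduleI_closed:
  assumes "H \<subseteq> carrier M" "\<zero>\<^bsub>M\<^esub> \<in> H"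
    and "\<And>a b. \<lbrakk>a \<in> H; b \<in> H\<rbrakk> \<Longrightarrow> a \<oplus>\<^bsub>M\<^esub> b \<in> H"
    and smult: "\<And>a x. \<lbrakk>a \<in> carrier R; x \<in> H\<rbrakk> \<Longrightarrow> a \<odot>\<^bsub>M\<^esub> x \<in> H"
  shows "submodule H R M"
proof (rule submoduleI)
  fix a assume "a \<in> H"
  then have "(\<ominus>\<^bsub>R\<^esub> \<one>\<^bsub>R\<^esub>) \<odot>\<^bsub>M\<^esub> a \<in> H"
    by (intro smult) auto
  then show "\<ominus>\<^bsub>M\<^esub> a \<in> H"
    using \<open>a \<in> H\<close> assms(1) by (auto simp: smult_l_minus)
qed (use assms in auto)

lemma (in module) submodule_zero: "submodule H R M \<Longrightarrow> \<zero>\<^bsub>M\<^esub> \<in> H"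
  using subgroup.one_closed[OF submodule.axioms(1)] by fastforce

lemma (in module) submodule_minus:
  "\<lbrakk>submodule H R M; x \<in> H; y \<in> H\<rbrakk> \<Longrightarrow> x \<ominus>\<^bsub>M\<^esub> y \<in> H"
  using submoduleE(3,5) by (metis a_minus_def)

lemma (in module) submodule_Int:
  "\<lbrakk>submodule H R M; submodule K R M\<rbrakk> \<Longrightarrow> submodule (H \<inter> K) R M"
  by (rule submoduleI_closed)
    (use submoduleE(1,4,5)[of H] submoduleE(1,4,5)[of K] submodule_zero in auto)

lemma (in module) submodule_abelian_subgroup:
  assumes "submodule N R M"
  shows "abelian_subgroup N M"
  by (intro abelian_subgroupI3 additive_subgroup.intro submodule.axioms(1)[OF assms]
      M.abelian_group_axioms)

lemma linear_maps_closed: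
  "\<lbrakk>f \<in> linear_maps R M N; x \<in> carrier M\<rbrakk> \<Longrightarrow> f x \<in> carrier N"
  unfolding linear_maps_def by auto

lemma linear_maps_add:
  "\<lbrakk>f \<in> linear_maps R M N; x \<in> carrier M; y \<in> carrier M\<rbrakk>
    \<Longrightarrow> f (x \<oplus>\<^bsub>M\<^esub> y) = f x \<oplus>\<^bsub>N\<^esub> f y"
  unfolding linear_maps_def by auto

lemma linear_maps_smult:
  "\<lbrakk>f \<in> linear_maps R M N; r \<in> carrier R; x \<in> carrier M\<rbrakk>
    \<Longrightarrow> f (r \<odot>\<^bsub>M\<^esub> x) = r \<odot>\<^bsub>N\<^esub> f x"
  unfolding linear_maps_def by auto

lemma linear_maps_restrictI:
  assumes "module R M"
    and "\<And>x. x \<in> carrier M \<Longrightarrow> f x \<in> carrier N"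
    and "\<And>x y. \<lbrakk>x \<in> carrier M; y \<in> carrier M\<rbrakk> \<Longrightarrow> f (x \<oplus>\<^bsub>M\<^esub> y) = f x \<oplus>\<^bsub>N\<^esub> f y"
    and "\<And>r x. \<lbrakk>r \<in> carrier R; x \<in> carrier M\<rbrakk> \<Longrightarrow> f (r \<odot>\<^bsub>M\<^esub> x) = r \<odot>\<^bsub>N\<^esub> f x"
  shows "(\<lambda>x\<in>carrier M. f x) \<in> linear_maps R M N"
proof -
  interpret M: module R M by fact
  show ?thesis
    unfolding linear_maps_def using assms by auto
qed

lemma linear_maps_zero:
  assumes "module R M" "module R N" "f \<in> linear_maps R M N"
  shows "f \<zero>\<^bsub>M\<^esub> = \<zero>\<^bsub>N\<^esub>"
proof -
  interpret M: module R M by fact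
  interpret N: module R N by fact
  have "f (\<zero>\<^bsub>R\<^esub> \<odot>\<^bsub>M\<^esub> \<zero>\<^bsub>M\<^esub>) = \<zero>\<^bsub>R\<^esub> \<odot>\<^bsub>N\<^esub> f \<zero>\<^bsub>M\<^esub>"
    by (rule linear_maps_smult[OF assms(3)]) auto
  then show ?thesis
    using linear_maps_closed[OF assms(3)] by simp
qed

lemma linear_maps_neg:
  assumes "module R M" "module R N" "f \<in> linear_maps R M N" "x \<in> carrier M"
  shows "f (\<ominus>\<^bsub>M\<^esub> x) = \<ominus>\<^bsub>N\<^esub> f x"
proof -
  interpret M: module R M by fact
  interpret N: module R N by fact
  have "f ((\<ominus>\<^bsub>R\<^esub> \<one>\<^bsub>R\<^esub>) \<odot>\<^bsub>M\<^esub> x) = (\<ominus>\<^bsub>R\<^esub> \<one>\<^bsub>R\<^esub>) \<odot>\<^bsub>N\<^esub> f x"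
    by (rule linear_maps_smult[OF assms(3)]) (use assms in auto)
  then show ?thesis
    using linear_maps_closed[OF assms(3,4)] assms(4)
    by (simp add: M.smult_l_minus N.smult_l_minus)
qed

lemma linear_maps_minus:
  assumes "module R M" "module R N" "f \<in> linear_maps R M N" "x \<in> carrier M" "y \<in> carrier M"
  shows "f (x \<ominus>\<^bsub>M\<^esub> y) = f x \<ominus>\<^bsub>N\<^esub> f y"
proof -
  interpret M: module R M by fact
  show ?thesis
    using assms by (simp add: a_minus_def linear_maps_add linear_maps_neg)
qed

lemma linear_maps_compose:
  assumes "module R M" "f \<in> linear_maps R M N" "g \<in> linear_maps R N P"
  shows "compose (carrier M) g f \<in> linear_maps R M P"
  unfolding compose_def
  by (rule linear_maps_restrictI[OF assms(1)])
    (use assms in \<open>simp_all add: linear_maps_closed linear_maps_add linear_maps_smult\<close>)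

lemma linear_maps_eqI:
  assumes "f \<in> linear_maps R M N" "g \<in> linear_maps R M P"
    and "\<And>x. x \<in> carrier M \<Longrightarrow> f x = g x"
  shows "f = g"
proof (rule extensionalityI[of _ "carrier M"])
  show "f \<in> extensional (carrier M)" "g \<in> extensional (carrier M)"
    using assms(1,2) by (auto simp: linear_maps_def PiE_def)
qed (fact assms(3))

text \<open>
  The value at \<open>y\<close> is read off at an arbitrary preimage of \<open>y\<close>; two preimages differ by an
  element of the kernel of \<open>q\<close>, which \<open>f\<close> does not see.
\<close>

lemma linear_maps_factor:
  assumes mods: "module R M" "module R Q" "module R P"
    and q: "q \<in> linear_maps R M Q" and surj: "q ` carrier M = carrier Q"
    and f: "f \<in> linear_maps R M P"
    and ker: "\<And>x. \<lbrakk>x \<in> carrier M; q x = \<zero>\<^bsub>Q\<^esub>\<rbrakk> \<Longrightarrow> f x = \<zero>\<^bsub>P\<^esub>"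
  shows "\<exists>g \<in> linear_maps R Q P. \<forall>x \<in> carrier M. g (q x) = f x"
proof -
  interpret M: module R M by fact
  interpret Q: module R Q by fact
  interpret P: module R P by fact
  have eq: "f x = f y" if "x \<in> carrier M" "y \<in> carrier M" "q x = q y" for x y
  proof -
    have "q (x \<ominus>\<^bsub>M\<^esub> y) = \<zero>\<^bsub>Q\<^esub>"
      using that q linear_maps_closed[OF q]
      by (simp add: linear_maps_minus[OF mods(1,2) q] Q.minus_eq_zero_iff)
    then have "f (x \<ominus>\<^bsub>M\<^esub> y) = \<zero>\<^bsub>P\<^esub>"
      using that by (intro ker) auto
    then show ?thesis
      using that linear_maps_closed[OF f]
      by (simp add: linear_maps_minus[OF mods(1,3) f] P.minus_eq_zero_iff)
  qed
  define s where "s y = (SOME x. x \<in> carrier M \<and> q x = y)" for y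
  have s: "s y \<in> carrier M \<and> q (s y) = y" if "y \<in> carrier Q" for y
  proof -
    have "y \<in> q ` carrier M"
      using that surj by simp
    then have "\<exists>x. x \<in> carrier M \<and> q x = y"
      by fastforce
    then show ?thesis
      unfolding s_def by (rule someI_ex)
  qed
  have fs: "f (s (q x)) = f x" if "x \<in> carrier M" for x
    using s[OF linear_maps_closed[OF q that]] that eq by blast
  have "(\<lambda>y\<in>carrier Q. f (s y)) \<in> linear_maps R Q P"
  proof (rule linear_maps_restrictI[OF mods(2)])
    show "f (s y) \<in> carrier P" if "y \<in> carrier Q" for y
      using s[OF that] f by (simp add: linear_maps_closed)
    show "f (s (x \<oplus>\<^bsub>Q\<^esub> y)) = f (s x) \<oplus>\<^bsub>P\<^esub> f (s y)" if "x \<in> carrier Q" "y \<in> carrier Q" for x y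
      using fs[of "s x \<oplus>\<^bsub>M\<^esub> s y"] s[OF that(1)] s[OF that(2)]
      by (simp add: linear_maps_add[OF q] linear_maps_add[OF f])
    show "f (s (r \<odot>\<^bsub>Q\<^esub> x)) = r \<odot>\<^bsub>P\<^esub> f (s x)" if "r \<in> carrier R" "x \<in> carrier Q" for r x
      using fs[of "r \<odot>\<^bsub>M\<^esub> s x"] s[OF that(2)] that
      by (simp add: linear_maps_smult[OF q] linear_maps_smult[OF f])
  qed
  then show ?thesis
    by (rule bexI[rotated]) (use fs linear_maps_closed[OF q] in auto)
qed

lemma submodule_vimage:
  assumes "module R M" "module R N" "f \<in> linear_maps R M N" "submodule H R N"
  shows "submodule {x \<in> carrier M. f x \<in> H} R M"
proof -
  interpret M: module R M by fact
  interpret N: module R N by fact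
  show ?thesis
    by (rule M.submoduleI_closed)
      (use assms in \<open>auto simp: linear_maps_zero linear_maps_add linear_maps_smult
         N.submodule_zero dest: N.submoduleE(4,5)\<close>)
qed

lemma submodule_image:
  assumes "module R M" "module R N" "f \<in> linear_maps R M N" "submodule H R M"
  shows "submodule (f ` H) R N"
proof -
  interpret M: module R M by fact
  interpret N: module R N by fact
  note H = M.submoduleE[OF assms(4)]
  show ?thesis
  proof (rule N.submoduleI_closed)
    show "f ` H \<subseteq> carrier N"
      using H(1) linear_maps_closed[OF assms(3)] by auto
    show "\<zero>\<^bsub>N\<^esub> \<in> f ` H"
      using linear_maps_zero[OF assms(1-3)] M.submodule_zero[OF assms(4)] by force
    show "a \<oplus>\<^bsub>N\<^esub> b \<in> f ` H" if ab: "a \<in> f ` H" "b \<in> f ` H" for a b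
    proof -
      obtain x y where "x \<in> H" "a = f x" "y \<in> H" "b = f y"
        using ab by auto
      then show ?thesis
        using H(1,5) linear_maps_add[OF assms(3), of x y] subsetD[OF H(1)] by (intro image_eqI[of _ _ "x \<oplus>\<^bsub>M\<^esub> y"]) auto
    qed
    show "r \<odot>\<^bsub>N\<^esub> b \<in> f ` H" if rb: "r \<in> carrier R" "b \<in> f ` H" for r b
    proof -
      obtain x where "x \<in> H" "b = f x"
        using rb(2) by auto
      then show ?thesis
        using rb(1) H(1,4) linear_maps_smult[OF assms(3), of r x] subsetD[OF H(1)]
        by (intro image_eqI[of _ _ "r \<odot>\<^bsub>M\<^esub> x"]) auto
    qed
  qed
qed

lemma submodule_equalizer:
  assumes "module R M" "module R N" "f \<in> linear_maps R M N" "g \<in> linear_maps R M N"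
  shows "submodule {x \<in> carrier M. f x = g x} R M"
proof -
  interpret M: module R M by fact
  show ?thesis
    by (rule M.submoduleI_closed)
      (use assms in \<open>auto simp: linear_maps_zero linear_maps_add linear_maps_smult\<close>)
qed

lemma submodule_a_kernel:
  assumes "module R M" "module R N" "f \<in> linear_maps R M N"
  shows "submodule (a_kernel M N f) R M"
proof -
  interpret M: module R M by fact
  interpret N: module R N by fact
  show ?thesis
    unfolding a_kernel_def'
    by (rule M.submoduleI_closed)
      (use assms in \<open>auto simp: linear_maps_zero linear_maps_add linear_maps_smult\<close>)
qed

lemma span_inc: "x \<in> A \<Longrightarrow> x \<in> submodule_span R M A"
  unfolding submodule_span_def by (rule hull_inc)

lemma span_minimal: "\<lbrakk>A \<subseteq> H; submodule H R M\<rbrakk> \<Longrightarrow> submodule_span R M A \<subseteq> H"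
  unfolding submodule_span_def by (rule hull_minimal)

lemma span_mono: "A \<subseteq> B \<Longrightarrow> submodule_span R M A \<subseteq> submodule_span R M B"
  unfolding submodule_span_def by (rule hull_mono)

lemma (in module) span_submodule:
  assumes "A \<subseteq> carrier M"
  shows "submodule (submodule_span R M A) R M"
proof (rule submoduleI_closed)
  show "submodule_span R M A \<subseteq> carrier M"
    by (rule span_minimal[OF assms carrier_is_submodule])
qed (auto simp: submodule_span_def hull_def intro: submodule_zero submoduleE(4,5))

lemma span_image:
  assumes "module R M" "module R N" "f \<in> linear_maps R M N" "A \<subseteq> carrier M"
  shows "f ` submodule_span R M A = submodule_span R N (f ` A)"
proof
  interpret M: module R M by fact
  interpret N: module R N by fact
  have fA: "f ` A \<subseteq> carrier N"
    using assms(4) linear_maps_closed[OF assms(3)] by auto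
  have "submodule_span R M A \<subseteq> {x \<in> carrier M. f x \<in> submodule_span R N (f ` A)}"
    by (rule span_minimal)
      (use assms(4) in \<open>auto intro: span_inc submodule_vimage[OF assms(1-3)] N.span_submodule[OF fA]\<close>)
  then show "f ` submodule_span R M A \<subseteq> submodule_span R N (f ` A)"
    by auto
  show "submodule_span R N (f ` A) \<subseteq> f ` submodule_span R M A"
    by (rule span_minimal)
      (auto intro: span_inc submodule_image[OF assms(1-3)] M.span_submodule[OF assms(4)])
qed

lemma linear_maps_eq_on_span:
  assumes "module R M" "module R N" "f \<in> linear_maps R M N" "g \<in> linear_maps R M N"
    and A: "A \<subseteq> carrier M" "\<And>x. x \<in> A \<Longrightarrow> f x = g x"
    and x: "x \<in> submodule_span R M A"
  shows "f x = g x"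
  using span_minimal[OF _ submodule_equalizer[OF assms(1-4)], of A] A x by auto

lemma (in abelian_group) minus_cancel:
  assumes "a \<in> carrier G" "b \<in> carrier G"
  shows "(a \<oplus> b) \<ominus> a = b" "(a \<oplus> b) \<ominus> b = a" "a \<oplus> (b \<ominus> a) = b" "b \<ominus> (b \<ominus> a) = a"
proof -
  show 1: "(a \<oplus> b) \<ominus> b = a"
    using assms by (simp add: a_minus_def a_assoc r_neg)
  show "(a \<oplus> b) \<ominus> a = b"
    using assms a_comm[OF assms] by (simp add: a_minus_def a_assoc r_neg)
  show 2: "a \<oplus> (b \<ominus> a) = b"
    using assms a_comm[of a "b \<oplus> \<ominus> a"] by (simp add: a_minus_def a_assoc l_neg)
  have "(a \<oplus> (b \<ominus> a)) \<ominus> (b \<ominus> a) = a"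
    using assms by (simp add: a_minus_def a_assoc r_neg)
  then show "b \<ominus> (b \<ominus> a) = a"
    unfolding 2 .
qed

lemma abelian_sum_zero_iff:
  assumes "abelian_group P" "a \<in> carrier P" "b \<in> carrier P" "c \<in> carrier P"
  shows "\<ominus>\<^bsub>P\<^esub> a \<oplus>\<^bsub>P\<^esub> (b \<oplus>\<^bsub>P\<^esub> c) = \<zero>\<^bsub>P\<^esub> \<longleftrightarrow> c = a \<ominus>\<^bsub>P\<^esub> b"
proof -
  interpret P: abelian_group P by fact
  have "\<ominus>\<^bsub>P\<^esub> a \<oplus>\<^bsub>P\<^esub> (b \<oplus>\<^bsub>P\<^esub> c) = c \<oplus>\<^bsub>P\<^esub> \<ominus>\<^bsub>P\<^esub> (a \<ominus>\<^bsub>P\<^esub> b)"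
    using assms by (simp add: a_minus_def P.minus_add P.a_ac)
  also have "\<dots> = \<zero>\<^bsub>P\<^esub> \<longleftrightarrow> c = a \<ominus>\<^bsub>P\<^esub> b"
    using assms by (metis P.minus_closed P.a_inv_closed P.minus_equality P.minus_minus P.r_neg)
  finally show ?thesis .
qed

lemma mem_set_add_iff: "z \<in> H <+>\<^bsub>M\<^esub> K \<longleftrightarrow> (\<exists>h \<in> H. \<exists>k \<in> K. z = h \<oplus>\<^bsub>M\<^esub> k)"
  by (simp add: set_add_def set_mult_def)

lemma submodule_set_add:
  assumes "module R M" "submodule H R M" "submodule K R M"
  shows "submodule (H <+>\<^bsub>M\<^esub> K) R M"
proof -
  interpret M: module R M by fact
  note H = M.submoduleE(1,4,5)[OF assms(2)] and K = M.submoduleE(1,4,5)[OF assms(3)]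
  note z = M.submodule_zero[OF assms(2)] M.submodule_zero[OF assms(3)]
  show ?thesis
  proof (rule M.submoduleI_closed)
    show "H <+>\<^bsub>M\<^esub> K \<subseteq> carrier M"
      using subsetD[OF H(1)] subsetD[OF K(1)] by (auto simp: mem_set_add_iff)
    show "\<zero>\<^bsub>M\<^esub> \<in> H <+>\<^bsub>M\<^esub> K"
      unfolding mem_set_add_iff by (rule bexI[OF _ z(1)], rule bexI[OF _ z(2)]) simp
  next
    fix a b assume "a \<in> H <+>\<^bsub>M\<^esub> K" "b \<in> H <+>\<^bsub>M\<^esub> K"
    then obtain h k h' k' where *: "h \<in> H" "k \<in> K" "h' \<in> H" "k' \<in> K"
      and ab: "a = h \<oplus>\<^bsub>M\<^esub> k" "b = h' \<oplus>\<^bsub>M\<^esub> k'"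
      by (auto simp: mem_set_add_iff)
    have "a \<oplus>\<^bsub>M\<^esub> b = (h \<oplus>\<^bsub>M\<^esub> h') \<oplus>\<^bsub>M\<^esub> (k \<oplus>\<^bsub>M\<^esub> k')"
      unfolding ab using * subsetD[OF H(1)] subsetD[OF K(1)] by (simp add: M.a_ac)
    then show "a \<oplus>\<^bsub>M\<^esub> b \<in> H <+>\<^bsub>M\<^esub> K"
      unfolding mem_set_add_iff using H(3)[OF *(1,3)] K(3)[OF *(2,4)] by blast
  next
    fix r a assume r: "r \<in> carrier R" and "a \<in> H <+>\<^bsub>M\<^esub> K"
    then obtain h k where *: "h \<in> H" "k \<in> K" and a: "a = h \<oplus>\<^bsub>M\<^esub> k"
      by (auto simp: mem_set_add_iff)
    have "r \<odot>\<^bsub>M\<^esub> a = r \<odot>\<^bsub>M\<^esub> h \<oplus>\<^bsub>M\<^esub> r \<odot>\<^bsub>M\<^esub> k"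
      unfolding a using * r subsetD[OF H(1)] subsetD[OF K(1)] by (simp add: M.smult_r_distr)
    then show "r \<odot>\<^bsub>M\<^esub> a \<in> H <+>\<^bsub>M\<^esub> K"
      unfolding mem_set_add_iff using H(2)[OF r *(1)] K(2)[OF r *(2)] by blast
  qed
qed

lemma bilinear_op_cong:
  assumes "carrier M' = carrier M" "add M' = add M" "smult M' = smult M"
  shows "bilinear_op R M' b \<longleftrightarrow> bilinear_op R M b"
  unfolding bilinear_op_def by (simp add: assms)

lemma bilinear_op_linear:
  assumes "module R M" "bilinear_op R M b" "v \<in> carrier M"
  shows "(\<lambda>u\<in>carrier M. b u v) \<in> linear_maps R M M" "(\<lambda>u\<in>carrier M. b v u) \<in> linear_maps R M M"
  by (rule linear_maps_restrictI[OF assms(1)];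
      use assms(2,3) in \<open>simp add: bilinear_op_def\<close>)+

text \<open>
  Fixing one argument turns the claim into the comparison of two linear maps on a spanning set.
\<close>

lemma bilinear_op_eqI:
  assumes M: "module R M" and b: "bilinear_op R M b" and c: "bilinear_op R M c"
    and span: "carrier M = submodule_span R M A"
    and eq: "\<And>u v. \<lbrakk>u \<in> A; v \<in> A\<rbrakk> \<Longrightarrow> b u v = c u v"
    and uv: "u \<in> carrier M" "v \<in> carrier M"
  shows "b u v = c u v"
proof -
  have A: "A \<subseteq> carrier M"
    unfolding span by (intro subsetI span_inc)
  have 1: "b u v = c u v" if u: "u \<in> carrier M" and v: "v \<in> A" for u v
  proof -
    have vM: "v \<in> carrier M"
      using v A by blast
    have "(\<lambda>u\<in>carrier M. b u v) u = (\<lambda>u\<in>carrier M. c u v) u"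
      by (rule linear_maps_eq_on_span[OF M M bilinear_op_linear(1)[OF M b vM] bilinear_op_linear(1)[OF M c vM] A])
        (use A eq v u span in auto)
    then show ?thesis
      using u by simp
  qed
  have "(\<lambda>v\<in>carrier M. b u v) v = (\<lambda>v\<in>carrier M. c u v) v"
    by (rule linear_maps_eq_on_span[OF M M bilinear_op_linear(2)[OF M b uv(1)] bilinear_op_linear(2)[OF M c uv(1)] A])
      (use A 1 uv span in auto)
  then show ?thesis
    using uv by simp
qed

lemma set_add_cong: "add M = add N \<Longrightarrow> set_add M = set_add N"
  by (simp add: fun_eq_iff set_add_def set_mult_def)

lemma a_r_coset_cong: "add M = add N \<Longrightarrow> a_r_coset M = a_r_coset N"
  by (simp add: fun_eq_iff a_r_coset_def r_coset_def)

lemma linear_maps_cong: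
  assumes "carrier M' = carrier M" "add M' = add M" "smult M' = smult M"
    and "carrier N' = carrier N" "add N' = add N" "smult N' = smult N"
  shows "linear_maps R M' N' = linear_maps R M N"
  unfolding linear_maps_def by (simp add: assms)

lemma submodule_cong:
  assumes "module R M" "carrier M' = carrier M" "add M' = add M" "zero M' = zero M" "smult M' = smult M"
    and "submodule N R M"
  shows "submodule N R M'"
proof -
  interpret M: module R M by fact
  interpret M': module R M'
    by (rule module_cong) fact+
  show ?thesis
    by (rule M'.submoduleI_closed)
      (use M.submoduleE(1,4,5)[OF assms(6)] M.submodule_zero[OF assms(6)] in \<open>simp_all add: assms(2-5)\<close>)
qed

text \<open>
  The tensor powers and the non-abelian tensor product are built by adding record fields to a quotient
  module; this and the preceding congruences carry module theory across such extensions.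
\<close>

lemma submodule_span_cong:
  assumes "module R M" "carrier M' = carrier M" "add M' = add M" "zero M' = zero M" "smult M' = smult M"
  shows "submodule_span R M' A = submodule_span R M A"
proof -
  have "submodule N R M' \<longleftrightarrow> submodule N R M" for N
    using submodule_cong[OF assms, of N] submodule_cong[OF module_cong[OF assms], of M N] assms
    by auto
  then show ?thesis
    by (simp add: submodule_span_def)
qed

section \<open>Quotients\<close>

lemma quot_mod_simps [simp]:
  "carrier (quot_mod M N) = a_rcosets\<^bsub>M\<^esub> N"
  "zero (quot_mod M N) = N"
  "add (quot_mod M N) = set_add M"
  by (simp_all add: quot_mod_def)

lemma a_rcosets_eq: "a_rcosets\<^bsub>M\<^esub> N = (\<lambda>x. N +>\<^bsub>M\<^esub> x) ` carrier M"
  by (auto simp: A_RCOSETS_def RCOSETS_def a_r_coset_def)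

context
  fixes R :: "('r, 'x) ring_scheme" and M :: "('r, 'a, 'y) module_scheme" and N
  assumes M: "module R M" and N: "submodule N R M"
begin

interpretation M: module R M by (rule M)
interpretation N: abelian_subgroup N M by (rule M.submodule_abelian_subgroup[OF N])

lemma coset_eq_iff:
  assumes "x \<in> carrier M" "y \<in> carrier M"
  shows "N +>\<^bsub>M\<^esub> x = N +>\<^bsub>M\<^esub> y \<longleftrightarrow> x \<ominus>\<^bsub>M\<^esub> y \<in> N"
  using assms N.a_rcos_module[of y x] N.a_repr_independence'[of x y] N.a_rcos_self[of x]
  by (auto simp: a_minus_def)

lemma coset_eq_zero_iff:
  assumes "x \<in> carrier M"
  shows "N +>\<^bsub>M\<^esub> x = N \<longleftrightarrow> x \<in> N"
  using assms N.a_rcos_self N.a_rcos_const by auto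

text \<open>
  The scalar multiple of a coset is a union of cosets; all the cosets united here coincide.
\<close>

lemma quot_smult:
  assumes "r \<in> carrier R" "x \<in> carrier M"
  shows "r \<odot>\<^bsub>quot_mod M N\<^esub> (N +>\<^bsub>M\<^esub> x) = N +>\<^bsub>M\<^esub> (r \<odot>\<^bsub>M\<^esub> x)"
proof -
  have "N +>\<^bsub>M\<^esub> (r \<odot>\<^bsub>M\<^esub> y) = N +>\<^bsub>M\<^esub> (r \<odot>\<^bsub>M\<^esub> x)" if y: "y \<in> N +>\<^bsub>M\<^esub> x" for y
  proof -
    have yM: "y \<in> carrier M"
      using y assms N.a_elemrcos_carrier by blast
    have "y \<ominus>\<^bsub>M\<^esub> x \<in> N"
      using y assms(2) yM by (simp add: N.a_rcos_module a_minus_def)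
    then have "r \<odot>\<^bsub>M\<^esub> (y \<ominus>\<^bsub>M\<^esub> x) \<in> N"
      using M.submoduleE(4)[OF N] assms by blast
    then have "(r \<odot>\<^bsub>M\<^esub> y) \<ominus>\<^bsub>M\<^esub> (r \<odot>\<^bsub>M\<^esub> x) \<in> N"
      using assms yM by (simp add: a_minus_def M.smult_r_distr M.smult_r_minus)
    then show ?thesis
      using coset_eq_iff assms yM by simp
  qed
  then have "(\<Union>y \<in> N +>\<^bsub>M\<^esub> x. N +>\<^bsub>M\<^esub> (r \<odot>\<^bsub>M\<^esub> y)) = (\<Union>y \<in> N +>\<^bsub>M\<^esub> x. N +>\<^bsub>M\<^esub> (r \<odot>\<^bsub>M\<^esub> x))"
    by (intro SUP_cong refl)
  also have "\<dots> = N +>\<^bsub>M\<^esub> (r \<odot>\<^bsub>M\<^esub> x)"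
    using N.a_rcos_self[OF assms(2)] by (subst UN_constant) auto
  finally show ?thesis
    by (simp add: quot_mod_def)
qed

lemma quot_module: "module R (quot_mod M N)"
proof -
  interpret Q: comm_group "M A_Mod N"
    by (rule N.a_factorgroup_is_comm_group)
  have *: "carrier (M A_Mod N) = a_rcosets\<^bsub>M\<^esub> N" "one (M A_Mod N) = N"
    by (simp_all add: A_FactGroup_def')
  have "abelian_group (quot_mod M N)"
  proof (rule abelian_groupI)
    show "\<exists>y\<in>carrier (quot_mod M N). y \<oplus>\<^bsub>quot_mod M N\<^esub> x = \<zero>\<^bsub>quot_mod M N\<^esub>"
      if "x \<in> carrier (quot_mod M N)" for x
      using that Q.l_inv_ex[of x] by (auto simp: *)
  qed (use Q.m_closed Q.one_closed Q.m_assoc Q.m_comm Q.l_one in \<open>simp_all add: *\<close>)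
  then show ?thesis
    by (intro moduleI M.is_cring)
      (auto simp: a_rcosets_eq quot_smult N.a_rcos_sum M.smult_l_distr M.smult_r_distr M.smult_assoc1)
qed

lemma quot_proj_linear:
  "(\<lambda>x\<in>carrier M. N +>\<^bsub>M\<^esub> x) \<in> linear_maps R M (quot_mod M N)"
  by (rule linear_maps_restrictI[OF M]) (auto simp: a_rcosets_eq N.a_rcos_sum quot_smult)

lemma quot_lift:
  assumes "module R P" "f \<in> linear_maps R M P" "\<And>x. x \<in> N \<Longrightarrow> f x = \<zero>\<^bsub>P\<^esub>"
  shows "\<exists>g \<in> linear_maps R (quot_mod M N) P. \<forall>x \<in> carrier M. g (N +>\<^bsub>M\<^esub> x) = f x"
  using linear_maps_factor[OF M quot_module assms(1) quot_proj_linear _ assms(2)] assms(3)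
  by (auto simp: a_rcosets_eq coset_eq_zero_iff)

end

section \<open>Free modules\<close>

lemma free_mod_simps [simp]:
  "carrier (free_mod R S) =
    {f. (\<forall>s. f s \<in> carrier R) \<and> finite {s. f s \<noteq> \<zero>\<^bsub>R\<^esub>} \<and> {s. f s \<noteq> \<zero>\<^bsub>R\<^esub>} \<subseteq> S}"
  "\<zero>\<^bsub>free_mod R S\<^esub> = (\<lambda>_. \<zero>\<^bsub>R\<^esub>)"
  "f \<oplus>\<^bsub>free_mod R S\<^esub> g = (\<lambda>s. f s \<oplus>\<^bsub>R\<^esub> g s)"
  "r \<odot>\<^bsub>free_mod R S\<^esub> f = (\<lambda>s. r \<otimes>\<^bsub>R\<^esub> f s)"
  by (simp_all add: free_mod_def)

context cring
begin

lemma free_mod_add_closed: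
  assumes "f \<in> carrier (free_mod R S)" "g \<in> carrier (free_mod R S)"
  shows "f \<oplus>\<^bsub>free_mod R S\<^esub> g \<in> carrier (free_mod R S)"
proof -
  have "{s. f s \<oplus> g s \<noteq> \<zero>} \<subseteq> {s. f s \<noteq> \<zero>} \<union> {s. g s \<noteq> \<zero>}"
    using assms by auto
  then show ?thesis
    using assms by (auto intro: finite_subset)
qed

lemma free_mod_smult_closed:
  assumes "r \<in> carrier R" "f \<in> carrier (free_mod R S)"
  shows "r \<odot>\<^bsub>free_mod R S\<^esub> f \<in> carrier (free_mod R S)"
proof -
  have "{s. r \<otimes> f s \<noteq> \<zero>} \<subseteq> {s. f s \<noteq> \<zero>}"
    using assms by auto
  then show ?thesis
    using assms by (auto intro: finite_subset)
qed

lemma free_mod_module: "module R (free_mod R S)"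
proof (intro moduleI is_cring abelian_groupI)
  fix f assume f: "f \<in> carrier (free_mod R S)"
  have "\<ominus> f s = \<zero> \<longleftrightarrow> f s = \<zero>" for s
    using f minus_minus[of "f s"] by auto
  then have "{s. \<ominus> f s \<noteq> \<zero>} = {s. f s \<noteq> \<zero>}"
    by simp
  then have "(\<lambda>s. \<ominus> f s) \<in> carrier (free_mod R S)"
    using f by auto
  moreover have "(\<lambda>s. \<ominus> f s) \<oplus>\<^bsub>free_mod R S\<^esub> f = \<zero>\<^bsub>free_mod R S\<^esub>"
    using f by (auto simp: l_neg)
  ultimately show "\<exists>g\<in>carrier (free_mod R S). g \<oplus>\<^bsub>free_mod R S\<^esub> f = \<zero>\<^bsub>free_mod R S\<^esub>"
    by (intro bexI[of _ "\<lambda>s. \<ominus> f s"])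
next
  show "f \<oplus>\<^bsub>free_mod R S\<^esub> g \<in> carrier (free_mod R S)"
    if "f \<in> carrier (free_mod R S)" "g \<in> carrier (free_mod R S)" for f g
    using free_mod_add_closed that .
  show "r \<odot>\<^bsub>free_mod R S\<^esub> f \<in> carrier (free_mod R S)"
    if "r \<in> carrier R" "f \<in> carrier (free_mod R S)" for r f
    using free_mod_smult_closed that .
qed (auto simp: fun_eq_iff a_ac l_distr r_distr m_assoc)

lemma free_gen_closed: "s \<in> S \<Longrightarrow> free_gen R s \<in> carrier (free_mod R S)"
  by (auto simp: free_gen_def)

text \<open>
  Induction on the size of the support, splitting off one point at a time.
\<close>

lemma free_mod_span: "carrier (free_mod R S) = submodule_span R (free_mod R S) (free_gen R ` S)"
proof -
  interpret F: module R "free_mod R S"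
    by (rule free_mod_module)
  have gen: "free_gen R ` S \<subseteq> carrier (free_mod R S)"
    by (rule image_subsetI) (rule free_gen_closed)
  note H = F.span_submodule[OF gen]
  have "f \<in> submodule_span R (free_mod R S) (free_gen R ` S)"
    if "f \<in> carrier (free_mod R S)" for f
    using that
  proof (induction "card {s. f s \<noteq> \<zero>}" arbitrary: f rule: less_induct)
    case less
    show ?case
    proof (cases "{s. f s \<noteq> \<zero>} = {}")
      case True
      then have "f = \<zero>\<^bsub>free_mod R S\<^esub>"
        by (auto simp: fun_eq_iff)
      then show ?thesis
        using F.submodule_zero[OF H] by simp
    next
      case False
      then obtain s where s: "f s \<noteq> \<zero>"
        by auto
      have sS: "s \<in> S" and fs: "f s \<in> carrier R"
        using less.prems s by auto
      let ?g = "f(s := \<zero>)"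
      have supp: "{t. ?g t \<noteq> \<zero>} = {t. f t \<noteq> \<zero>} - {s}"
        by auto
      have g: "?g \<in> carrier (free_mod R S)"
        using less.prems supp by auto
      have "card {t. ?g t \<noteq> \<zero>} < card {t. f t \<noteq> \<zero>}"
        unfolding supp using s less.prems by (intro card_Diff1_less) auto
      then have 1: "?g \<in> submodule_span R (free_mod R S) (free_gen R ` S)"
        using g by (intro less.hyps) auto
      have 2: "f s \<odot>\<^bsub>free_mod R S\<^esub> free_gen R s \<in> submodule_span R (free_mod R S) (free_gen R ` S)"
        using sS fs by (intro F.submoduleE(4)[OF H] span_inc) auto
      have f: "\<And>t. f t \<in> carrier R"
        using less.prems by auto
      have "f = ?g \<oplus>\<^bsub>free_mod R S\<^esub> (f s \<odot>\<^bsub>free_mod R S\<^esub> free_gen R s)"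
        using f by (auto simp: fun_eq_iff free_gen_def)
      then show ?thesis
        using F.submoduleE(5)[OF H 1 2] by metis
    qed
  qed
  then show ?thesis
    using F.submoduleE(1)[OF H] by blast
qed

lemma free_mod_lift:
  assumes P: "module R P" and \<phi>: "\<And>s. s \<in> S \<Longrightarrow> \<phi> s \<in> carrier P"
  shows "\<exists>g \<in> linear_maps R (free_mod R S) P. \<forall>s \<in> S. g (free_gen R s) = \<phi> s"
proof -
  interpret P: module R P by fact
  interpret F: module R "free_mod R S"
    by (rule free_mod_module)
  define g where "g f = finsum P (\<lambda>s. f s \<odot>\<^bsub>P\<^esub> \<phi> s) {s. f s \<noteq> \<zero>}" for f
  have g: "g f = finsum P (\<lambda>s. f s \<odot>\<^bsub>P\<^esub> \<phi> s) A"
    if "f \<in> carrier (free_mod R S)" "finite A" "A \<subseteq> S" "{s. f s \<noteq> \<zero>} \<subseteq> A" for f A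
    unfolding g_def using that \<phi>
    by (intro P.add.finprod_mono_neutral_cong_left) auto
  have closed: "(\<lambda>s. f s \<odot>\<^bsub>P\<^esub> \<phi> s) \<in> A \<rightarrow> carrier P"
    if "f \<in> carrier (free_mod R S)" "A \<subseteq> S" for f A
    using that \<phi> by auto
  have "(\<lambda>f\<in>carrier (free_mod R S). g f) \<in> linear_maps R (free_mod R S) P"
  proof (rule linear_maps_restrictI[OF free_mod_module])
    show "g f \<in> carrier P" if "f \<in> carrier (free_mod R S)" for f
      unfolding g_def by (rule P.finsum_closed, rule closed) (use that in auto)
  next
    fix f h assume fh: "f \<in> carrier (free_mod R S)" "h \<in> carrier (free_mod R S)"
    let ?A = "{s. f s \<noteq> \<zero>} \<union> {s. h s \<noteq> \<zero>}"
    have A: "finite ?A" "?A \<subseteq> S"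
      using fh by auto
    have supp: "{s. (f \<oplus>\<^bsub>free_mod R S\<^esub> h) s \<noteq> \<zero>} \<subseteq> ?A"
      using fh by auto
    have "g (f \<oplus>\<^bsub>free_mod R S\<^esub> h) = finsum P (\<lambda>s. (f \<oplus>\<^bsub>free_mod R S\<^esub> h) s \<odot>\<^bsub>P\<^esub> \<phi> s) ?A"
      by (rule g[OF free_mod_add_closed[OF fh] A supp])
    also have "\<dots> = finsum P (\<lambda>s. f s \<odot>\<^bsub>P\<^esub> \<phi> s \<oplus>\<^bsub>P\<^esub> h s \<odot>\<^bsub>P\<^esub> \<phi> s) ?A"
      using fh A(2) \<phi> by (intro P.finsum_cong' refl) (auto simp: P.smult_l_distr)
    also have "\<dots> = g f \<oplus>\<^bsub>P\<^esub> g h"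
      using P.finsum_addf[OF closed[OF fh(1) A(2)] closed[OF fh(2) A(2)]]
        g[OF fh(1) A] g[OF fh(2) A] by auto
    finally show "g (f \<oplus>\<^bsub>free_mod R S\<^esub> h) = g f \<oplus>\<^bsub>P\<^esub> g h" .
  next
    fix r f assume r: "r \<in> carrier R" and f: "f \<in> carrier (free_mod R S)"
    let ?A = "{s. f s \<noteq> \<zero>}"
    have A: "finite ?A" "?A \<subseteq> S"
      using f by auto
    have supp: "{s. (r \<odot>\<^bsub>free_mod R S\<^esub> f) s \<noteq> \<zero>} \<subseteq> ?A"
      using r by auto
    have "g (r \<odot>\<^bsub>free_mod R S\<^esub> f) = finsum P (\<lambda>s. (r \<odot>\<^bsub>free_mod R S\<^esub> f) s \<odot>\<^bsub>P\<^esub> \<phi> s) ?A"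
      by (rule g[OF free_mod_smult_closed[OF r f] A supp])
    also have "\<dots> = finsum P (\<lambda>s. r \<odot>\<^bsub>P\<^esub> (f s \<odot>\<^bsub>P\<^esub> \<phi> s)) ?A"
      using f r A(2) \<phi> by (intro P.finsum_cong' refl) (auto simp: P.smult_assoc1)
    also have "\<dots> = r \<odot>\<^bsub>P\<^esub> g f"
      unfolding g_def by (rule P.finsum_smult_ldistr[symmetric, OF A(1) r closed[OF f A(2)]])
    finally show "g (r \<odot>\<^bsub>free_mod R S\<^esub> f) = r \<odot>\<^bsub>P\<^esub> g f" .
  qed
  moreover have "g (free_gen R s) = \<phi> s" if "s \<in> S" for s
  proof -
    have "g (free_gen R s) = finsum P (\<lambda>t. free_gen R s t \<odot>\<^bsub>P\<^esub> \<phi> t) {s}"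
      by (rule g[OF free_gen_closed[OF that]]) (use that in \<open>auto simp: free_gen_def\<close>)
    also have "\<dots> = \<phi> s"
      using \<phi>[OF that] by (simp add: free_gen_def)
    finally show ?thesis .
  qed
  ultimately show ?thesis
    by (intro bexI[of _ "\<lambda>f\<in>carrier (free_mod R S). g f"] ballI)
      (simp_all add: free_gen_closed del: free_mod_simps)
qed

end

section \<open>Tensor powers\<close>

lemma with_grade_simps [simp]:
  "carrier (with_grade M g) = carrier M"
  "add (with_grade M g) = add M"
  "zero (with_grade M g) = zero M"
  "smult (with_grade M g) = smult M"
  "grade (with_grade M g) = g"
  by (simp_all add: with_grade_def module.defs supermodule.defs)

lemma sub_supermodule_simps:
  "carrier (sub_supermodule M K) = K"
  "mult (sub_supermodule M K) = mult M"
  "one (sub_supermodule M K) = one M"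
  "zero (sub_supermodule M K) = zero M"
  "add (sub_supermodule M K) = add M"
  "smult (sub_supermodule M K) = smult M"
  "grade (sub_supermodule M K) = (\<lambda>p. grade M p \<inter> K)"
  by (simp_all add: sub_supermodule_def with_grade_def module.defs supermodule.defs)

text \<open>
  The format is that of the relations which define the tensor power, so that a multilinear map kills
  them by definition.
\<close>

definition multilinear ::
    "('r, 'x) ring_scheme \<Rightarrow> ('r, 'a, 'y) module_scheme \<Rightarrow> nat \<Rightarrow> ('r, 'b, 'z) module_scheme
      \<Rightarrow> ('a list \<Rightarrow> 'b) \<Rightarrow> bool"
  where "multilinear R M n P \<phi> \<longleftrightarrow>
    (\<forall>xs \<in> tensor_lists M n. \<phi> xs \<in> carrier P) \<and>
    (\<forall>us x y vs. us @ [x] @ vs \<in> tensor_lists M n \<longrightarrow> y \<in> carrier M \<longrightarrow>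
       \<phi> (us @ [x \<oplus>\<^bsub>M\<^esub> y] @ vs) = \<phi> (us @ [x] @ vs) \<oplus>\<^bsub>P\<^esub> \<phi> (us @ [y] @ vs)) \<and>
    (\<forall>us r x vs. us @ [x] @ vs \<in> tensor_lists M n \<longrightarrow> r \<in> carrier R \<longrightarrow>
       \<phi> (us @ [r \<odot>\<^bsub>M\<^esub> x] @ vs) = r \<odot>\<^bsub>P\<^esub> \<phi> (us @ [x] @ vs))"

lemma multilinear_closed: "\<lbrakk>multilinear R M n P \<phi>; xs \<in> tensor_lists M n\<rbrakk> \<Longrightarrow> \<phi> xs \<in> carrier P"
  by (simp add: multilinear_def)

lemma multilinear_addD:
  "\<lbrakk>multilinear R M n P \<phi>; us @ [x] @ vs \<in> tensor_lists M n; y \<in> carrier M\<rbrakk>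
    \<Longrightarrow> \<phi> (us @ [x \<oplus>\<^bsub>M\<^esub> y] @ vs) = \<phi> (us @ [x] @ vs) \<oplus>\<^bsub>P\<^esub> \<phi> (us @ [y] @ vs)"
  by (simp add: multilinear_def del: append_Cons)

lemma multilinear_smultD:
  "\<lbrakk>multilinear R M n P \<phi>; us @ [x] @ vs \<in> tensor_lists M n; r \<in> carrier R\<rbrakk>
    \<Longrightarrow> \<phi> (us @ [r \<odot>\<^bsub>M\<^esub> x] @ vs) = r \<odot>\<^bsub>P\<^esub> \<phi> (us @ [x] @ vs)"
  by (simp add: multilinear_def del: append_Cons)

lemma tensor_lists_append:
  "us @ [x] @ vs \<in> tensor_lists M n \<longleftrightarrow>
    set us \<subseteq> carrier M \<and> x \<in> carrier M \<and> set vs \<subseteq> carrier M \<and> length us + 1 + length vs = n"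
  by (auto simp: tensor_lists_def)

text \<open>
  The generators of the relations, named apart from their span: a linear map kills the span as soon as
  it kills these.
\<close>

definition tensor_generators ::
    "('r, 'x) ring_scheme \<Rightarrow> ('r, 'a, 'y) module_scheme \<Rightarrow> nat \<Rightarrow> ('a list \<Rightarrow> 'r) set"
  where "tensor_generators R M n =
    (let F = free_mod R (tensor_lists M n); e = free_gen R in
      {e (us @ [x \<oplus>\<^bsub>M\<^esub> y] @ vs) \<ominus>\<^bsub>F\<^esub> (e (us @ [x] @ vs) \<oplus>\<^bsub>F\<^esub> e (us @ [y] @ vs)) | us x y vs.
          us @ [x] @ vs \<in> tensor_lists M n \<and> y \<in> carrier M} \<union>
       {e (us @ [r \<odot>\<^bsub>M\<^esub> x] @ vs) \<ominus>\<^bsub>F\<^esub> r \<odot>\<^bsub>F\<^esub> e (us @ [x] @ vs) | us r x vs.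
          us @ [x] @ vs \<in> tensor_lists M n \<and> r \<in> carrier R})"

lemma tensor_rels_eq:
  "tensor_rels R M n = submodule_span R (free_mod R (tensor_lists M n)) (tensor_generators R M n)"
  by (simp add: tensor_rels_def tensor_generators_def Let_def)

context
  fixes R :: "('r, 'x) ring_scheme" and M :: "('r, 'a, 'y) supermodule_scheme"
  assumes M: "module R M"
begin

interpretation M: module R M by (rule M)

private abbreviation (input) F where "F n \<equiv> free_mod R (tensor_lists M n)"
private abbreviation (input) e where "e \<equiv> free_gen R"

private lemma F: "module R (F n)"
  by (rule M.free_mod_module)

private lemma e_closed: "xs \<in> tensor_lists M n \<Longrightarrow> e xs \<in> carrier (F n)"
  by (rule M.free_gen_closed)

private lemma lists:
  assumes "us @ [x] @ vs \<in> tensor_lists M n"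
  shows "y \<in> carrier M \<Longrightarrow> us @ [y] @ vs \<in> tensor_lists M n"
    and "y \<in> carrier M \<Longrightarrow> us @ [x \<oplus>\<^bsub>M\<^esub> y] @ vs \<in> tensor_lists M n"
    and "r \<in> carrier R \<Longrightarrow> us @ [r \<odot>\<^bsub>M\<^esub> x] @ vs \<in> tensor_lists M n"
  using assms by (simp_all add: tensor_lists_append del: append_Cons)

private lemma tensor_generators_closed: "tensor_generators R M n \<subseteq> carrier (F n)"
proof -
  interpret F: module R "F n" by (rule F)
  show ?thesis
    unfolding tensor_generators_def Let_def
    by (safe; intro F.minus_closed F.add.m_closed F.smult_closed e_closed; 
        (assumption | rule lists(2), assumption, assumption | rule lists(3), assumption, assumption
          | rule lists(1), assumption, assumption))
qed

private lemma tensor_rels_submodule: "submodule (tensor_rels R M n) R (F n)"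
  unfolding tensor_rels_eq by (rule module.span_submodule[OF F tensor_generators_closed])

lemma tensor_power_simps:
  "carrier (tensor_power R M n) = carrier (quot_mod (F n) (tensor_rels R M n))"
  "add (tensor_power R M n) = add (quot_mod (F n) (tensor_rels R M n))"
  "zero (tensor_power R M n) = zero (quot_mod (F n) (tensor_rels R M n))"
  "smult (tensor_power R M n) = smult (quot_mod (F n) (tensor_rels R M n))"
  by (simp_all only: tensor_power_def Let_def with_grade_simps)

lemma tensor_power_module: "module R (tensor_power R M n)"
  by (rule module_cong[OF quot_module[OF F tensor_rels_submodule]]) (rule tensor_power_simps)+

lemma grade_tensor_power:
  "grade (tensor_power R M n) p = submodule_span R (tensor_power R M n)
    {pure_tensor R M xs | xs ps. length xs = n \<and> has_degrees M xs ps \<and> sum_list ps = p}"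
  by (subst submodule_span_cong[OF quot_module[OF F tensor_rels_submodule] tensor_power_simps])
    (simp only: tensor_power_def Let_def with_grade_simps)

private definition proj where
  "proj n = (\<lambda>x \<in> carrier (F n). tensor_rels R M n +>\<^bsub>F n\<^esub> x)"

private lemma proj_linear: "proj n \<in> linear_maps R (F n) (tensor_power R M n)"
  using quot_proj_linear[OF F tensor_rels_submodule, of n]
  by (simp add: proj_def linear_maps_cong[OF refl refl refl tensor_power_simps(1,2,4)] del: free_mod_simps quot_mod_simps)

private lemma proj_surj: "proj n ` carrier (F n) = carrier (tensor_power R M n)"
  by (simp add: proj_def tensor_power_simps a_rcosets_eq del: free_mod_simps)

private lemma proj_e: "xs \<in> tensor_lists M n \<Longrightarrow> proj n (e xs) = pure_tensor R M xs"
  using e_closed[of xs n] by (auto simp: proj_def pure_tensor_def tensor_lists_def simp del: free_mod_simps)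

private lemma proj_eqI:
  assumes "x \<in> carrier (F n)" "y \<in> carrier (F n)" "x \<ominus>\<^bsub>F n\<^esub> y \<in> tensor_generators R M n"
  shows "proj n x = proj n y"
proof -
  have "x \<ominus>\<^bsub>F n\<^esub> y \<in> tensor_rels R M n"
    unfolding tensor_rels_eq using assms(3) by (rule span_inc)
  then show ?thesis
    using assms(1,2) coset_eq_iff[OF F tensor_rels_submodule assms(1,2)]
    by (simp add: proj_def del: free_mod_simps)
qed

lemma pure_tensor_closed: "xs \<in> tensor_lists M n \<Longrightarrow> pure_tensor R M xs \<in> carrier (tensor_power R M n)"
  using proj_e linear_maps_closed[OF proj_linear e_closed] by metis

lemma pure_tensor_multilinear: "multilinear R M n (tensor_power R M n) (pure_tensor R M)"
proof -
  interpret F: module R "F n" by (rule F)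
  have add: "pure_tensor R M (us @ [x \<oplus>\<^bsub>M\<^esub> y] @ vs)
      = pure_tensor R M (us @ [x] @ vs) \<oplus>\<^bsub>tensor_power R M n\<^esub> pure_tensor R M (us @ [y] @ vs)"
    if *: "us @ [x] @ vs \<in> tensor_lists M n" "y \<in> carrier M" for us x y vs
  proof -
    note l = *(1) lists(1,2)[OF *]
    note c = l[THEN e_closed]
    have "proj n (e (us @ [x \<oplus>\<^bsub>M\<^esub> y] @ vs)) = proj n (e (us @ [x] @ vs) \<oplus>\<^bsub>F n\<^esub> e (us @ [y] @ vs))"
      by (rule proj_eqI[OF c(3) F.add.m_closed[OF c(1,2)]])
        (use * in \<open>unfold tensor_generators_def Let_def, blast\<close>)
    also have "\<dots> = proj n (e (us @ [x] @ vs)) \<oplus>\<^bsub>tensor_power R M n\<^esub> proj n (e (us @ [y] @ vs))"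
      by (rule linear_maps_add[OF proj_linear c(1,2)])
    finally show ?thesis
      by (simp only: l[THEN proj_e])
  qed
  have smult: "pure_tensor R M (us @ [r \<odot>\<^bsub>M\<^esub> x] @ vs)
      = r \<odot>\<^bsub>tensor_power R M n\<^esub> pure_tensor R M (us @ [x] @ vs)"
    if *: "us @ [x] @ vs \<in> tensor_lists M n" "r \<in> carrier R" for us x r vs
  proof -
    note l = *(1) lists(3)[OF *]
    note c = l[THEN e_closed]
    have "proj n (e (us @ [r \<odot>\<^bsub>M\<^esub> x] @ vs)) = proj n (r \<odot>\<^bsub>F n\<^esub> e (us @ [x] @ vs))"
      by (rule proj_eqI[OF c(2) F.smult_closed[OF *(2) c(1)]])
        (use * in \<open>unfold tensor_generators_def Let_def, blast\<close>)
    also have "\<dots> = r \<odot>\<^bsub>tensor_power R M n\<^esub> proj n (e (us @ [x] @ vs))"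
      by (rule linear_maps_smult[OF proj_linear *(2) c(1)])
    finally show ?thesis
      by (simp only: l[THEN proj_e])
  qed
  show ?thesis
    unfolding multilinear_def
    by (intro conjI ballI allI impI; (rule pure_tensor_closed | rule add | rule smult); assumption)
qed

lemma tensor_power_span:
  "carrier (tensor_power R M n)
    = submodule_span R (tensor_power R M n) (pure_tensor R M ` tensor_lists M n)"
proof -
  have "carrier (tensor_power R M n) = proj n ` submodule_span R (F n) (e ` tensor_lists M n)"
    unfolding proj_surj[symmetric] M.free_mod_span[symmetric] ..
  also have "\<dots> = submodule_span R (tensor_power R M n) (proj n ` e ` tensor_lists M n)"
    by (rule span_image[OF F tensor_power_module proj_linear]) (use e_closed in blast)
  also have "proj n ` e ` tensor_lists M n = pure_tensor R M ` tensor_lists M n"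
    unfolding image_image by (rule image_cong[OF refl proj_e])
  finally show ?thesis .
qed

text \<open>
  The universal property of the tensor power.
\<close>

lemma tensor_power_lift:
  assumes P: "module R P" and \<phi>: "multilinear R M n P \<phi>"
  shows "\<exists>g \<in> linear_maps R (tensor_power R M n) P.
    \<forall>xs \<in> tensor_lists M n. g (pure_tensor R M xs) = \<phi> xs"
proof -
  interpret P: module R P by fact
  interpret F: module R "F n" by (rule F)
  have \<phi>_closed: "\<phi> xs \<in> carrier P" if "xs \<in> tensor_lists M n" for xs
    by (rule multilinear_closed[OF \<phi> that])
  from M.free_mod_lift[OF P \<phi>_closed] obtain f where f: "f \<in> linear_maps R (F n) P"
    and "\<forall>xs \<in> tensor_lists M n. f (e xs) = \<phi> xs" ..
  then have fe: "f (e xs) = \<phi> xs" if "xs \<in> tensor_lists M n" for xs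
    using that by simp
  have "tensor_generators R M n \<subseteq> a_kernel (F n) P f"
  proof
    fix z assume "z \<in> tensor_generators R M n"
    then consider us x y vs where "us @ [x] @ vs \<in> tensor_lists M n" "y \<in> carrier M"
        "z = e (us @ [x \<oplus>\<^bsub>M\<^esub> y] @ vs) \<ominus>\<^bsub>F n\<^esub> (e (us @ [x] @ vs) \<oplus>\<^bsub>F n\<^esub> e (us @ [y] @ vs))"
      | us r x vs where "us @ [x] @ vs \<in> tensor_lists M n" "r \<in> carrier R"
        "z = e (us @ [r \<odot>\<^bsub>M\<^esub> x] @ vs) \<ominus>\<^bsub>F n\<^esub> r \<odot>\<^bsub>F n\<^esub> e (us @ [x] @ vs)"
      unfolding tensor_generators_def Let_def by blast
    then have "f z = \<zero>\<^bsub>P\<^esub>"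
    proof cases
      case 1
      note l = 1(1) lists(1,2)[OF 1(1,2)]
      note c = l[THEN e_closed]
      have "\<phi> (us @ [x \<oplus>\<^bsub>M\<^esub> y] @ vs) = \<phi> (us @ [x] @ vs) \<oplus>\<^bsub>P\<^esub> \<phi> (us @ [y] @ vs)"
        by (rule multilinear_addD[OF \<phi> 1(1,2)])
      then show ?thesis
        unfolding 1(3) linear_maps_minus[OF F P f c(3) F.add.m_closed[OF c(1,2)]]
          linear_maps_add[OF f c(1,2)] l[THEN fe]
        using l[THEN \<phi>_closed] by (simp add: P.minus_eq_zero_iff del: append_Cons)
    next
      case 2
      note l = 2(1) lists(3)[OF 2(1,2)]
      note c = l[THEN e_closed]
      have "\<phi> (us @ [r \<odot>\<^bsub>M\<^esub> x] @ vs) = r \<odot>\<^bsub>P\<^esub> \<phi> (us @ [x] @ vs)"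
        by (rule multilinear_smultD[OF \<phi> 2(1,2)])
      then show ?thesis
        unfolding 2(3) linear_maps_minus[OF F P f c(2) F.smult_closed[OF 2(2) c(1)]]
          linear_maps_smult[OF f 2(2) c(1)] l[THEN fe]
        using l[THEN \<phi>_closed] 2(2) by (simp add: P.minus_eq_zero_iff del: append_Cons)
    qed
    then show "z \<in> a_kernel (F n) P f"
      using \<open>z \<in> tensor_generators R M n\<close> tensor_generators_closed unfolding a_kernel_def' by blast
  qed
  then have "tensor_rels R M n \<subseteq> a_kernel (F n) P f"
    unfolding tensor_rels_eq by (rule span_minimal) (rule submodule_a_kernel[OF F P f])
  then have "f x = \<zero>\<^bsub>P\<^esub>" if "x \<in> tensor_rels R M n" for x
    using that unfolding a_kernel_def' by blast
  from quot_lift[OF F tensor_rels_submodule P f this]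
  obtain g where g: "g \<in> linear_maps R (quot_mod (F n) (tensor_rels R M n)) P"
    and gf: "\<forall>x \<in> carrier (F n). g (tensor_rels R M n +>\<^bsub>F n\<^esub> x) = f x" ..
  have "g \<in> linear_maps R (tensor_power R M n) P"
    using g unfolding linear_maps_cong[OF tensor_power_simps(1,2,4) refl refl refl] .
  moreover have "g (pure_tensor R M xs) = \<phi> xs" if "xs \<in> tensor_lists M n" for xs
    using bspec[OF gf e_closed[OF that]] fe[OF that] that by (simp add: pure_tensor_def tensor_lists_def)
  ultimately show ?thesis
    by blast
qed

end

section \<open>Homogeneous components\<close>

text \<open>
  The projection to the component of degree \<open>p\<close>. The choice is unique because \<open>p\<close> and \<open>p + 1\<close> are the
  two degrees and the components of these degrees meet in zero only.
\<close>

definition homogeneous_part :: "('r, 'a, 'y) supermodule_scheme \<Rightarrow> bit \<Rightarrow> 'a \<Rightarrow> 'a"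
  where "homogeneous_part M p x = (SOME y. y \<in> grade M p \<and> x \<ominus>\<^bsub>M\<^esub> y \<in> grade M (p + 1))"

context supermodule
begin

lemma grade_carrier: "x \<in> grade M p \<Longrightarrow> x \<in> carrier M"
  using submoduleE(1)[OF grade_submodule] by blast

lemma grade_disjoint: "\<lbrakk>x \<in> grade M p; x \<in> grade M (p + 1)\<rbrakk> \<Longrightarrow> x = \<zero>\<^bsub>M\<^esub>"
  using grade_inter by (cases p) auto

lemma homogeneous_part_ex:
  assumes "x \<in> carrier M"
  shows "\<exists>y. y \<in> grade M p \<and> x \<ominus>\<^bsub>M\<^esub> y \<in> grade M (p + 1)"
proof -
  obtain a b where ab: "a \<in> grade M 0" "b \<in> grade M 1" "x = a \<oplus>\<^bsub>M\<^esub> b"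
    using assms grade_sum by (auto simp: mem_set_add_iff)
  note c = ab(1,2)[THEN grade_carrier]
  have "x \<ominus>\<^bsub>M\<^esub> a = b" "x \<ominus>\<^bsub>M\<^esub> b = a"
    using c unfolding ab(3) by (simp_all add: M.minus_cancel)
  then show ?thesis
    using ab(1,2) by (cases p) auto
qed

lemma homogeneous_part_unique:
  assumes x: "x \<in> carrier M" and y: "y \<in> grade M p" "x \<ominus>\<^bsub>M\<^esub> y \<in> grade M (p + 1)"
  shows "homogeneous_part M p x = y"
proof -
  let ?h = "homogeneous_part M p x"
  have h: "?h \<in> grade M p" "x \<ominus>\<^bsub>M\<^esub> ?h \<in> grade M (p + 1)"
    using someI_ex[OF homogeneous_part_ex[OF x, of p]] by (auto simp: homogeneous_part_def)
  note c = h(1)[THEN grade_carrier] y(1)[THEN grade_carrier]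
  have "(x \<ominus>\<^bsub>M\<^esub> y) \<ominus>\<^bsub>M\<^esub> (x \<ominus>\<^bsub>M\<^esub> ?h) = ?h \<ominus>\<^bsub>M\<^esub> y"
    using c x by (simp add: a_minus_def M.minus_add M.a_ac M.r_neg1 M.r_neg2)
  then have "?h \<ominus>\<^bsub>M\<^esub> y \<in> grade M (p + 1)"
    using submodule_minus[OF grade_submodule y(2) h(2)] by simp
  then have "?h \<ominus>\<^bsub>M\<^esub> y = \<zero>\<^bsub>M\<^esub>"
    using submodule_minus[OF grade_submodule h(1) y(1)] grade_disjoint by blast
  then show ?thesis
    using c minus_eq_zero_iff by simp
qed

lemma homogeneous_part_in:
  assumes "x \<in> carrier M"
  shows "homogeneous_part M p x \<in> grade M p"
    and "x \<ominus>\<^bsub>M\<^esub> homogeneous_part M p x \<in> grade M (p + 1)"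
  using someI_ex[OF homogeneous_part_ex[OF assms, of p]] by (auto simp: homogeneous_part_def)

lemma homogeneous_part_closed [simp]:
  "x \<in> carrier M \<Longrightarrow> homogeneous_part M p x \<in> carrier M"
  using homogeneous_part_in(1) grade_carrier by blast

lemma homogeneous_part_add:
  assumes "x \<in> carrier M" "y \<in> carrier M"
  shows "homogeneous_part M p (x \<oplus>\<^bsub>M\<^esub> y) = homogeneous_part M p x \<oplus>\<^bsub>M\<^esub> homogeneous_part M p y"
proof (rule homogeneous_part_unique)
  let ?x = "homogeneous_part M p x" and ?y = "homogeneous_part M p y"
  show "?x \<oplus>\<^bsub>M\<^esub> ?y \<in> grade M p"
    using assms by (intro submoduleE(5)[OF grade_submodule] homogeneous_part_in)
  have "x \<oplus>\<^bsub>M\<^esub> y \<ominus>\<^bsub>M\<^esub> (?x \<oplus>\<^bsub>M\<^esub> ?y) = (x \<ominus>\<^bsub>M\<^esub> ?x) \<oplus>\<^bsub>M\<^esub> (y \<ominus>\<^bsub>M\<^esub> ?y)"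
    using assms by (simp add: a_minus_def M.minus_add M.a_ac)
  also have "\<dots> \<in> grade M (p + 1)"
    using assms by (intro submoduleE(5)[OF grade_submodule] homogeneous_part_in)
  finally show "x \<oplus>\<^bsub>M\<^esub> y \<ominus>\<^bsub>M\<^esub> (?x \<oplus>\<^bsub>M\<^esub> ?y) \<in> grade M (p + 1)" .
qed (use assms in auto)

lemma homogeneous_part_smult:
  assumes "r \<in> carrier R" "x \<in> carrier M"
  shows "homogeneous_part M p (r \<odot>\<^bsub>M\<^esub> x) = r \<odot>\<^bsub>M\<^esub> homogeneous_part M p x"
proof (rule homogeneous_part_unique)
  let ?x = "homogeneous_part M p x"
  show "r \<odot>\<^bsub>M\<^esub> ?x \<in> grade M p"
    using assms by (intro submoduleE(4)[OF grade_submodule] homogeneous_part_in)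
  have "r \<odot>\<^bsub>M\<^esub> x \<ominus>\<^bsub>M\<^esub> r \<odot>\<^bsub>M\<^esub> ?x = r \<odot>\<^bsub>M\<^esub> (x \<ominus>\<^bsub>M\<^esub> ?x)"
    using assms by (simp add: a_minus_def smult_r_distr smult_r_minus)
  also have "\<dots> \<in> grade M (p + 1)"
    using assms by (intro submoduleE(4)[OF grade_submodule] homogeneous_part_in)
  finally show "r \<odot>\<^bsub>M\<^esub> x \<ominus>\<^bsub>M\<^esub> r \<odot>\<^bsub>M\<^esub> ?x \<in> grade M (p + 1)" .
qed (use assms in auto)

lemma homogeneous_part_grade:
  assumes "x \<in> grade M p"
  shows "homogeneous_part M q x = (if q = p then x else \<zero>\<^bsub>M\<^esub>)"
proof (rule homogeneous_part_unique)
  have p: "p = q + 1" if "q \<noteq> p"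
    using that by (cases p; cases q) auto
  show "(if q = p then x else \<zero>\<^bsub>M\<^esub>) \<in> grade M q"
    using assms submodule_zero[OF grade_submodule] by auto
  have "x \<ominus>\<^bsub>M\<^esub> x = \<zero>\<^bsub>M\<^esub>" "x \<ominus>\<^bsub>M\<^esub> \<zero>\<^bsub>M\<^esub> = x"
    using assms[THEN grade_carrier] by (simp_all add: minus_eq_zero_iff) (simp add: a_minus_def)
  then show "x \<ominus>\<^bsub>M\<^esub> (if q = p then x else \<zero>\<^bsub>M\<^esub>) \<in> grade M (q + 1)"
    using assms p submodule_zero[OF grade_submodule] by auto
qed (use assms grade_carrier in auto)

lemma homogeneous_part_sum:
  assumes "x \<in> carrier M"
  shows "homogeneous_part M p x \<oplus>\<^bsub>M\<^esub> homogeneous_part M (p + 1) x = x"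
proof -
  have "x \<ominus>\<^bsub>M\<^esub> (x \<ominus>\<^bsub>M\<^esub> homogeneous_part M p x) = homogeneous_part M p x"
    using assms by (simp add: M.minus_cancel)
  then have "homogeneous_part M (p + 1) x = x \<ominus>\<^bsub>M\<^esub> homogeneous_part M p x"
    using homogeneous_part_in[OF assms, of p] assms
    by (intro homogeneous_part_unique) (auto simp: add.assoc)
  then show ?thesis
    using assms by (simp add: M.minus_cancel)
qed

lemma has_degrees_carrier: "has_degrees M xs ps \<Longrightarrow> set xs \<subseteq> carrier M"
  unfolding has_degrees_def by (induction rule: list_all2_induct) (auto intro: grade_carrier)

text \<open>
  The boundary maps and the Leibniz identity are prescribed on homogeneous elements only, so linear maps
  have to be compared on homogeneous tensors. A pure tensor becomes a sum of homogeneous ones by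
  splitting its factors one after the other; the induction keeps a prefix \<open>us\<close> of factors that are
  homogeneous already.
\<close>

lemma homogeneous_tensors_span:
  "carrier (tensor_power R M n)
    = submodule_span R (tensor_power R M n)
        {pure_tensor R M xs | xs ps. length xs = n \<and> has_degrees M xs ps}"
    (is "_ = submodule_span R ?T ?A")
proof
  interpret T: module R ?T
    by (rule tensor_power_module[OF module_axioms])
  have lists: "xs \<in> tensor_lists M n" if "length xs = n" "has_degrees M xs ps" for xs ps
    using that has_degrees_carrier by (simp add: tensor_lists_def)
  have A: "?A \<subseteq> carrier ?T"
    using lists pure_tensor_closed[OF module_axioms] by blast
  note H = T.span_submodule[OF A]
  have "pure_tensor R M (us @ vs) \<in> submodule_span R ?T ?A"
    if "has_degrees M us ps" "set vs \<subseteq> carrier M" "length us + length vs = n" for us ps vs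
    using that
  proof (induction vs arbitrary: us ps)
    case Nil
    then show ?case
      by (intro span_inc) auto
  next
    case (Cons v vs)
    let ?h = "\<lambda>p. homogeneous_part M p v"
    have v: "v \<in> carrier M"
      using Cons.prems by simp
    have "us @ [?h 0] @ vs \<in> tensor_lists M n" "?h 1 \<in> carrier M"
      unfolding tensor_lists_append using Cons.prems v has_degrees_carrier[of us ps] by auto
    from multilinear_addD[OF pure_tensor_multilinear[OF module_axioms] this]
    have "pure_tensor R M (us @ [?h 0 \<oplus>\<^bsub>M\<^esub> ?h 1] @ vs)
        = pure_tensor R M (us @ [?h 0] @ vs) \<oplus>\<^bsub>?T\<^esub> pure_tensor R M (us @ [?h 1] @ vs)" .
    moreover have "?h 0 \<oplus>\<^bsub>M\<^esub> ?h 1 = v"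
      using homogeneous_part_sum[OF v, of 0] by simp
    moreover have "pure_tensor R M (us @ [?h p] @ vs) \<in> submodule_span R ?T ?A" for p
    proof -
      have "has_degrees M (us @ [?h p]) (ps @ [p])"
        using Cons.prems(1) homogeneous_part_in(1)[OF v]
        by (auto simp: has_degrees_def intro: list_all2_appendI)
      from Cons.IH[OF this] show ?thesis
        using Cons.prems by simp
    qed
    ultimately show ?case
      using T.submoduleE(5)[OF H] by simp
  qed
  from this[of "[]" "[]"] have "pure_tensor R M ` tensor_lists M n \<subseteq> submodule_span R ?T ?A"
    by (auto simp: has_degrees_def tensor_lists_def)
  then show "carrier ?T \<subseteq> submodule_span R ?T ?A"
    by (subst tensor_power_span[OF module_axioms]) (rule span_minimal[OF _ H])
  show "submodule_span R ?T ?A \<subseteq> carrier ?T"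
    by (rule T.submoduleE(1)[OF H])
qed

lemma grade_tensor_power_closed: "grade (tensor_power R M n) p \<subseteq> carrier (tensor_power R M n)"
  unfolding grade_tensor_power[OF module_axioms] homogeneous_tensors_span by (rule span_mono) blast

lemma tensor_power_maps_eqI:
  assumes "module R P" "f \<in> linear_maps R (tensor_power R M n) P" "g \<in> linear_maps R (tensor_power R M n) P"
    and "\<And>xs ps. \<lbrakk>length xs = n; has_degrees M xs ps\<rbrakk> \<Longrightarrow> f (pure_tensor R M xs) = g (pure_tensor R M xs)"
  shows "f = g"
proof (rule linear_maps_eqI[OF assms(2,3)])
  let ?A = "{pure_tensor R M xs | xs ps. length xs = n \<and> has_degrees M xs ps}"
  fix x assume "x \<in> carrier (tensor_power R M n)"
  then have "x \<in> submodule_span R (tensor_power R M n) ?A"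
    using homogeneous_tensors_span by simp
  moreover have "?A \<subseteq> carrier (tensor_power R M n)"
    unfolding homogeneous_tensors_span by (intro subsetI span_inc)
  moreover have "f t = g t" if "t \<in> ?A" for t
    using assms(4) that by auto
  ultimately show "f x = g x"
    by (intro linear_maps_eq_on_span[OF tensor_power_module[OF module_axioms] assms(1-3), of ?A x])
qed

end

section \<open>Multilinear maps of low arity\<close>

context
  fixes R :: "('r, 'x) ring_scheme" and M :: "('r, 'a, 'y) supermodule_scheme"
  assumes M: "module R M"
begin

lemma multilinear_add:
  assumes "module R P" "multilinear R M n P \<phi>" "multilinear R M n P \<psi>"
  shows "multilinear R M n P (\<lambda>xs. \<phi> xs \<oplus>\<^bsub>P\<^esub> \<psi> xs)"
proof -
  interpret M: module R M by (rule M)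
  interpret P: module R P by fact
  have lists: "us @ [y] @ vs \<in> tensor_lists M n"
    if "us @ [x] @ vs \<in> tensor_lists M n" "y \<in> carrier M" for us x y vs
    using that by (simp add: tensor_lists_append del: append_Cons)
  have \<phi>: "\<And>xs. xs \<in> tensor_lists M n \<Longrightarrow> \<phi> xs \<in> carrier P"
    and \<psi>: "\<And>xs. xs \<in> tensor_lists M n \<Longrightarrow> \<psi> xs \<in> carrier P"
    using assms(2,3) by (simp_all add: multilinear_closed)
  show ?thesis
    unfolding multilinear_def
  proof (intro conjI ballI allI impI)
    show "\<phi> xs \<oplus>\<^bsub>P\<^esub> \<psi> xs \<in> carrier P" if "xs \<in> tensor_lists M n" for xs
      using \<phi>[OF that] \<psi>[OF that] by simp
  next
    fix us x y vs assume *: "us @ [x] @ vs \<in> tensor_lists M n" "y \<in> carrier M"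
    have "\<phi> (us @ [x \<oplus>\<^bsub>M\<^esub> y] @ vs) = \<phi> (us @ [x] @ vs) \<oplus>\<^bsub>P\<^esub> \<phi> (us @ [y] @ vs)"
      "\<psi> (us @ [x \<oplus>\<^bsub>M\<^esub> y] @ vs) = \<psi> (us @ [x] @ vs) \<oplus>\<^bsub>P\<^esub> \<psi> (us @ [y] @ vs)"
      by (rule multilinear_addD[OF assms(2) *] multilinear_addD[OF assms(3) *])+
    then show "\<phi> (us @ [x \<oplus>\<^bsub>M\<^esub> y] @ vs) \<oplus>\<^bsub>P\<^esub> \<psi> (us @ [x \<oplus>\<^bsub>M\<^esub> y] @ vs)
        = \<phi> (us @ [x] @ vs) \<oplus>\<^bsub>P\<^esub> \<psi> (us @ [x] @ vs) \<oplus>\<^bsub>P\<^esub> (\<phi> (us @ [y] @ vs) \<oplus>\<^bsub>P\<^esub> \<psi> (us @ [y] @ vs))"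
      using \<phi>[OF *(1)] \<psi>[OF *(1)] \<phi>[OF lists[OF *]] \<psi>[OF lists[OF *]]
      by (simp add: P.a_ac del: append_Cons)
  next
    fix us r x vs assume *: "us @ [x] @ vs \<in> tensor_lists M n" "r \<in> carrier R"
    have "\<phi> (us @ [r \<odot>\<^bsub>M\<^esub> x] @ vs) = r \<odot>\<^bsub>P\<^esub> \<phi> (us @ [x] @ vs)"
      "\<psi> (us @ [r \<odot>\<^bsub>M\<^esub> x] @ vs) = r \<odot>\<^bsub>P\<^esub> \<psi> (us @ [x] @ vs)"
      by (rule multilinear_smultD[OF assms(2) *] multilinear_smultD[OF assms(3) *])+
    then show "\<phi> (us @ [r \<odot>\<^bsub>M\<^esub> x] @ vs) \<oplus>\<^bsub>P\<^esub> \<psi> (us @ [r \<odot>\<^bsub>M\<^esub> x] @ vs)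
        = r \<odot>\<^bsub>P\<^esub> (\<phi> (us @ [x] @ vs) \<oplus>\<^bsub>P\<^esub> \<psi> (us @ [x] @ vs))"
      using \<phi>[OF *(1)] \<psi>[OF *(1)] *(2) by (simp add: P.smult_r_distr del: append_Cons)
  qed
qed

lemma multilinear1I:
  assumes "\<And>x. x \<in> carrier M \<Longrightarrow> \<phi> x \<in> carrier P"
    and "\<And>x y. \<lbrakk>x \<in> carrier M; y \<in> carrier M\<rbrakk> \<Longrightarrow> \<phi> (x \<oplus>\<^bsub>M\<^esub> y) = \<phi> x \<oplus>\<^bsub>P\<^esub> \<phi> y"
    and "\<And>r x. \<lbrakk>r \<in> carrier R; x \<in> carrier M\<rbrakk> \<Longrightarrow> \<phi> (r \<odot>\<^bsub>M\<^esub> x) = r \<odot>\<^bsub>P\<^esub> \<phi> x"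
  shows "multilinear R M 1 P (\<lambda>xs. \<phi> (xs ! 0))"
  unfolding multilinear_def using assms
  by (auto simp: tensor_lists_def length_Suc_conv append_eq_Cons_conv)

lemma multilinear2I:
  assumes "\<And>x y. \<lbrakk>x \<in> carrier M; y \<in> carrier M\<rbrakk> \<Longrightarrow> \<phi> x y \<in> carrier P"
    and "\<And>x y z. \<lbrakk>x \<in> carrier M; y \<in> carrier M; z \<in> carrier M\<rbrakk>
      \<Longrightarrow> \<phi> (x \<oplus>\<^bsub>M\<^esub> y) z = \<phi> x z \<oplus>\<^bsub>P\<^esub> \<phi> y z"
    and "\<And>x y z. \<lbrakk>x \<in> carrier M; y \<in> carrier M; z \<in> carrier M\<rbrakk>
      \<Longrightarrow> \<phi> z (x \<oplus>\<^bsub>M\<^esub> y) = \<phi> z x \<oplus>\<^bsub>P\<^esub> \<phi> z y"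
    and "\<And>r x y. \<lbrakk>r \<in> carrier R; x \<in> carrier M; y \<in> carrier M\<rbrakk>
      \<Longrightarrow> \<phi> (r \<odot>\<^bsub>M\<^esub> x) y = r \<odot>\<^bsub>P\<^esub> \<phi> x y"
    and "\<And>r x y. \<lbrakk>r \<in> carrier R; x \<in> carrier M; y \<in> carrier M\<rbrakk>
      \<Longrightarrow> \<phi> x (r \<odot>\<^bsub>M\<^esub> y) = r \<odot>\<^bsub>P\<^esub> \<phi> x y"
  shows "multilinear R M 2 P (\<lambda>xs. \<phi> (xs ! 0) (xs ! 1))"
proof -
  have split: "(us = [] \<and> (\<exists>b. vs = [b])) \<or> (\<exists>a. us = [a] \<and> vs = [])"
    if "us @ [x] @ vs \<in> tensor_lists M 2" for us x and vs :: "'a list"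
    using that unfolding tensor_lists_append
    by (cases us; cases "tl us"; cases vs; cases "tl vs") auto
  show ?thesis
    unfolding multilinear_def
  proof (intro conjI ballI allI impI)
    show "\<phi> (xs ! 0) (xs ! 1) \<in> carrier P" if "xs \<in> tensor_lists M 2" for xs
      using that assms(1) nth_mem[of _ xs] by (auto simp: tensor_lists_def subset_iff)
  next
    fix us x y vs assume *: "us @ [x] @ vs \<in> tensor_lists M 2" "y \<in> carrier M"
    show "\<phi> ((us @ [x \<oplus>\<^bsub>M\<^esub> y] @ vs) ! 0) ((us @ [x \<oplus>\<^bsub>M\<^esub> y] @ vs) ! 1)
        = \<phi> ((us @ [x] @ vs) ! 0) ((us @ [x] @ vs) ! 1) \<oplus>\<^bsub>P\<^esub> \<phi> ((us @ [y] @ vs) ! 0) ((us @ [y] @ vs) ! 1)"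
      using split[OF *(1)] * assms(2,3) by (auto simp: tensor_lists_def)
  next
    fix us r x vs assume *: "us @ [x] @ vs \<in> tensor_lists M 2" "r \<in> carrier R"
    show "\<phi> ((us @ [r \<odot>\<^bsub>M\<^esub> x] @ vs) ! 0) ((us @ [r \<odot>\<^bsub>M\<^esub> x] @ vs) ! 1)
        = r \<odot>\<^bsub>P\<^esub> \<phi> ((us @ [x] @ vs) ! 0) ((us @ [x] @ vs) ! 1)"
      using split[OF *(1)] * assms(4,5) by (auto simp: tensor_lists_def)
  qed
qed

lemma multilinear3I:
  assumes "\<And>x y z. \<lbrakk>x \<in> carrier M; y \<in> carrier M; z \<in> carrier M\<rbrakk> \<Longrightarrow> \<phi> x y z \<in> carrier P"
    and "\<And>x x' y z. \<lbrakk>x \<in> carrier M; x' \<in> carrier M; y \<in> carrier M; z \<in> carrier M\<rbrakk>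
      \<Longrightarrow> \<phi> (x \<oplus>\<^bsub>M\<^esub> x') y z = \<phi> x y z \<oplus>\<^bsub>P\<^esub> \<phi> x' y z"
    and "\<And>x y y' z. \<lbrakk>x \<in> carrier M; y \<in> carrier M; y' \<in> carrier M; z \<in> carrier M\<rbrakk>
      \<Longrightarrow> \<phi> x (y \<oplus>\<^bsub>M\<^esub> y') z = \<phi> x y z \<oplus>\<^bsub>P\<^esub> \<phi> x y' z"
    and "\<And>x y z z'. \<lbrakk>x \<in> carrier M; y \<in> carrier M; z \<in> carrier M; z' \<in> carrier M\<rbrakk>
      \<Longrightarrow> \<phi> x y (z \<oplus>\<^bsub>M\<^esub> z') = \<phi> x y z \<oplus>\<^bsub>P\<^esub> \<phi> x y z'"
    and "\<And>r x y z. \<lbrakk>r \<in> carrier R; x \<in> carrier M; y \<in> carrier M; z \<in> carrier M\<rbrakk>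
      \<Longrightarrow> \<phi> (r \<odot>\<^bsub>M\<^esub> x) y z = r \<odot>\<^bsub>P\<^esub> \<phi> x y z"
    and "\<And>r x y z. \<lbrakk>r \<in> carrier R; x \<in> carrier M; y \<in> carrier M; z \<in> carrier M\<rbrakk>
      \<Longrightarrow> \<phi> x (r \<odot>\<^bsub>M\<^esub> y) z = r \<odot>\<^bsub>P\<^esub> \<phi> x y z"
    and "\<And>r x y z. \<lbrakk>r \<in> carrier R; x \<in> carrier M; y \<in> carrier M; z \<in> carrier M\<rbrakk>
      \<Longrightarrow> \<phi> x y (r \<odot>\<^bsub>M\<^esub> z) = r \<odot>\<^bsub>P\<^esub> \<phi> x y z"
  shows "multilinear R M 3 P (\<lambda>xs. \<phi> (xs ! 0) (xs ! 1) (xs ! 2))"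
proof -
  have split: "(us = [] \<and> (\<exists>b c. vs = [b, c])) \<or> (\<exists>a b. us = [a] \<and> vs = [b]) \<or> (\<exists>a b. us = [a, b] \<and> vs = [])"
    if "us @ [x] @ vs \<in> tensor_lists M 3" for us x and vs :: "'a list"
    using that unfolding tensor_lists_append
    by (cases us; cases "tl us"; cases "tl (tl us)"; cases vs; cases "tl vs"; cases "tl (tl vs)") auto
  show ?thesis
    unfolding multilinear_def
  proof (intro conjI ballI allI impI)
    show "\<phi> (xs ! 0) (xs ! 1) (xs ! 2) \<in> carrier P" if "xs \<in> tensor_lists M 3" for xs
      using that assms(1) nth_mem[of _ xs] by (auto simp: tensor_lists_def subset_iff)
  next
    fix us x y vs assume *: "us @ [x] @ vs \<in> tensor_lists M 3" "y \<in> carrier M"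
    show "\<phi> ((us @ [x \<oplus>\<^bsub>M\<^esub> y] @ vs) ! 0) ((us @ [x \<oplus>\<^bsub>M\<^esub> y] @ vs) ! 1) ((us @ [x \<oplus>\<^bsub>M\<^esub> y] @ vs) ! 2)
        = \<phi> ((us @ [x] @ vs) ! 0) ((us @ [x] @ vs) ! 1) ((us @ [x] @ vs) ! 2)
          \<oplus>\<^bsub>P\<^esub> \<phi> ((us @ [y] @ vs) ! 0) ((us @ [y] @ vs) ! 1) ((us @ [y] @ vs) ! 2)"
      using split[OF *(1)] * assms(2-4) by (auto simp: tensor_lists_def)
  next
    fix us r x vs assume *: "us @ [x] @ vs \<in> tensor_lists M 3" "r \<in> carrier R"
    show "\<phi> ((us @ [r \<odot>\<^bsub>M\<^esub> x] @ vs) ! 0) ((us @ [r \<odot>\<^bsub>M\<^esub> x] @ vs) ! 1) ((us @ [r \<odot>\<^bsub>M\<^esub> x] @ vs) ! 2)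
        = r \<odot>\<^bsub>P\<^esub> \<phi> ((us @ [x] @ vs) ! 0) ((us @ [x] @ vs) ! 1) ((us @ [x] @ vs) ! 2)"
      using split[OF *(1)] * assms(5-7) by (auto simp: tensor_lists_def)
  qed
qed

lemma pure_tensor2:
  shows "\<lbrakk>x \<in> carrier M; y \<in> carrier M\<rbrakk> \<Longrightarrow> pure_tensor R M [x, y] \<in> carrier (tensor_power R M 2)"
    and "\<lbrakk>x \<in> carrier M; y \<in> carrier M; z \<in> carrier M\<rbrakk> \<Longrightarrow> pure_tensor R M [x \<oplus>\<^bsub>M\<^esub> y, z]
      = pure_tensor R M [x, z] \<oplus>\<^bsub>tensor_power R M 2\<^esub> pure_tensor R M [y, z]"
    and "\<lbrakk>x \<in> carrier M; y \<in> carrier M; z \<in> carrier M\<rbrakk> \<Longrightarrow> pure_tensor R M [z, x \<oplus>\<^bsub>M\<^esub> y]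
      = pure_tensor R M [z, x] \<oplus>\<^bsub>tensor_power R M 2\<^esub> pure_tensor R M [z, y]"
    and "\<lbrakk>r \<in> carrier R; x \<in> carrier M; y \<in> carrier M\<rbrakk> \<Longrightarrow> pure_tensor R M [r \<odot>\<^bsub>M\<^esub> x, y]
      = r \<odot>\<^bsub>tensor_power R M 2\<^esub> pure_tensor R M [x, y]"
    and "\<lbrakk>r \<in> carrier R; x \<in> carrier M; y \<in> carrier M\<rbrakk> \<Longrightarrow> pure_tensor R M [x, r \<odot>\<^bsub>M\<^esub> y]
      = r \<odot>\<^bsub>tensor_power R M 2\<^esub> pure_tensor R M [x, y]"
proof -
  note add = multilinear_addD[OF pure_tensor_multilinear[OF M, of 2]]
    and smult = multilinear_smultD[OF pure_tensor_multilinear[OF M, of 2]]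
  show "\<lbrakk>x \<in> carrier M; y \<in> carrier M\<rbrakk> \<Longrightarrow> pure_tensor R M [x, y] \<in> carrier (tensor_power R M 2)"
    by (rule pure_tensor_closed[OF M]) (simp add: tensor_lists_def)
  show "\<lbrakk>x \<in> carrier M; y \<in> carrier M; z \<in> carrier M\<rbrakk> \<Longrightarrow> pure_tensor R M [x \<oplus>\<^bsub>M\<^esub> y, z]
      = pure_tensor R M [x, z] \<oplus>\<^bsub>tensor_power R M 2\<^esub> pure_tensor R M [y, z]"
    using add[of "[]" x "[z]" y] by (simp add: tensor_lists_def)
  show "\<lbrakk>x \<in> carrier M; y \<in> carrier M; z \<in> carrier M\<rbrakk> \<Longrightarrow> pure_tensor R M [z, x \<oplus>\<^bsub>M\<^esub> y]
      = pure_tensor R M [z, x] \<oplus>\<^bsub>tensor_power R M 2\<^esub> pure_tensor R M [z, y]"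
    using add[of "[z]" x "[]" y] by (simp add: tensor_lists_def)
  show "\<lbrakk>r \<in> carrier R; x \<in> carrier M; y \<in> carrier M\<rbrakk> \<Longrightarrow> pure_tensor R M [r \<odot>\<^bsub>M\<^esub> x, y]
      = r \<odot>\<^bsub>tensor_power R M 2\<^esub> pure_tensor R M [x, y]"
    using smult[of "[]" x "[y]" r] by (simp add: tensor_lists_def)
  show "\<lbrakk>r \<in> carrier R; x \<in> carrier M; y \<in> carrier M\<rbrakk> \<Longrightarrow> pure_tensor R M [x, r \<odot>\<^bsub>M\<^esub> y]
      = r \<odot>\<^bsub>tensor_power R M 2\<^esub> pure_tensor R M [x, y]"
    using smult[of "[x]" y "[]" r] by (simp add: tensor_lists_def)
qed

end

section \<open>Leibniz boundaries in low degrees\<close>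

context cring
begin

lemma super_sign_closed [simp]: "super_sign R p \<in> carrier R"
  by (simp add: super_sign_def)

lemma super_sign_0 [simp]: "super_sign R 0 = \<one>"
  by (simp add: super_sign_def)

lemma super_sign_1 [simp]: "super_sign R 1 = \<ominus> \<one>"
  by (simp add: super_sign_def)

end

lemma (in supermodule) pure_tensor1:
  shows "x \<in> carrier M \<Longrightarrow> pure_tensor R M [x] \<in> carrier (tensor_power R M 1)"
    and "\<lbrakk>x \<in> carrier M; y \<in> carrier M\<rbrakk> \<Longrightarrow> pure_tensor R M [x \<oplus>\<^bsub>M\<^esub> y]
      = pure_tensor R M [x] \<oplus>\<^bsub>tensor_power R M 1\<^esub> pure_tensor R M [y]"
    and "\<lbrakk>r \<in> carrier R; x \<in> carrier M\<rbrakk> \<Longrightarrow> pure_tensor R M [r \<odot>\<^bsub>M\<^esub> x]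
      = r \<odot>\<^bsub>tensor_power R M 1\<^esub> pure_tensor R M [x]"
proof -
  note add = multilinear_addD[OF pure_tensor_multilinear[OF module_axioms, of 1]]
    and smult = multilinear_smultD[OF pure_tensor_multilinear[OF module_axioms, of 1]]
  show "x \<in> carrier M \<Longrightarrow> pure_tensor R M [x] \<in> carrier (tensor_power R M 1)"
    by (rule pure_tensor_closed[OF module_axioms]) (simp add: tensor_lists_def)
  show "\<lbrakk>x \<in> carrier M; y \<in> carrier M\<rbrakk> \<Longrightarrow> pure_tensor R M [x \<oplus>\<^bsub>M\<^esub> y]
      = pure_tensor R M [x] \<oplus>\<^bsub>tensor_power R M 1\<^esub> pure_tensor R M [y]"
    using add[of "[]" x "[]" y] by (simp add: tensor_lists_def)
  show "\<lbrakk>r \<in> carrier R; x \<in> carrier M\<rbrakk> \<Longrightarrow> pure_tensor R M [r \<odot>\<^bsub>M\<^esub> x]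
      = r \<odot>\<^bsub>tensor_power R M 1\<^esub> pure_tensor R M [x]"
    using smult[of "[]" x "[]" r] by (simp add: tensor_lists_def)
qed

lemma (in supermodule) tensor_power1_iso:
  "\<exists>g \<in> linear_maps R (tensor_power R M 1) M. \<forall>x \<in> carrier M. g (pure_tensor R M [x]) = x"
proof -
  have "multilinear R M 1 M (\<lambda>xs. xs ! 0)"
    by (rule multilinear1I[where \<phi> = "\<lambda>x. x"]) (use module_axioms in simp_all)
  from tensor_power_lift[OF module_axioms module_axioms this]
  obtain g where "g \<in> linear_maps R (tensor_power R M 1) M"
    and "\<forall>xs\<in>tensor_lists M 1. g (pure_tensor R M xs) = xs ! 0" ..
  then show ?thesis
    by (intro bexI[of _ g]) (auto simp: tensor_lists_def)
qed

context leibniz_superalgebra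
begin

lemma bracket_closed [simp]:
  "\<lbrakk>x \<in> carrier L; y \<in> carrier L\<rbrakk> \<Longrightarrow> bracket L x y \<in> carrier L"
  using bracket_bilinear unfolding bilinear_op_def by blast

lemma bracket_linear:
  "\<lbrakk>x \<in> carrier L; y \<in> carrier L; z \<in> carrier L\<rbrakk>
    \<Longrightarrow> bracket L (x \<oplus>\<^bsub>L\<^esub> y) z = bracket L x z \<oplus>\<^bsub>L\<^esub> bracket L y z"
  "\<lbrakk>x \<in> carrier L; y \<in> carrier L; z \<in> carrier L\<rbrakk>
    \<Longrightarrow> bracket L z (x \<oplus>\<^bsub>L\<^esub> y) = bracket L z x \<oplus>\<^bsub>L\<^esub> bracket L z y"
  "\<lbrakk>r \<in> carrier R; x \<in> carrier L; y \<in> carrier L\<rbrakk>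
    \<Longrightarrow> bracket L (r \<odot>\<^bsub>L\<^esub> x) y = r \<odot>\<^bsub>L\<^esub> bracket L x y"
  "\<lbrakk>r \<in> carrier R; x \<in> carrier L; y \<in> carrier L\<rbrakk>
    \<Longrightarrow> bracket L x (r \<odot>\<^bsub>L\<^esub> y) = r \<odot>\<^bsub>L\<^esub> bracket L x y"
  using bracket_bilinear unfolding bilinear_op_def by auto

lemma bracket_zero:
  assumes "x \<in> carrier L"
  shows "bracket L \<zero>\<^bsub>L\<^esub> x = \<zero>\<^bsub>L\<^esub>" "bracket L x \<zero>\<^bsub>L\<^esub> = \<zero>\<^bsub>L\<^esub>"
  using bracket_linear(3)[of "\<zero>\<^bsub>R\<^esub>" "\<zero>\<^bsub>L\<^esub>" x] bracket_linear(4)[of "\<zero>\<^bsub>R\<^esub>" x "\<zero>\<^bsub>L\<^esub>"] assms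
  by simp_all

text \<open>
  At most one linear map has the prescribed values, so exhibiting one evaluates the definite description.
\<close>

lemma leibniz_boundary_eqI:
  assumes d: "d \<in> linear_maps R (tensor_power R L n) (tensor_power R L (n - 1))"
    and eq: "\<And>xs ps. \<lbrakk>length xs = n; has_degrees L xs ps\<rbrakk> \<Longrightarrow> d (pure_tensor R L xs) =
      finsum (tensor_power R L (n - 1)) (\<lambda>(i, j). leibniz_boundary_term R L xs ps i j) {(i, j). i < j \<and> j < n}"
  shows "leibniz_boundary R L n = d"
  unfolding leibniz_boundary_def
proof (rule the_equality)
  show "d \<in> linear_maps R (tensor_power R L n) (tensor_power R L (n - 1)) \<and>
       (\<forall>xs ps. length xs = n \<longrightarrow> has_degrees L xs ps \<longrightarrow> d (pure_tensor R L xs) =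
            finsum (tensor_power R L (n - 1)) (\<lambda>(i, j). leibniz_boundary_term R L xs ps i j)
              {(i, j). i < j \<and> j < n})"
    using assms by simp
next
  fix d'
  assume d': "d' \<in> linear_maps R (tensor_power R L n) (tensor_power R L (n - 1)) \<and>
       (\<forall>xs ps. length xs = n \<longrightarrow> has_degrees L xs ps \<longrightarrow> d' (pure_tensor R L xs) =
            finsum (tensor_power R L (n - 1)) (\<lambda>(i, j). leibniz_boundary_term R L xs ps i j)
              {(i, j). i < j \<and> j < n})"
  show "d' = d"
    by (rule tensor_power_maps_eqI[OF tensor_power_module[OF module_axioms] conjunct1[OF d'] d])
      (simp only: d'[THEN conjunct2, rule_format] eq)
qed

lemma leibniz_boundary_2:
  "leibniz_boundary R L 2 \<in> linear_maps R (tensor_power R L 2) (tensor_power R L 1)"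
  "\<And>x y. \<lbrakk>x \<in> carrier L; y \<in> carrier L\<rbrakk>
    \<Longrightarrow> leibniz_boundary R L 2 (pure_tensor R L [x, y]) = pure_tensor R L [bracket L x y]"
proof -
  let ?T = "tensor_power R L 1"
  interpret T: module R ?T by (rule tensor_power_module[OF module_axioms])
  interpret T': module R "tensor_power R L (Suc 0)" by (rule tensor_power_module[OF module_axioms])
  have "multilinear R L 2 ?T (\<lambda>xs. pure_tensor R L [bracket L (xs ! 0) (xs ! 1)])"
    by (rule multilinear2I[where \<phi> = "\<lambda>x y. pure_tensor R L [bracket L x y]"])
      (simp_all add: module_axioms pure_tensor1 bracket_linear del: One_nat_def)
  from tensor_power_lift[OF module_axioms T.module_axioms this]
  obtain d where d: "d \<in> linear_maps R (tensor_power R L 2) ?T"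
    and "\<forall>xs\<in>tensor_lists L 2. d (pure_tensor R L xs) = pure_tensor R L [bracket L (xs ! 0) (xs ! 1)]" ..
  then have val: "d (pure_tensor R L [x, y]) = pure_tensor R L [bracket L x y]"
    if "x \<in> carrier L" "y \<in> carrier L" for x y
    using that by (simp add: tensor_lists_def)
  have "leibniz_boundary R L 2 = d"
  proof (rule leibniz_boundary_eqI)
    show "d \<in> linear_maps R (tensor_power R L 2) (tensor_power R L (2 - 1))"
      using d by simp
    fix xs ps assume "length xs = 2" and deg: "has_degrees L xs ps"
    then obtain x y where xs: "xs = [x, y]"
      by (auto simp: numeral_2_eq_2 length_Suc_conv)
    have c: "x \<in> carrier L" "y \<in> carrier L"
      using has_degrees_carrier[OF deg] by (simp_all add: xs)
    have "{(i, j). i < j \<and> j < 2} = {(0 :: nat, 1 :: nat)}"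
      by auto
    moreover have "{0 <..< 1 :: nat} = {}"
      by auto
    then have "leibniz_boundary_term R L xs ps 0 1 = pure_tensor R L [bracket L x y]"
      using pure_tensor1(1)[OF bracket_closed[OF c]]
      by (simp add: leibniz_boundary_term_def xs numeral_2_eq_2)
    ultimately show "d (pure_tensor R L xs) = finsum (tensor_power R L (2 - 1))
        (\<lambda>(i, j). leibniz_boundary_term R L xs ps i j) {(i, j). i < j \<and> j < 2}"
      using val[OF c] pure_tensor1(1)[OF bracket_closed[OF c]] by (simp add: xs)
  qed
  then show "leibniz_boundary R L 2 \<in> linear_maps R (tensor_power R L 2) ?T"
    and "\<lbrakk>x \<in> carrier L; y \<in> carrier L\<rbrakk>
      \<Longrightarrow> leibniz_boundary R L 2 (pure_tensor R L [x, y]) = pure_tensor R L [bracket L x y]" for x y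
    using d val by simp_all
qed

text \<open>
  The point is that a linear map with the prescribed values exists: the sign
  \<open>(-1)\<close> to the power \<open>\<bar>y\<bar>\<bar>z\<bar>\<close> has to be written as a multilinear expression in arbitrary \<open>y\<close> and \<open>z\<close>. With
  the linear parity involution \<open>k y = y\<^sub>0 - y\<^sub>1\<close> this is
  \<open>[x, z\<^sub>0] \<otimes> y + [x, z\<^sub>1] \<otimes> k y\<close>.
\<close>

lemma leibniz_boundary_3:
  "leibniz_boundary R L 3 \<in> linear_maps R (tensor_power R L 3) (tensor_power R L 2)"
  "\<And>x y z p q r. \<lbrakk>x \<in> grade L p; y \<in> grade L q; z \<in> grade L r\<rbrakk>
    \<Longrightarrow> leibniz_boundary R L 3 (pure_tensor R L [x, y, z]) =
      \<ominus>\<^bsub>tensor_power R L 2\<^esub> pure_tensor R L [bracket L x y, z]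
      \<oplus>\<^bsub>tensor_power R L 2\<^esub> (super_sign R (q * r) \<odot>\<^bsub>tensor_power R L 2\<^esub> pure_tensor R L [bracket L x z, y]
        \<oplus>\<^bsub>tensor_power R L 2\<^esub> pure_tensor R L [x, bracket L y z])"
proof -
  let ?T = "tensor_power R L 2" and ?t = "pure_tensor R L" and ?h = "homogeneous_part L"
  \<comment> \<open>\<open>?k\<close> multiplies elements of degree \<open>q\<close> by \<open>(-1)\<^sup>q\<close>.\<close>
  let ?k = "\<lambda>y. ?h 0 y \<oplus>\<^bsub>L\<^esub> \<ominus>\<^bsub>R\<^esub> \<one>\<^bsub>R\<^esub> \<odot>\<^bsub>L\<^esub> ?h 1 y"
  interpret T: module R ?T by (rule tensor_power_module[OF module_axioms])
  note t = pure_tensor2[OF module_axioms]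
  have smult_swap: "\<ominus>\<^bsub>R\<^esub> \<one>\<^bsub>R\<^esub> \<odot>\<^bsub>?T\<^esub> (r \<odot>\<^bsub>?T\<^esub> u) = r \<odot>\<^bsub>?T\<^esub> (\<ominus>\<^bsub>R\<^esub> \<one>\<^bsub>R\<^esub> \<odot>\<^bsub>?T\<^esub> u)"
    if "r \<in> carrier R" "u \<in> carrier ?T" for r u
    using that by (simp add: T.smult_assoc1[symmetric] R.m_comm)
  define \<phi> where "\<phi> x y z = \<ominus>\<^bsub>R\<^esub> \<one>\<^bsub>R\<^esub> \<odot>\<^bsub>?T\<^esub> ?t [bracket L x y, z]
      \<oplus>\<^bsub>?T\<^esub> ((?t [bracket L x (?h 0 z), y] \<oplus>\<^bsub>?T\<^esub> ?t [bracket L x (?h 1 z), ?k y])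
        \<oplus>\<^bsub>?T\<^esub> ?t [x, bracket L y z])" for x y z
  have "multilinear R L 3 ?T (\<lambda>xs. \<ominus>\<^bsub>R\<^esub> \<one>\<^bsub>R\<^esub> \<odot>\<^bsub>?T\<^esub> ?t [bracket L (xs ! 0) (xs ! 1), xs ! 2])"
    by (rule multilinear3I[where \<phi> = "\<lambda>x y z. \<ominus>\<^bsub>R\<^esub> \<one>\<^bsub>R\<^esub> \<odot>\<^bsub>?T\<^esub> ?t [bracket L x y, z]"])
      (simp_all add: module_axioms t bracket_linear T.smult_r_distr smult_swap)
  moreover have "multilinear R L 3 ?T (\<lambda>xs. ?t [bracket L (xs ! 0) (?h 0 (xs ! 2)), xs ! 1])"
    by (rule multilinear3I[where \<phi> = "\<lambda>x y z. ?t [bracket L x (?h 0 z), y]"])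
      (simp_all add: module_axioms t bracket_linear homogeneous_part_add homogeneous_part_smult)
  moreover have "multilinear R L 3 ?T (\<lambda>xs. ?t [bracket L (xs ! 0) (?h 1 (xs ! 2)), ?k (xs ! 1)])"
    by (rule multilinear3I[where \<phi> = "\<lambda>x y z. ?t [bracket L x (?h 1 z), ?k y]"])
      (simp_all add: module_axioms t bracket_linear homogeneous_part_add homogeneous_part_smult
        T.smult_r_distr smult_swap T.a_ac)
  moreover have "multilinear R L 3 ?T (\<lambda>xs. ?t [xs ! 0, bracket L (xs ! 1) (xs ! 2)])"
    by (rule multilinear3I[where \<phi> = "\<lambda>x y z. ?t [x, bracket L y z]"])
      (simp_all add: module_axioms t bracket_linear)
  ultimately have "multilinear R L 3 ?T (\<lambda>xs. \<phi> (xs ! 0) (xs ! 1) (xs ! 2))"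
    unfolding \<phi>_def by (intro multilinear_add module_axioms T.module_axioms)
  from tensor_power_lift[OF module_axioms T.module_axioms this]
  obtain d where d: "d \<in> linear_maps R (tensor_power R L 3) ?T"
    and "\<forall>xs\<in>tensor_lists L 3. d (?t xs) = \<phi> (xs ! 0) (xs ! 1) (xs ! 2)" ..
  then have val: "d (?t [x, y, z]) = \<phi> x y z"
    if "x \<in> carrier L" "y \<in> carrier L" "z \<in> carrier L" for x y z
    using that by (simp add: tensor_lists_def)
  have zero: "?t [\<zero>\<^bsub>L\<^esub>, u] = \<zero>\<^bsub>?T\<^esub>" if "u \<in> carrier L" for u
    using t(4)[of "\<zero>\<^bsub>R\<^esub>" "\<zero>\<^bsub>L\<^esub>" u] t(1)[of "\<zero>\<^bsub>L\<^esub>" u] that by simp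
  have \<phi>: "\<phi> x y z = \<ominus>\<^bsub>?T\<^esub> ?t [bracket L x y, z]
      \<oplus>\<^bsub>?T\<^esub> (super_sign R (q * r) \<odot>\<^bsub>?T\<^esub> ?t [bracket L x z, y] \<oplus>\<^bsub>?T\<^esub> ?t [x, bracket L y z])"
    if xyz: "x \<in> grade L p" "y \<in> grade L q" "z \<in> grade L r" for x y z p q r
  proof -
    note c = xyz[THEN grade_carrier]
    have "?t [bracket L x (?h 0 z), y] \<oplus>\<^bsub>?T\<^esub> ?t [bracket L x (?h 1 z), ?k y]
        = super_sign R (q * r) \<odot>\<^bsub>?T\<^esub> ?t [bracket L x z, y]"
      using c by (cases q; cases r)
        (simp_all add: homogeneous_part_grade[OF xyz(2)] homogeneous_part_grade[OF xyz(3)]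
          bracket_zero zero t)
    then show ?thesis
      using c by (simp add: \<phi>_def t T.smult_l_minus)
  qed
  have "leibniz_boundary R L 3 = d"
  proof (rule leibniz_boundary_eqI)
    show "d \<in> linear_maps R (tensor_power R L 3) (tensor_power R L (3 - 1))"
      using d by simp
    fix xs ps assume "length xs = 3" and deg: "has_degrees L xs ps"
    then obtain x y z where xs: "xs = [x, y, z]"
      by (auto simp: numeral_3_eq_3 length_Suc_conv)
    with deg obtain p q r where ps: "ps = [p, q, r]"
      and xyz: "x \<in> grade L p" "y \<in> grade L q" "z \<in> grade L r"
      by (auto simp: has_degrees_def list_all2_Cons1)
    note c = xyz[THEN grade_carrier]
    have I: "{(i, j). i < j \<and> j < 3} = {(0 :: nat, 1 :: nat), (0, 2), (1, 2)}"
      by auto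
    have "{0 <..< 2} = {1 :: nat}" "{0 <..< 1 :: nat} = {}" "{1 <..< 2 :: nat} = {}"
      by auto
    then have "leibniz_boundary_term R L xs ps 0 1 = \<ominus>\<^bsub>?T\<^esub> ?t [bracket L x y, z]"
      "leibniz_boundary_term R L xs ps 0 2 = super_sign R (q * r) \<odot>\<^bsub>?T\<^esub> ?t [bracket L x z, y]"
      "leibniz_boundary_term R L xs ps 1 2 = ?t [x, bracket L y z]"
      using c by (simp_all add: leibniz_boundary_term_def xs ps t T.smult_l_minus mult.commute
          numeral_2_eq_2[symmetric])
    then have "finsum ?T (\<lambda>(i, j). leibniz_boundary_term R L xs ps i j) {(i, j). i < j \<and> j < 3}
        = \<ominus>\<^bsub>?T\<^esub> ?t [bracket L x y, z]
      \<oplus>\<^bsub>?T\<^esub> (super_sign R (q * r) \<odot>\<^bsub>?T\<^esub> ?t [bracket L x z, y] \<oplus>\<^bsub>?T\<^esub> ?t [x, bracket L y z])"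
      unfolding I using c by (simp add: t)
    then show "d (?t xs) = finsum (tensor_power R L (3 - 1))
        (\<lambda>(i, j). leibniz_boundary_term R L xs ps i j) {(i, j). i < j \<and> j < 3}"
      using val[OF c] \<phi>[OF xyz] by (simp add: xs)
  qed
  then show "leibniz_boundary R L 3 \<in> linear_maps R (tensor_power R L 3) ?T"
    and "\<lbrakk>x \<in> grade L p; y \<in> grade L q; z \<in> grade L r\<rbrakk>
    \<Longrightarrow> leibniz_boundary R L 3 (?t [x, y, z]) = \<ominus>\<^bsub>?T\<^esub> ?t [bracket L x y, z]
      \<oplus>\<^bsub>?T\<^esub> (super_sign R (q * r) \<odot>\<^bsub>?T\<^esub> ?t [bracket L x z, y] \<oplus>\<^bsub>?T\<^esub> ?t [x, bracket L y z])"
      for x y z p q r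
    using d val \<phi> grade_carrier by simp_all
qed

lemma leibniz_boundaries_2:
  "leibniz_boundaries R L 2 = leibniz_boundary R L 3 ` carrier (tensor_power R L 3)"
  by (simp add: leibniz_boundaries_def)

lemma leibniz_boundaries_submodule:
  "submodule (leibniz_boundaries R L 2) R (tensor_power R L 2)"
  unfolding leibniz_boundaries_2
  using submodule_image[OF tensor_power_module[OF module_axioms] tensor_power_module[OF module_axioms]
      leibniz_boundary_3(1) module.carrier_is_submodule[OF tensor_power_module[OF module_axioms]]] .

end

section \<open>The non-abelian tensor product\<close>

lemma nonab_tensor_simps:
  "carrier (nonab_tensor R L) = carrier (quot_mod (tensor_power R L 2) (leibniz_boundaries R L 2))"
  "add (nonab_tensor R L) = add (quot_mod (tensor_power R L 2) (leibniz_boundaries R L 2))"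
  "zero (nonab_tensor R L) = zero (quot_mod (tensor_power R L 2) (leibniz_boundaries R L 2))"
  "smult (nonab_tensor R L) = smult (quot_mod (tensor_power R L 2) (leibniz_boundaries R L 2))"
  "grade (nonab_tensor R L) p =
    (\<lambda>x. leibniz_boundaries R L 2 +>\<^bsub>tensor_power R L 2\<^esub> x) ` grade (tensor_power R L 2) p"
  "bracket (nonab_tensor R L) = nonab_bracket R L"
  by (simp_all add: nonab_tensor_def nonab_tensor_supermodule_def quot_supermodule_def with_grade_def
      module.defs supermodule.defs leibniz_superalgebra.defs del: quot_mod_simps)

lemma nonab_tensor_supermodule_simps:
  "carrier (nonab_tensor_supermodule R L) = carrier (nonab_tensor R L)"
  "add (nonab_tensor_supermodule R L) = add (nonab_tensor R L)"
  "zero (nonab_tensor_supermodule R L) = zero (nonab_tensor R L)"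
  "smult (nonab_tensor_supermodule R L) = smult (nonab_tensor R L)"
  by (simp_all add: nonab_tensor_def supermodule.defs leibniz_superalgebra.defs)

context leibniz_superalgebra
begin

text \<open>
  In this notation \<open>U\<close> is the non-abelian tensor product \<open>L \<otimes> L\<close> and \<open>t x y\<close> its element \<open>x \<otimes> y\<close>.
\<close>

abbreviation "T2 \<equiv> tensor_power R L 2"
abbreviation "B2 \<equiv> leibniz_boundaries R L 2"
abbreviation "U \<equiv> nonab_tensor R L"
abbreviation "t \<equiv> nonab_pure_tensor R L"

lemma T2_module: "module R T2"
  by (rule tensor_power_module[OF module_axioms])

lemma nonab_module: "module R U"
  by (rule module_cong[OF quot_module[OF T2_module leibniz_boundaries_submodule] nonab_tensor_simps(1-4)])

definition "nonab_proj = (\<lambda>x\<in>carrier T2. B2 +>\<^bsub>T2\<^esub> x)"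

lemma nonab_proj_linear: "nonab_proj \<in> linear_maps R T2 U"
  unfolding nonab_proj_def linear_maps_cong[OF refl refl refl nonab_tensor_simps(1,2,4)]
  by (rule quot_proj_linear[OF T2_module leibniz_boundaries_submodule])

lemma nonab_proj_surj: "nonab_proj ` carrier T2 = carrier U"
  by (simp add: nonab_proj_def nonab_tensor_simps a_rcosets_eq)

lemma nonab_proj_eq_zero_iff: "x \<in> carrier T2 \<Longrightarrow> nonab_proj x = \<zero>\<^bsub>U\<^esub> \<longleftrightarrow> x \<in> B2"
  using coset_eq_zero_iff[OF T2_module leibniz_boundaries_submodule, of x]
  by (simp add: nonab_proj_def nonab_tensor_simps)

lemma nonab_proj_pure: "\<lbrakk>x \<in> carrier L; y \<in> carrier L\<rbrakk> \<Longrightarrow> nonab_proj (pure_tensor R L [x, y]) = t x y"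
  by (simp add: nonab_proj_def nonab_pure_tensor_def pure_tensor2[OF module_axioms])

lemma nonab_pure_linear:
  shows "\<lbrakk>x \<in> carrier L; y \<in> carrier L\<rbrakk> \<Longrightarrow> t x y \<in> carrier U"
    and "\<lbrakk>x \<in> carrier L; y \<in> carrier L; z \<in> carrier L\<rbrakk> \<Longrightarrow> t (x \<oplus>\<^bsub>L\<^esub> y) z = t x z \<oplus>\<^bsub>U\<^esub> t y z"
    and "\<lbrakk>x \<in> carrier L; y \<in> carrier L; z \<in> carrier L\<rbrakk> \<Longrightarrow> t z (x \<oplus>\<^bsub>L\<^esub> y) = t z x \<oplus>\<^bsub>U\<^esub> t z y"
    and "\<lbrakk>r \<in> carrier R; x \<in> carrier L; y \<in> carrier L\<rbrakk> \<Longrightarrow> t (r \<odot>\<^bsub>L\<^esub> x) y = r \<odot>\<^bsub>U\<^esub> t x y"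
    and "\<lbrakk>r \<in> carrier R; x \<in> carrier L; y \<in> carrier L\<rbrakk> \<Longrightarrow> t x (r \<odot>\<^bsub>L\<^esub> y) = r \<odot>\<^bsub>U\<^esub> t x y"
  using linear_maps_closed[OF nonab_proj_linear] linear_maps_add[OF nonab_proj_linear]
    linear_maps_smult[OF nonab_proj_linear]
  by (simp_all add: nonab_proj_pure[symmetric] pure_tensor2[OF module_axioms])

lemma nonab_pure_zero:
  assumes "x \<in> carrier L"
  shows "t \<zero>\<^bsub>L\<^esub> x = \<zero>\<^bsub>U\<^esub>" "t x \<zero>\<^bsub>L\<^esub> = \<zero>\<^bsub>U\<^esub>"
proof -
  interpret U: module R U by (rule nonab_module)
  show "t \<zero>\<^bsub>L\<^esub> x = \<zero>\<^bsub>U\<^esub>" "t x \<zero>\<^bsub>L\<^esub> = \<zero>\<^bsub>U\<^esub>"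
    using nonab_pure_linear(4)[of "\<zero>\<^bsub>R\<^esub>" "\<zero>\<^bsub>L\<^esub>" x] nonab_pure_linear(5)[of "\<zero>\<^bsub>R\<^esub>" x "\<zero>\<^bsub>L\<^esub>"]
      nonab_pure_linear(1) assms by simp_all
qed

text \<open>
  For a bilinear \<open>\<phi>\<close> this says that the induced map on the tensor square vanishes on the image of the
  boundary map in degree three. For the bracket itself it is the Leibniz identity.
\<close>

definition leibniz_balanced :: "('r, 'b, 'z) module_scheme \<Rightarrow> ('a \<Rightarrow> 'a \<Rightarrow> 'b) \<Rightarrow> bool"
  where "leibniz_balanced P \<phi> \<longleftrightarrow>
    (\<forall>p q r. \<forall>x \<in> grade L p. \<forall>y \<in> grade L q. \<forall>z \<in> grade L r.
      \<phi> x (bracket L y z) =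
        \<phi> (bracket L x y) z \<ominus>\<^bsub>P\<^esub> super_sign R (q * r) \<odot>\<^bsub>P\<^esub> \<phi> (bracket L x z) y)"

lemma leibniz_balancedD:
  "\<lbrakk>leibniz_balanced P \<phi>; x \<in> grade L p; y \<in> grade L q; z \<in> grade L r\<rbrakk> \<Longrightarrow> \<phi> x (bracket L y z) =
    \<phi> (bracket L x y) z \<ominus>\<^bsub>P\<^esub> super_sign R (q * r) \<odot>\<^bsub>P\<^esub> \<phi> (bracket L x z) y"
  by (simp add: leibniz_balanced_def)

text \<open>
  The relation is the image of a boundary, which is zero in the quotient.
\<close>

lemma nonab_balanced: "leibniz_balanced U t"
  unfolding leibniz_balanced_def
proof (intro allI ballI)
  interpret U: module R U by (rule nonab_module)
  interpret T: module R T2 by (rule T2_module)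
  fix p q r x y z assume xyz: "x \<in> grade L p" "y \<in> grade L q" "z \<in> grade L r"
  note c = xyz[THEN grade_carrier]
  note T = pure_tensor2[OF module_axioms]
  have "pure_tensor R L [x, y, z] \<in> carrier (tensor_power R L 3)"
    using c by (intro pure_tensor_closed[OF module_axioms]) (simp add: tensor_lists_def)
  then have "leibniz_boundary R L 3 (pure_tensor R L [x, y, z]) \<in> B2"
    unfolding leibniz_boundaries_2 by (rule imageI)
  moreover have "leibniz_boundary R L 3 (pure_tensor R L [x, y, z]) \<in> carrier T2"
    unfolding leibniz_boundary_3(2)[OF xyz] using c by (simp add: T)
  ultimately have "nonab_proj (leibniz_boundary R L 3 (pure_tensor R L [x, y, z])) = \<zero>\<^bsub>U\<^esub>"
    using nonab_proj_eq_zero_iff by blast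
  then have "\<ominus>\<^bsub>U\<^esub> t (bracket L x y) z \<oplus>\<^bsub>U\<^esub>
      (super_sign R (q * r) \<odot>\<^bsub>U\<^esub> t (bracket L x z) y \<oplus>\<^bsub>U\<^esub> t x (bracket L y z)) = \<zero>\<^bsub>U\<^esub>"
    unfolding leibniz_boundary_3(2)[OF xyz] using c
    by (simp add: T linear_maps_add[OF nonab_proj_linear] linear_maps_smult[OF nonab_proj_linear]
        linear_maps_neg[OF T2_module nonab_module nonab_proj_linear] nonab_proj_pure)
  then show "t x (bracket L y z) =
        t (bracket L x y) z \<ominus>\<^bsub>U\<^esub> super_sign R (q * r) \<odot>\<^bsub>U\<^esub> t (bracket L x z) y"
    using c by (simp add: abelian_sum_zero_iff[OF U.abelian_group_axioms] nonab_pure_linear(1))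
qed

text \<open>
  The universal property of the non-abelian tensor product, through which every map out of it is
  constructed.
\<close>

lemma nonab_lift:
  assumes P: "module R P" and ml: "multilinear R L 2 P (\<lambda>xs. \<phi> (xs ! 0) (xs ! 1))"
    and bal: "leibniz_balanced P \<phi>"
  shows "\<exists>g \<in> linear_maps R U P. \<forall>x \<in> carrier L. \<forall>y \<in> carrier L. g (t x y) = \<phi> x y"
proof -
  interpret T: module R T2 by (rule T2_module)
  interpret P: module R P by (rule P)
  note T3 = tensor_power_module[OF module_axioms, of 3]
  have \<phi>: "\<phi> x y \<in> carrier P" if "x \<in> carrier L" "y \<in> carrier L" for x y
    using multilinear_closed[OF ml, of "[x, y]"] that by (simp add: tensor_lists_def)
  from tensor_power_lift[OF module_axioms P ml] obtain f where f: "f \<in> linear_maps R T2 P"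
    and "\<forall>xs\<in>tensor_lists L 2. f (pure_tensor R L xs) = \<phi> (xs ! 0) (xs ! 1)" ..
  then have val: "f (pure_tensor R L [x, y]) = \<phi> x y" if "x \<in> carrier L" "y \<in> carrier L" for x y
    using that by (simp add: tensor_lists_def)
  let ?T3 = "tensor_power R L 3"
  let ?c = "compose (carrier ?T3) f (leibniz_boundary R L 3)" and ?z = "\<lambda>x\<in>carrier ?T3. \<zero>\<^bsub>P\<^esub>"
  have eq: "?c = ?z"
  proof (rule tensor_power_maps_eqI[OF P linear_maps_compose[OF T3 leibniz_boundary_3(1) f]])
    show "?z \<in> linear_maps R ?T3 P"
      by (rule linear_maps_restrictI[OF T3]) simp_all
    fix xs ps assume "length xs = 3" and deg: "has_degrees L xs ps"
    then obtain x y z where xs: "xs = [x, y, z]"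
      by (auto simp: numeral_3_eq_3 length_Suc_conv)
    with deg obtain p q r where xyz: "x \<in> grade L p" "y \<in> grade L q" "z \<in> grade L r"
      by (auto simp: has_degrees_def list_all2_Cons1)
    note c = xyz[THEN grade_carrier]
    have "pure_tensor R L xs \<in> carrier ?T3"
      using c by (intro pure_tensor_closed[OF module_axioms]) (simp add: tensor_lists_def xs)
    moreover have "f (leibniz_boundary R L 3 (pure_tensor R L xs)) = \<zero>\<^bsub>P\<^esub>"
      unfolding xs leibniz_boundary_3(2)[OF xyz] using c
      by (simp add: linear_maps_add[OF f] linear_maps_smult[OF f] linear_maps_neg[OF T2_module P f]
          pure_tensor2[OF module_axioms] val \<phi> abelian_sum_zero_iff[OF P.abelian_group_axioms]
          leibniz_balancedD[OF bal xyz])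
    ultimately show "?c (pure_tensor R L xs) = ?z (pure_tensor R L xs)"
      by (simp add: compose_def)
  qed
  have "f (leibniz_boundary R L 3 x) = \<zero>\<^bsub>P\<^esub>" if "x \<in> carrier ?T3" for x
    using that fun_cong[OF eq, of x] by (simp add: compose_def)
  then have ker: "f b = \<zero>\<^bsub>P\<^esub>" if "b \<in> B2" for b
    using that by (auto simp: leibniz_boundaries_2)
  from quot_lift[OF T2_module leibniz_boundaries_submodule P f ker]
  obtain g where g: "g \<in> linear_maps R (quot_mod T2 B2) P"
    and gf: "\<forall>x \<in> carrier T2. g (B2 +>\<^bsub>T2\<^esub> x) = f x" ..
  have "g \<in> linear_maps R U P"
    using g unfolding linear_maps_cong[OF nonab_tensor_simps(1,2,4) refl refl refl] .
  moreover have "g (t x y) = \<phi> x y" if "x \<in> carrier L" "y \<in> carrier L" for x y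
    using gf that val by (simp add: nonab_pure_tensor_def pure_tensor2[OF module_axioms])
  ultimately show ?thesis
    by blast
qed

lemma nonab_span: "carrier U = submodule_span R U {t x y | x y. x \<in> carrier L \<and> y \<in> carrier L}"
proof -
  have lists: "tensor_lists L 2 = {[x, y] | x y. x \<in> carrier L \<and> y \<in> carrier L}"
    by (auto simp: tensor_lists_def numeral_2_eq_2 length_Suc_conv)
  have sub: "pure_tensor R L ` tensor_lists L 2 \<subseteq> carrier T2"
    using pure_tensor_closed[OF module_axioms] by blast
  have "carrier U = nonab_proj ` submodule_span R T2 (pure_tensor R L ` tensor_lists L 2)"
    unfolding nonab_proj_surj[symmetric] tensor_power_span[OF module_axioms, symmetric] ..
  also have "\<dots> = submodule_span R U (nonab_proj ` pure_tensor R L ` tensor_lists L 2)"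
    by (rule span_image[OF T2_module nonab_module nonab_proj_linear sub])
  also have "nonab_proj ` pure_tensor R L ` tensor_lists L 2 = {t x y | x y. x \<in> carrier L \<and> y \<in> carrier L}"
    unfolding lists
  proof (intro subset_antisym subsetI)
    fix u assume "u \<in> {t x y | x y. x \<in> carrier L \<and> y \<in> carrier L}"
    then obtain x y where *: "u = t x y" "x \<in> carrier L" "y \<in> carrier L"
      by blast
    then have "u = nonab_proj (pure_tensor R L [x, y])"
      by (simp add: nonab_proj_pure)
    then show "u \<in> nonab_proj ` pure_tensor R L ` {[x, y] | x y. x \<in> carrier L \<and> y \<in> carrier L}"
      using * by blast
  next
    fix u assume "u \<in> nonab_proj ` pure_tensor R L ` {[x, y] | x y. x \<in> carrier L \<and> y \<in> carrier L}"
    then obtain x y where *: "u = nonab_proj (pure_tensor R L [x, y])" "x \<in> carrier L" "y \<in> carrier L"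
      by blast
    then show "u \<in> {t x y | x y. x \<in> carrier L \<and> y \<in> carrier L}"
      using nonab_proj_pure[OF *(2,3)] by blast
  qed
  finally show ?thesis .
qed

text \<open>
  The graded components of the quotient are images of spans, hence spans of images.
\<close>

lemma nonab_grade: "grade U p = submodule_span R U
    {t x y | x y q r. x \<in> grade L q \<and> y \<in> grade L r \<and> q + r = p}"
proof -
  let ?A = "{pure_tensor R L xs | xs ps. length xs = 2 \<and> has_degrees L xs ps \<and> sum_list ps = p}"
  have A: "?A = {pure_tensor R L [x, y] | x y q r. x \<in> grade L q \<and> y \<in> grade L r \<and> q + r = p}"
    (is "_ = ?A'")
  proof (intro subset_antisym subsetI)
    fix u assume "u \<in> ?A"
    then obtain xs ps where *: "u = pure_tensor R L xs" "length xs = 2" "has_degrees L xs ps" "sum_list ps = p"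
      by blast
    then obtain x y where xs: "xs = [x, y]"
      by (auto simp: numeral_2_eq_2 length_Suc_conv)
    with * obtain q r where ps: "ps = [q, r]" and xy: "x \<in> grade L q" "y \<in> grade L r"
      by (auto simp: has_degrees_def list_all2_Cons1)
    have "q + r = p"
      using *(4) ps by simp
    then show "u \<in> ?A'"
      using *(1) xs xy by blast
  next
    fix u assume "u \<in> ?A'"
    then obtain x y q r where *: "u = pure_tensor R L [x, y]" "x \<in> grade L q" "y \<in> grade L r" "q + r = p"
      by blast
    then have "length [x, y] = 2 \<and> has_degrees L [x, y] [q, r] \<and> sum_list [q, r] = p"
      by (simp add: has_degrees_def)
    then show "u \<in> ?A"
      using *(1) by blast
  qed
  have sub: "?A \<subseteq> carrier T2"
    unfolding A using pure_tensor2(1)[OF module_axioms] grade_carrier by auto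
  have "grade U p = nonab_proj ` grade T2 p"
    unfolding nonab_tensor_simps(5) nonab_proj_def using grade_tensor_power_closed
    by (intro image_cong) auto
  also have "\<dots> = submodule_span R U (nonab_proj ` ?A)"
    unfolding grade_tensor_power[OF module_axioms]
    by (rule span_image[OF T2_module nonab_module nonab_proj_linear sub])
  also have "nonab_proj ` ?A = {t x y | x y q r. x \<in> grade L q \<and> y \<in> grade L r \<and> q + r = p}"
    unfolding A
  proof (intro subset_antisym subsetI)
    fix u assume "u \<in> nonab_proj ` ?A'"
    then obtain x y q r where *: "u = nonab_proj (pure_tensor R L [x, y])"
      "x \<in> grade L q" "y \<in> grade L r" "q + r = p"
      by blast
    then have "u = t x y"
      using nonab_proj_pure grade_carrier by simp
    then show "u \<in> {t x y | x y q r. x \<in> grade L q \<and> y \<in> grade L r \<and> q + r = p}"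
      using *(2-4) by blast
  next
    fix u assume "u \<in> {t x y | x y q r. x \<in> grade L q \<and> y \<in> grade L r \<and> q + r = p}"
    then obtain x y q r where *: "u = t x y" "x \<in> grade L q" "y \<in> grade L r" "q + r = p"
      by blast
    then have "u = nonab_proj (pure_tensor R L [x, y])"
      using grade_carrier nonab_proj_pure by auto
    then show "u \<in> nonab_proj ` ?A'"
      using * by blast
  qed
  finally show ?thesis .
qed

lemma nonab_pure_grade:
  "\<lbrakk>x \<in> grade L p; y \<in> grade L q\<rbrakk> \<Longrightarrow> t x y \<in> grade U (p + q)"
  unfolding nonab_grade by (rule span_inc) blast

lemma nonab_gradeI:
  assumes "submodule H R U"
    and "\<And>x y q r. \<lbrakk>x \<in> grade L q; y \<in> grade L r; q + r = p\<rbrakk> \<Longrightarrow> t x y \<in> H"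
  shows "grade U p \<subseteq> H"
  unfolding nonab_grade by (rule span_minimal[OF _ assms(1)]) (use assms(2) in blast)

lemma nonab_maps_eqI:
  assumes "module R P" "f \<in> linear_maps R U P" "g \<in> linear_maps R U P"
    and "\<And>x y. \<lbrakk>x \<in> carrier L; y \<in> carrier L\<rbrakk> \<Longrightarrow> f (t x y) = g (t x y)"
  shows "f = g"
proof (rule linear_maps_eqI[OF assms(2,3)])
  fix u assume "u \<in> carrier U"
  then have "u \<in> submodule_span R U {t x y | x y. x \<in> carrier L \<and> y \<in> carrier L}"
    unfolding nonab_span[symmetric] .
  then show "f u = g u"
    by (rule linear_maps_eq_on_span[OF nonab_module assms(1-3), rotated 2])
      (use assms(4) nonab_pure_linear(1) in auto)
qed

text \<open>
  The projections to the graded components, induced by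
  \<open>(x, y) \<mapsto> x\<^sub>0 \<otimes> y\<^sub>p + x\<^sub>1 \<otimes> y\<^bsub>p+1\<^esub>\<close>. They are what makes the sum of the two components direct.
\<close>

lemma nonab_component:
  "\<exists>f \<in> linear_maps R U U. \<forall>x q y r. x \<in> grade L q \<longrightarrow> y \<in> grade L r \<longrightarrow>
    f (t x y) = (if q + r = p then t x y else \<zero>\<^bsub>U\<^esub>)"
proof -
  interpret U: module R U by (rule nonab_module)
  let ?h = "homogeneous_part L"
  define \<phi> where "\<phi> x y = t (?h 0 x) (?h p y) \<oplus>\<^bsub>U\<^esub> t (?h 1 x) (?h (p + 1) y)" for x y
  have \<phi>: "\<phi> x y = (if q + r = p then t x y else \<zero>\<^bsub>U\<^esub>)" if "x \<in> grade L q" "y \<in> grade L r" for x y q r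
    using that[THEN grade_carrier]
    by (cases p; cases q; cases r)
      (simp_all add: \<phi>_def homogeneous_part_grade[OF that(1)] homogeneous_part_grade[OF that(2)]
        nonab_pure_zero nonab_pure_linear(1))
  have ml: "multilinear R L 2 U (\<lambda>xs. \<phi> (xs ! 0) (xs ! 1))"
    by (rule multilinear2I)
      (simp_all add: module_axioms \<phi>_def nonab_pure_linear homogeneous_part_add homogeneous_part_smult
        U.smult_r_distr U.a_ac)
  have "leibniz_balanced U \<phi>"
    unfolding leibniz_balanced_def
  proof (intro allI ballI)
    fix a b c x y z assume xyz: "x \<in> grade L a" "y \<in> grade L b" "z \<in> grade L c"
    have "\<phi> x (bracket L y z) = (if a + b + c = p then t x (bracket L y z) else \<zero>\<^bsub>U\<^esub>)"
      "\<phi> (bracket L x y) z = (if a + b + c = p then t (bracket L x y) z else \<zero>\<^bsub>U\<^esub>)"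
      "\<phi> (bracket L x z) y = (if a + b + c = p then t (bracket L x z) y else \<zero>\<^bsub>U\<^esub>)"
      using \<phi>[OF xyz(1) bracket_even[OF xyz(2,3)]] \<phi>[OF bracket_even[OF xyz(1,2)] xyz(3)]
        \<phi>[OF bracket_even[OF xyz(1,3)] xyz(2)] by (simp_all only: ac_simps)
    then show "\<phi> x (bracket L y z) =
        \<phi> (bracket L x y) z \<ominus>\<^bsub>U\<^esub> super_sign R (b * c) \<odot>\<^bsub>U\<^esub> \<phi> (bracket L x z) y"
      using leibniz_balancedD[OF nonab_balanced xyz] U.minus_eq_zero_iff[of "\<zero>\<^bsub>U\<^esub>" "\<zero>\<^bsub>U\<^esub>"]
      by simp
  qed
  from nonab_lift[OF nonab_module ml this] obtain f where f: "f \<in> linear_maps R U U"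
    and ft: "\<forall>x\<in>carrier L. \<forall>y\<in>carrier L. f (t x y) = \<phi> x y" ..
  show ?thesis
    by (rule bexI[OF _ f]) (use ft \<phi> grade_carrier in auto)
qed

lemma nonab_supermodule: "supermodule R U"
proof -
  interpret U: module R U by (rule nonab_module)
  have closed: "{t x y | x y q r. x \<in> grade L q \<and> y \<in> grade L r \<and> q + r = p} \<subseteq> carrier U" for p
    using nonab_pure_linear(1) grade_carrier by auto
  have sub: "submodule (grade U p) R U" for p
    unfolding nonab_grade by (rule U.span_submodule[OF closed])
  have le: "carrier U \<subseteq> grade U 0 <+>\<^bsub>U\<^esub> grade U 1"
    unfolding nonab_span
  proof (rule span_minimal[OF _ submodule_set_add[OF nonab_module sub sub]], safe)
    fix x y assume xy: "x \<in> carrier L" "y \<in> carrier L"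
    let ?h = "homogeneous_part L"
    have "?h 0 x \<oplus>\<^bsub>L\<^esub> ?h 1 x = x" "?h 0 y \<oplus>\<^bsub>L\<^esub> ?h 1 y = y"
      using homogeneous_part_sum[OF xy(1), of 0] homogeneous_part_sum[OF xy(2), of 0] by simp_all
    then have "t x y = t (?h 0 x \<oplus>\<^bsub>L\<^esub> ?h 1 x) (?h 0 y \<oplus>\<^bsub>L\<^esub> ?h 1 y)"
      by simp
    also have "\<dots> = (t (?h 0 x) (?h 0 y) \<oplus>\<^bsub>U\<^esub> t (?h 1 x) (?h 1 y))
        \<oplus>\<^bsub>U\<^esub> (t (?h 0 x) (?h 1 y) \<oplus>\<^bsub>U\<^esub> t (?h 1 x) (?h 0 y))"
      using xy by (simp add: nonab_pure_linear U.a_ac)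
    finally have "t x y = \<dots>" .
    moreover have "t (?h p x) (?h q y) \<in> grade U (p + q)" for p q
      using xy by (intro nonab_pure_grade homogeneous_part_in)
    from this[of 0 0] this[of 1 1] this[of 0 1] this[of 1 0]
    have "t (?h 0 x) (?h 0 y) \<oplus>\<^bsub>U\<^esub> t (?h 1 x) (?h 1 y) \<in> grade U 0"
      "t (?h 0 x) (?h 1 y) \<oplus>\<^bsub>U\<^esub> t (?h 1 x) (?h 0 y) \<in> grade U 1"
      by (simp_all add: U.submoduleE(5)[OF sub])
    ultimately show "t x y \<in> grade U 0 <+>\<^bsub>U\<^esub> grade U 1"
      unfolding mem_set_add_iff by blast
  qed
  have ge: "grade U 0 <+>\<^bsub>U\<^esub> grade U 1 \<subseteq> carrier U"
    by (rule U.submoduleE(1)[OF submodule_set_add[OF nonab_module sub sub]])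
  have zero: "u = \<zero>\<^bsub>U\<^esub>" if u: "u \<in> grade U 0" "u \<in> grade U 1" for u
  proof -
    from nonab_component[of 0] obtain f where f: "f \<in> linear_maps R U U"
      and ft: "\<forall>x q y r. x \<in> grade L q \<longrightarrow> y \<in> grade L r \<longrightarrow>
        f (t x y) = (if q + r = 0 then t x y else \<zero>\<^bsub>U\<^esub>)" ..
    have id: "(\<lambda>x\<in>carrier U. x) \<in> linear_maps R U U"
      by (rule linear_maps_restrictI[OF nonab_module]) simp_all
    have "grade U 0 \<subseteq> {u \<in> carrier U. f u = (\<lambda>x\<in>carrier U. x) u}"
      by (rule nonab_gradeI[OF submodule_equalizer[OF nonab_module nonab_module f id]])
        (use ft nonab_pure_linear(1) grade_carrier in auto)
    moreover have "grade U 1 \<subseteq> a_kernel U U f"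
      by (rule nonab_gradeI[OF submodule_a_kernel[OF nonab_module nonab_module f]])
        (use ft nonab_pure_linear(1) grade_carrier in \<open>auto simp: a_kernel_def'\<close>)
    ultimately have "f u = (\<lambda>x\<in>carrier U. x) u" "u \<in> carrier U" "f u = \<zero>\<^bsub>U\<^esub>"
      using u unfolding a_kernel_def' by blast+
    then show ?thesis
      by (simp only: restrict_apply')
  qed
  show ?thesis
  proof (intro supermodule.intro nonab_module supermodule_axioms.intro sub)
    show "carrier U = grade U 0 <+>\<^bsub>U\<^esub> grade U 1"
      using le ge by (rule subset_antisym)
    show "grade U 0 \<inter> grade U 1 = {\<zero>\<^bsub>U\<^esub>}"
      using zero U.submodule_zero[OF sub] by blast
  qed
qed

end

section \<open>The bracket of the tensor product\<close>

context leibniz_superalgebra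
begin

abbreviation "\<delta> \<equiv> nonab_delta2 R L"

lemma nonab_delta2_ex:
  "\<exists>d \<in> linear_maps R U L. \<forall>x \<in> carrier L. \<forall>y \<in> carrier L. d (t x y) = bracket L x y"
proof (rule nonab_lift[OF module_axioms])
  show "multilinear R L 2 L (\<lambda>xs. bracket L (xs ! 0) (xs ! 1))"
    by (rule multilinear2I) (simp_all add: module_axioms bracket_linear)
  show "leibniz_balanced L (bracket L)"
    unfolding leibniz_balanced_def using leibniz_identity by blast
qed

lemma nonab_delta2:
  "\<delta> \<in> linear_maps R U L"
  "\<And>x y. \<lbrakk>x \<in> carrier L; y \<in> carrier L\<rbrakk> \<Longrightarrow> \<delta> (t x y) = bracket L x y"
proof -
  from nonab_delta2_ex obtain d where d: "d \<in> linear_maps R U L"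
    and val: "\<forall>x \<in> carrier L. \<forall>y \<in> carrier L. d (t x y) = bracket L x y" ..
  have "\<delta> = d"
    unfolding nonab_delta2_def
  proof (rule the_equality)
    fix d' assume "d' \<in> linear_maps R U L \<and>
      (\<forall>x \<in> carrier L. \<forall>y \<in> carrier L. d' (t x y) = bracket L x y)"
    then show "d' = d"
      using val by (intro nonab_maps_eqI[OF module_axioms _ d]) simp_all
  qed (use d val in simp)
  then show "\<delta> \<in> linear_maps R U L"
    "\<And>x y. \<lbrakk>x \<in> carrier L; y \<in> carrier L\<rbrakk> \<Longrightarrow> \<delta> (t x y) = bracket L x y"
    using d val by simp_all
qed

lemma nonab_delta2_closed [simp]: "u \<in> carrier U \<Longrightarrow> \<delta> u \<in> carrier L"
  by (rule linear_maps_closed[OF nonab_delta2(1)])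

lemma nonab_delta2_grade: "u \<in> grade U p \<Longrightarrow> \<delta> u \<in> grade L p"
proof -
  have "grade U p \<subseteq> {u \<in> carrier U. \<delta> u \<in> grade L p}"
    by (rule nonab_gradeI[OF submodule_vimage[OF nonab_module module_axioms nonab_delta2(1) grade_submodule]])
      (use grade_carrier nonab_pure_linear(1) bracket_even nonab_delta2(2) in auto)
  then show "u \<in> grade U p \<Longrightarrow> \<delta> u \<in> grade L p"
    by blast
qed

lemma nonab_bracket_bilinear: "bilinear_op R U (\<lambda>u\<in>carrier U. \<lambda>v\<in>carrier U. t (\<delta> u) (\<delta> v))"
proof -
  interpret U: module R U by (rule nonab_module)
  show ?thesis
    unfolding bilinear_op_def
    by (simp add: nonab_pure_linear linear_maps_add[OF nonab_delta2(1)] linear_maps_smult[OF nonab_delta2(1)])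
qed

text \<open>
  The prescribed bracket of \<open>x \<otimes> y\<close> and \<open>x' \<otimes> y'\<close> is the pure tensor of their images under \<open>\<delta>\<close>. Hence
  \<open>[u, v] = \<delta> u \<otimes> \<delta> v\<close> is the bracket on all of \<open>U\<close>, and it is well defined without inspecting relations.
\<close>

lemma nonab_bracket_eq: "nonab_bracket R L = (\<lambda>u\<in>carrier U. \<lambda>v\<in>carrier U. t (\<delta> u) (\<delta> v))"
    (is "_ = ?b")
proof -
  let ?P = "\<lambda>b. b \<in> carrier U \<rightarrow>\<^sub>E (carrier U \<rightarrow>\<^sub>E carrier U) \<and> bilinear_op R U b \<and>
       (\<forall>x \<in> carrier L. \<forall>y \<in> carrier L. \<forall>x' \<in> carrier L. \<forall>y' \<in> carrier L.
          b (t x y) (t x' y') = t (bracket L x y) (bracket L x' y'))"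
  have b: "?P ?b"
    using nonab_bracket_bilinear nonab_pure_linear(1) nonab_delta2(2) by auto
  have "(THE b. ?P b) = ?b"
  proof (rule the_equality)
    show "?P ?b"
      by (rule b)
    fix c assume c: "?P c"
    have "c u v = ?b u v" if "u \<in> carrier U" "v \<in> carrier U" for u v
    proof (rule bilinear_op_eqI[OF nonab_module _ nonab_bracket_bilinear nonab_span _ that])
      show "bilinear_op R U c"
        using c by (elim conjE)
      fix u v assume "u \<in> {t x y | x y. x \<in> carrier L \<and> y \<in> carrier L}"
        "v \<in> {t x y | x y. x \<in> carrier L \<and> y \<in> carrier L}"
      then obtain x y x' y' where "u = t x y" "v = t x' y'"
        "x \<in> carrier L" "y \<in> carrier L" "x' \<in> carrier L" "y' \<in> carrier L"
        by blast
      then show "c u v = ?b u v"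
        using c b by simp
    qed
    then have "c u = ?b u" if "u \<in> carrier U" for u
      using c that by (intro extensionalityI[of "c u" "carrier U" "?b u"]) (auto simp: PiE_def Pi_def)
    then show "c = ?b"
      using c by (intro extensionalityI[of c "carrier U" ?b]) (auto simp: PiE_def)
  qed
  then show ?thesis
    by (simp add: nonab_bracket_def Let_def nonab_tensor_supermodule_simps
        bilinear_op_cong[OF nonab_tensor_supermodule_simps(1,2,4)])
qed

lemma nonab_bracket:
  "\<lbrakk>u \<in> carrier U; v \<in> carrier U\<rbrakk> \<Longrightarrow> bracket U u v = t (\<delta> u) (\<delta> v)"
  unfolding nonab_tensor_simps(6) nonab_bracket_eq by simp

text \<open>
  Since \<open>[u, v] = \<delta> u \<otimes> \<delta> v\<close> and \<open>\<delta>\<close> preserves brackets, the Leibniz identity for \<open>u\<close>, \<open>v\<close>, \<open>w\<close> is the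
  defining relation of the non-abelian tensor product for \<open>\<delta> u\<close>, \<open>\<delta> v\<close>, \<open>\<delta> w\<close>.
\<close>

lemma nonab_leibniz_superalgebra: "leibniz_superalgebra R U"
proof -
  interpret U: supermodule R U by (rule nonab_supermodule)
  show ?thesis
  proof (intro leibniz_superalgebra.intro leibniz_superalgebra_axioms.intro nonab_supermodule)
    show "bilinear_op R U (bracket U)"
      unfolding nonab_tensor_simps(6) nonab_bracket_eq by (rule nonab_bracket_bilinear)
  next
    fix u v p q assume uv: "u \<in> grade U p" "v \<in> grade U q"
    then show "bracket U u v \<in> grade U (p + q)"
      using U.grade_carrier by (simp only: nonab_bracket nonab_pure_grade nonab_delta2_grade)
  next
    fix u v w p q r assume uvw: "u \<in> grade U p" "v \<in> grade U q" "w \<in> grade U r"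
    note c = uvw[THEN U.grade_carrier] and d = uvw[THEN nonab_delta2_grade]
    show "bracket U u (bracket U v w) =
        bracket U (bracket U u v) w \<ominus>\<^bsub>U\<^esub> super_sign R (q * r) \<odot>\<^bsub>U\<^esub> bracket U (bracket U u w) v"
      using leibniz_balancedD[OF nonab_balanced d] c
      by (simp only: nonab_bracket nonab_delta2 nonab_pure_linear(1) nonab_delta2_closed bracket_closed)
  qed
qed

section \<open>The central extension\<close>

text \<open>
  The commutator is generated as an ideal, but the span of all brackets already is one: it absorbs
  brackets trivially, and it is graded because a bracket is the sum of the brackets of the homogeneous
  components.
\<close>

lemma perfect_span:
  assumes "perfect R L"
  shows "carrier L = submodule_span R L {bracket L x y | x y. x \<in> carrier L \<and> y \<in> carrier L}"
    (is "_ = submodule_span R L ?A")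
proof -
  let ?N = "submodule_span R L ?A" and ?h = "homogeneous_part L"
  have A: "?A \<subseteq> carrier L"
    by auto
  note N = span_submodule[OF A]
  have NA: "bracket L x y \<in> ?N" if "x \<in> carrier L" "y \<in> carrier L" for x y
    using that by (intro span_inc) blast
  have sub: "submodule (grade L p \<inter> ?N) R L" for p
    by (rule submodule_Int[OF grade_submodule N])
  have "?N \<subseteq> (grade L 0 \<inter> ?N) <+>\<^bsub>L\<^esub> (grade L 1 \<inter> ?N)"
  proof (rule span_minimal[OF _ submodule_set_add[OF module_axioms sub sub]], safe)
    fix x y assume xy: "x \<in> carrier L" "y \<in> carrier L"
    have "?h 0 x \<oplus>\<^bsub>L\<^esub> ?h 1 x = x" "?h 0 y \<oplus>\<^bsub>L\<^esub> ?h 1 y = y"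
      using homogeneous_part_sum[OF xy(1), of 0] homogeneous_part_sum[OF xy(2), of 0] by simp_all
    then have "bracket L x y = bracket L (?h 0 x \<oplus>\<^bsub>L\<^esub> ?h 1 x) (?h 0 y \<oplus>\<^bsub>L\<^esub> ?h 1 y)"
      by simp
    also have "\<dots> = (bracket L (?h 0 x) (?h 0 y) \<oplus>\<^bsub>L\<^esub> bracket L (?h 1 x) (?h 1 y))
        \<oplus>\<^bsub>L\<^esub> (bracket L (?h 0 x) (?h 1 y) \<oplus>\<^bsub>L\<^esub> bracket L (?h 1 x) (?h 0 y))"
      using xy by (simp add: bracket_linear M.a_ac)
    finally have "bracket L x y = \<dots>" .
    moreover have "bracket L (?h p x) (?h q y) \<in> grade L (p + q) \<inter> ?N" for p q
      using xy by (intro IntI bracket_even homogeneous_part_in NA homogeneous_part_closed)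
    from this[of 0 0] this[of 1 1] this[of 0 1] this[of 1 0]
    have "bracket L (?h 0 x) (?h 0 y) \<oplus>\<^bsub>L\<^esub> bracket L (?h 1 x) (?h 1 y) \<in> grade L 0 \<inter> ?N"
      "bracket L (?h 0 x) (?h 1 y) \<oplus>\<^bsub>L\<^esub> bracket L (?h 1 x) (?h 0 y) \<in> grade L 1 \<inter> ?N"
      by (intro submoduleE(5)[OF sub]; simp)+
    ultimately show "bracket L x y \<in> (grade L 0 \<inter> ?N) <+>\<^bsub>L\<^esub> (grade L 1 \<inter> ?N)"
      unfolding mem_set_add_iff by blast
  qed
  moreover have "(grade L 0 \<inter> ?N) <+>\<^bsub>L\<^esub> (grade L 1 \<inter> ?N) \<subseteq> ?N"
    using submoduleE(5)[OF N] unfolding mem_set_add_iff subset_iff by blast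
  ultimately have graded: "?N = (grade L 0 \<inter> ?N) <+>\<^bsub>L\<^esub> (grade L 1 \<inter> ?N)"
    by (rule subset_antisym)
  have closed: "bracket L x y \<in> ?N \<and> bracket L y x \<in> ?N" if "x \<in> ?N" "y \<in> carrier L" for x y
    using that subsetD[OF submoduleE(1)[OF N] that(1)] by (intro conjI NA)
  have "leibniz_ideal R L ?N"
    unfolding leibniz_ideal_def by (intro conjI N graded ballI; use closed in blast)
  then have "commutator R L \<subseteq> ?N"
    unfolding commutator_def by (intro hull_minimal) (auto intro: NA)
  then show ?thesis
    using assms submoduleE(1)[OF N] unfolding perfect_def by (intro subset_antisym) simp_all
qed

lemma nonab_delta2_surj:
  assumes "perfect R L"
  shows "\<delta> ` carrier U = carrier L"
proof -
  let ?A = "{t x y | x y. x \<in> carrier L \<and> y \<in> carrier L}"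
  have "?A \<subseteq> carrier U"
    using nonab_pure_linear(1) by auto
  then have "\<delta> ` carrier U = submodule_span R L (\<delta> ` ?A)"
    using span_image[OF nonab_module module_axioms nonab_delta2(1)] nonab_span by simp
  also have "\<delta> ` ?A = {bracket L x y | x y. x \<in> carrier L \<and> y \<in> carrier L}"
  proof (intro subset_antisym subsetI)
    fix z assume "z \<in> \<delta> ` ?A"
    then obtain x y where "z = \<delta> (t x y)" "x \<in> carrier L" "y \<in> carrier L"
      by blast
    then show "z \<in> {bracket L x y | x y. x \<in> carrier L \<and> y \<in> carrier L}"
      using nonab_delta2(2) by blast
  next
    fix z assume "z \<in> {bracket L x y | x y. x \<in> carrier L \<and> y \<in> carrier L}"
    then obtain x y where "z = bracket L x y" and xy: "x \<in> carrier L" "y \<in> carrier L"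
      by blast
    then have "z = \<delta> (t x y)"
      using nonab_delta2(2) by simp
    then show "z \<in> \<delta> ` ?A"
      using xy by blast
  qed
  also have "submodule_span R L \<dots> = carrier L"
    using perfect_span[OF assms] by simp
  finally show ?thesis .
qed

lemma nonab_delta2_hom: "\<delta> \<in> leibniz_homs R U L"
  unfolding leibniz_homs_def
  using nonab_delta2 nonab_delta2_grade nonab_bracket by auto

text \<open>
  Centrality is immediate from \<open>[u, v] = \<delta> u \<otimes> \<delta> v\<close>, which vanishes as soon as \<open>\<delta> u\<close> or \<open>\<delta> v\<close> does.
\<close>

lemma nonab_central_extension:
  assumes "perfect R L"
  shows "central_extension R U L \<delta>"
proof -
  have "a_kernel U L \<delta> \<subseteq> leibniz_centre U"
    by (auto simp: a_kernel_def' leibniz_centre_def nonab_bracket nonab_pure_zero)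
  then show ?thesis
    unfolding central_extension_def
    using nonab_leibniz_superalgebra leibniz_superalgebra_axioms nonab_delta2_hom nonab_delta2_surj[OF assms]
    by simp
qed

end

section \<open>Universality of the extension\<close>

text \<open>
  Two lifts of the same element differ by a central element. This is why brackets of lifts are
  independent of the choice of the lifts.
\<close>

lemma central_extension_bracket_cong:
  assumes "central_extension R E L \<phi>"
    and "a \<in> carrier E" "a' \<in> carrier E" "b \<in> carrier E" "\<phi> a = \<phi> a'"
  shows "bracket E a b = bracket E a' b" "bracket E b a = bracket E b a'"
proof -
  interpret E: leibniz_superalgebra R E
    using assms(1) by (simp add: central_extension_def)
  interpret L: leibniz_superalgebra R L
    using assms(1) by (simp add: central_extension_def)
  have \<phi>: "\<phi> \<in> linear_maps R E L"
    using assms(1) by (simp add: central_extension_def leibniz_homs_def)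
  have "\<phi> (a \<ominus>\<^bsub>E\<^esub> a') = \<zero>\<^bsub>L\<^esub>"
    using assms linear_maps_closed[OF \<phi>]
    by (simp add: linear_maps_minus[OF E.module_axioms L.module_axioms \<phi>] L.minus_eq_zero_iff)
  then have "a \<ominus>\<^bsub>E\<^esub> a' \<in> leibniz_centre E"
    using assms(1-3) by (auto simp: central_extension_def a_kernel_def')
  then have z: "bracket E (a \<ominus>\<^bsub>E\<^esub> a') b = \<zero>\<^bsub>E\<^esub>" "bracket E b (a \<ominus>\<^bsub>E\<^esub> a') = \<zero>\<^bsub>E\<^esub>"
    using assms(4) by (auto simp: leibniz_centre_def)
  have a: "a = a' \<oplus>\<^bsub>E\<^esub> (a \<ominus>\<^bsub>E\<^esub> a')"
    using assms(2,3) by (simp add: E.M.minus_cancel)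
  show "bracket E a b = bracket E a' b" "bracket E b a = bracket E b a'"
    by (subst a, use assms z in \<open>simp add: E.bracket_linear\<close>)+
qed

text \<open>
  Any lift can be replaced by its component of degree \<open>p\<close>, because \<open>\<phi>\<close> is even.
\<close>

lemma central_extension_homogeneous_lift:
  assumes "central_extension R E L \<phi>" "x \<in> grade L p"
  shows "\<exists>a \<in> grade E p. \<phi> a = x"
proof -
  interpret E: leibniz_superalgebra R E
    using assms(1) by (simp add: central_extension_def)
  interpret L: leibniz_superalgebra R L
    using assms(1) by (simp add: central_extension_def)
  have \<phi>: "\<phi> \<in> linear_maps R E L" and gr: "\<And>p a. a \<in> grade E p \<Longrightarrow> \<phi> a \<in> grade L p"
    and surj: "\<phi> ` carrier E = carrier L"
    using assms(1) by (auto simp: central_extension_def leibniz_homs_def)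
  have xL: "x \<in> carrier L"
    using assms(2) by (rule L.grade_carrier)
  then have "x \<in> \<phi> ` carrier E"
    by (simp only: surj)
  then obtain a where a: "a \<in> carrier E" "x = \<phi> a"
    by blast
  let ?a = "homogeneous_part E p a"
  note h = E.homogeneous_part_in[OF a(1), of p]
  have "x \<ominus>\<^bsub>L\<^esub> \<phi> ?a = \<phi> (a \<ominus>\<^bsub>E\<^esub> ?a)"
    using a by (simp add: linear_maps_minus[OF E.module_axioms L.module_axioms \<phi>])
  \<comment> \<open>So \<open>\<phi> ?a\<close> is the component of degree \<open>p\<close> of \<open>x\<close>, which is \<open>x\<close> itself.\<close>
  then have "x \<ominus>\<^bsub>L\<^esub> \<phi> ?a \<in> grade L (p + 1)"
    using gr[OF h(2)] by (simp only:)
  from L.homogeneous_part_unique[OF xL gr[OF h(1)] this]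
  have "\<phi> ?a = x"
    using L.homogeneous_part_grade[OF assms(2), of p] by simp
  then show ?thesis
    using h(1) by blast
qed

context leibniz_superalgebra
begin

text \<open>
  The map to \<open>E\<close> has to send \<open>x \<otimes> y\<close> to the bracket of lifts of \<open>x\<close> and \<open>y\<close>. As the lifts may be
  chosen freely, this is bilinear, and the Leibniz identity of \<open>E\<close>, applied to homogeneous lifts, makes it
  respect the relations. For uniqueness, \<open>\<delta>\<close> is surjective, so \<open>x \<otimes> y = [u, v]\<close> with \<open>x = \<delta> u\<close> and
  \<open>y = \<delta> v\<close>, and any competitor \<open>g\<close> sends this to \<open>[g u, g v]\<close>, a bracket of lifts of \<open>x\<close> and \<open>y\<close>.
\<close>

lemma nonab_universal:
  assumes perf: "perfect R L" and ext: "central_extension R E L \<phi>"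
  shows "\<exists>!f. f \<in> leibniz_homs R U E \<and> \<delta> = compose (carrier U) \<phi> f"
proof -
  interpret E: leibniz_superalgebra R E
    using ext by (simp add: central_extension_def)
  interpret U: leibniz_superalgebra R U
    by (rule nonab_leibniz_superalgebra)
  have \<phi>: "\<phi> \<in> linear_maps R E L"
    and hom: "\<And>a b. \<lbrakk>a \<in> carrier E; b \<in> carrier E\<rbrakk> \<Longrightarrow> \<phi> (bracket E a b) = bracket L (\<phi> a) (\<phi> b)"
    and surj: "\<phi> ` carrier E = carrier L"
    using ext by (auto simp: central_extension_def leibniz_homs_def)
  note cong = central_extension_bracket_cong[OF ext]
  \<comment> \<open>A section of \<open>\<phi>\<close>, merely as a map of sets.\<close>
  define s where "s x = (SOME a. a \<in> carrier E \<and> \<phi> a = x)" for x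
  have s: "s x \<in> carrier E" "\<phi> (s x) = x" if "x \<in> carrier L" for x
  proof -
    have "x \<in> \<phi> ` carrier E"
      using that surj by simp
    then have "\<exists>a. a \<in> carrier E \<and> \<phi> a = x"
      by fastforce
    from someI_ex[OF this] show "s x \<in> carrier E" "\<phi> (s x) = x"
      by (simp_all add: s_def)
  qed
  define \<psi> where "\<psi> x y = bracket E (s x) (s y)" for x y
  have \<psi>: "\<psi> (\<phi> a) (\<phi> b) = bracket E a b" if "a \<in> carrier E" "b \<in> carrier E" for a b
  proof -
    note c = that[THEN linear_maps_closed[OF \<phi>]]
    have "bracket E (s (\<phi> a)) (s (\<phi> b)) = bracket E a (s (\<phi> b))"
      using s[OF c(1)] s[OF c(2)] that by (intro cong(1)) simp_all
    also have "\<dots> = bracket E a b"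
      using s[OF c(1)] s[OF c(2)] that by (intro cong(2)) simp_all
    finally show ?thesis
      by (simp add: \<psi>_def)
  qed
  have lift: "\<psi> x y = bracket E a b"
    if "a \<in> carrier E" "b \<in> carrier E" "\<phi> a = x" "\<phi> b = y" for a b x y
    using \<psi>[OF that(1,2)] that(3,4) by simp
  have ml: "multilinear R L 2 E (\<lambda>xs. \<psi> (xs ! 0) (xs ! 1))"
  proof (rule multilinear2I[OF module_axioms])
    show "\<psi> x y \<in> carrier E" if "x \<in> carrier L" "y \<in> carrier L" for x y
      using that s(1) by (simp add: \<psi>_def)
  next
    fix x y z assume xyz: "x \<in> carrier L" "y \<in> carrier L" "z \<in> carrier L"
    note sxyz = xyz[THEN s(1)] xyz[THEN s(2)]
    have "\<psi> (x \<oplus>\<^bsub>L\<^esub> y) z = bracket E (s x \<oplus>\<^bsub>E\<^esub> s y) (s z)"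
      using sxyz by (intro lift) (simp_all add: linear_maps_add[OF \<phi>])
    then show "\<psi> (x \<oplus>\<^bsub>L\<^esub> y) z = \<psi> x z \<oplus>\<^bsub>E\<^esub> \<psi> y z"
      using sxyz by (simp add: E.bracket_linear \<psi>_def)
    have "\<psi> z (x \<oplus>\<^bsub>L\<^esub> y) = bracket E (s z) (s x \<oplus>\<^bsub>E\<^esub> s y)"
      using sxyz by (intro lift) (simp_all add: linear_maps_add[OF \<phi>])
    then show "\<psi> z (x \<oplus>\<^bsub>L\<^esub> y) = \<psi> z x \<oplus>\<^bsub>E\<^esub> \<psi> z y"
      using sxyz by (simp add: E.bracket_linear \<psi>_def)
  next
    fix r x y assume r: "r \<in> carrier R" and xy: "x \<in> carrier L" "y \<in> carrier L"
    note sxy = xy[THEN s(1)] xy[THEN s(2)]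
    have "\<psi> (r \<odot>\<^bsub>L\<^esub> x) y = bracket E (r \<odot>\<^bsub>E\<^esub> s x) (s y)"
      using r sxy by (intro lift) (simp_all add: linear_maps_smult[OF \<phi>])
    then show "\<psi> (r \<odot>\<^bsub>L\<^esub> x) y = r \<odot>\<^bsub>E\<^esub> \<psi> x y"
      using r sxy by (simp add: E.bracket_linear \<psi>_def)
    have "\<psi> x (r \<odot>\<^bsub>L\<^esub> y) = bracket E (s x) (r \<odot>\<^bsub>E\<^esub> s y)"
      using r sxy by (intro lift) (simp_all add: linear_maps_smult[OF \<phi>])
    then show "\<psi> x (r \<odot>\<^bsub>L\<^esub> y) = r \<odot>\<^bsub>E\<^esub> \<psi> x y"
      using r sxy by (simp add: E.bracket_linear \<psi>_def)
  qed
  have bal: "leibniz_balanced E \<psi>"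
    unfolding leibniz_balanced_def
  proof (intro allI ballI)
    fix p q r x y z assume "x \<in> grade L p" "y \<in> grade L q" "z \<in> grade L r"
    then obtain a b c where abc: "a \<in> grade E p" "b \<in> grade E q" "c \<in> grade E r"
      and xyz: "\<phi> a = x" "\<phi> b = y" "\<phi> c = z"
      using central_extension_homogeneous_lift[OF ext] by metis
    note E = abc[THEN E.grade_carrier]
    have "\<psi> x (bracket L y z) = bracket E a (bracket E b c)"
      "\<psi> (bracket L x y) z = bracket E (bracket E a b) c"
      "\<psi> (bracket L x z) y = bracket E (bracket E a c) b"
      using E by (intro lift; simp add: hom xyz)+
    then show "\<psi> x (bracket L y z) =
        \<psi> (bracket L x y) z \<ominus>\<^bsub>E\<^esub> super_sign R (q * r) \<odot>\<^bsub>E\<^esub> \<psi> (bracket L x z) y"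
      using E.leibniz_identity[OF abc] by (simp only:)
  qed
  from nonab_lift[OF E.module_axioms ml bal] obtain f where f: "f \<in> linear_maps R U E"
    and "\<forall>x \<in> carrier L. \<forall>y \<in> carrier L. f (t x y) = \<psi> x y" ..
  then have ft: "f (t x y) = \<psi> x y" if "x \<in> carrier L" "y \<in> carrier L" for x y
    using that by simp
  have comp: "\<delta> = compose (carrier U) \<phi> f"
  proof (rule nonab_maps_eqI[OF module_axioms nonab_delta2(1) linear_maps_compose[OF nonab_module f \<phi>]])
    fix x y assume xy: "x \<in> carrier L" "y \<in> carrier L"
    then show "\<delta> (t x y) = compose (carrier U) \<phi> f (t x y)"
      using s[OF xy(1)] s[OF xy(2)]
      by (simp add: compose_def nonab_pure_linear(1) nonab_delta2(2) ft \<psi>_def hom)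
  qed
  have \<phi>f: "\<phi> (f u) = \<delta> u" if "u \<in> carrier U" for u
    using that by (subst comp) (simp add: compose_def)
  have "f \<in> leibniz_homs R U E"
    unfolding leibniz_homs_def
  proof (intro CollectI conjI allI ballI f)
    fix p
    have "grade U p \<subseteq> {u \<in> carrier U. f u \<in> grade E p}"
    proof (rule nonab_gradeI[OF submodule_vimage[OF nonab_module E.module_axioms f E.grade_submodule]])
      fix x y q r assume xy: "x \<in> grade L q" "y \<in> grade L r" and p: "q + r = p"
      then obtain a b where ab: "a \<in> grade E q" "b \<in> grade E r" "\<phi> a = x" "\<phi> b = y"
        using central_extension_homogeneous_lift[OF ext] by metis
      have "f (t x y) = bracket E a b"
        using ab(1,2)[THEN E.grade_carrier] ab(3,4) xy[THEN grade_carrier] by (simp add: ft lift)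
      also have "\<dots> \<in> grade E p"
        using E.bracket_even[OF ab(1,2)] unfolding p .
      finally show "t x y \<in> {u \<in> carrier U. f u \<in> grade E p}"
        using xy[THEN grade_carrier] nonab_pure_linear(1) by simp
    qed
    then show "f ` grade U p \<subseteq> grade E p"
      by blast
  next
    fix u v assume uv: "u \<in> carrier U" "v \<in> carrier U"
    have "f (bracket U u v) = \<psi> (\<delta> u) (\<delta> v)"
      using uv by (simp add: nonab_bracket ft)
    also have "\<dots> = bracket E (f u) (f v)"
      using uv linear_maps_closed[OF f] \<phi>f by (intro lift) simp_all
    finally show "f (bracket U u v) = bracket E (f u) (f v)" .
  qed
  moreover have "g = f" if g: "g \<in> leibniz_homs R U E" "\<delta> = compose (carrier U) \<phi> g" for g
  proof -
    have gl: "g \<in> linear_maps R U E"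
      and gb: "\<And>u v. \<lbrakk>u \<in> carrier U; v \<in> carrier U\<rbrakk> \<Longrightarrow> g (bracket U u v) = bracket E (g u) (g v)"
      using g(1) by (auto simp: leibniz_homs_def)
    have \<phi>g: "\<phi> (g u) = \<delta> u" if "u \<in> carrier U" for u
      using that by (subst g(2)) (simp add: compose_def)
    show ?thesis
    proof (rule nonab_maps_eqI[OF E.module_axioms gl f])
      fix x y assume xy: "x \<in> carrier L" "y \<in> carrier L"
      then have "x \<in> \<delta> ` carrier U" "y \<in> \<delta> ` carrier U"
        using nonab_delta2_surj[OF perf] by simp_all
      then obtain u v where uv: "u \<in> carrier U" "v \<in> carrier U" and "x = \<delta> u" "y = \<delta> v"
        by blast
      then have t: "t x y = bracket U u v"
        by (simp add: nonab_bracket)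
      have "g (t x y) = bracket E (g u) (g v)"
        using uv by (simp add: t gb)
      also have "\<dots> = \<psi> x y"
        using uv \<open>x = \<delta> u\<close> \<open>y = \<delta> v\<close> linear_maps_closed[OF gl] \<phi>g by (intro lift[symmetric]) simp_all
      also have "\<dots> = f (t x y)"
        using xy by (simp add: ft)
      finally show "g (t x y) = f (t x y)" .
    qed
  qed
  ultimately show ?thesis
    using comp by (intro ex1I[of _ f]) blast+
qed

section \<open>The kernel and second homology\<close>

text \<open>
  The boundary map in degree two ends in the first tensor power, while \<open>\<delta>\<close> ends in \<open>L\<close>. The two
  kernels agree because \<open>x \<mapsto> pure_tensor R L [x]\<close> has a left inverse.
\<close>

lemma leibniz_cycles_iff:
  assumes x: "x \<in> carrier T2"
  shows "x \<in> leibniz_cycles R L 2 \<longleftrightarrow> nonab_proj x \<in> a_kernel U L \<delta>"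
proof -
  let ?T1 = "tensor_power R L 1" and ?d = "leibniz_boundary R L 2"
  have T1: "module R ?T1"
    by (rule tensor_power_module[OF module_axioms])
  \<comment> \<open>The isomorphism of \<open>L\<close> with its first tensor power, through which the boundary map factors.\<close>
  define \<iota> where "\<iota> = (\<lambda>x\<in>carrier L. pure_tensor R L [x])"
  have \<iota>: "\<iota> \<in> linear_maps R L ?T1"
    unfolding \<iota>_def by (rule linear_maps_restrictI[OF module_axioms]) (simp_all add: pure_tensor1 del: One_nat_def)
  from tensor_power1_iso obtain g where g: "g \<in> linear_maps R ?T1 L"
    and g\<iota>: "\<forall>x \<in> carrier L. g (pure_tensor R L [x]) = x" ..
  note \<delta>p = linear_maps_compose[OF T2_module nonab_proj_linear nonab_delta2(1)]
  note \<iota>\<delta>p = linear_maps_compose[OF T2_module \<delta>p \<iota>]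
  have "?d = compose (carrier T2) \<iota> (compose (carrier T2) \<delta> nonab_proj)"
  proof (rule tensor_power_maps_eqI[OF T1 leibniz_boundary_2(1) \<iota>\<delta>p])
    fix xs ps assume "length xs = 2" and deg: "has_degrees L xs ps"
    then obtain x y where xs: "xs = [x, y]"
      by (auto simp: numeral_2_eq_2 length_Suc_conv)
    have "x \<in> carrier L" "y \<in> carrier L"
      using has_degrees_carrier[OF deg] by (simp_all add: xs)
    then show "?d (pure_tensor R L xs)
        = compose (carrier T2) \<iota> (compose (carrier T2) \<delta> nonab_proj) (pure_tensor R L xs)"
      by (simp add: xs compose_def leibniz_boundary_2(2) pure_tensor2[OF module_axioms] nonab_proj_pure
          nonab_delta2(2) \<iota>_def)
  qed
  then have d: "?d x = \<iota> (\<delta> (nonab_proj x))"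
    using x by (simp add: compose_def)
  have px: "nonab_proj x \<in> carrier U"
    using linear_maps_closed[OF nonab_proj_linear x] .
  have "?d x = \<zero>\<^bsub>?T1\<^esub> \<longleftrightarrow> \<delta> (nonab_proj x) = \<zero>\<^bsub>L\<^esub>"
  proof
    assume "?d x = \<zero>\<^bsub>?T1\<^esub>"
    then have "g (\<iota> (\<delta> (nonab_proj x))) = \<zero>\<^bsub>L\<^esub>"
      using d linear_maps_zero[OF T1 module_axioms g] by simp
    then show "\<delta> (nonab_proj x) = \<zero>\<^bsub>L\<^esub>"
      using g\<iota> px by (simp add: \<iota>_def)
  next
    assume "\<delta> (nonab_proj x) = \<zero>\<^bsub>L\<^esub>"
    then show "?d x = \<zero>\<^bsub>?T1\<^esub>"
      using d linear_maps_zero[OF module_axioms T1 \<iota>] by simp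
  qed
  then show ?thesis
    using x px by (simp add: leibniz_cycles_def a_kernel_def')
qed

text \<open>
  Both sides are the cosets of the boundaries that consist of cycles, so the kernel is equal to the
  homology module and not merely isomorphic to it. Taking the quotient of the cycles or of the whole
  tensor square yields the same cosets, as these depend on the addition alone.
\<close>

lemma nonab_kernel_eq_homology:
  "sub_supermodule U (a_kernel U L \<delta>) = leibniz_homology R L 2"
proof -
  let ?K = "a_kernel U L \<delta>" and ?Z = "leibniz_cycles R L 2"
  let ?S = "sub_supermodule T2 ?Z"
  have coset: "a_r_coset ?S = a_r_coset T2" and sum: "set_add ?S = set_add T2"
    by (rule a_r_coset_cong set_add_cong; simp add: sub_supermodule_simps)+
  have Z: "?Z \<subseteq> carrier T2"
    by (auto simp: leibniz_cycles_def a_kernel_def')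
  have im: "(\<lambda>x. B2 +>\<^bsub>T2\<^esub> x) ` A \<inter> ?K = (\<lambda>x. B2 +>\<^bsub>T2\<^esub> x) ` (A \<inter> ?Z)" if "A \<subseteq> carrier T2" for A
    using that leibniz_cycles_iff by (auto simp: nonab_proj_def subset_iff)
  have "?K \<subseteq> (\<lambda>x. B2 +>\<^bsub>T2\<^esub> x) ` carrier T2"
    by (auto simp: a_kernel_def' nonab_tensor_simps(1) a_rcosets_eq)
  moreover have "carrier T2 \<inter> ?Z = ?Z"
    using Z by blast
  ultimately have K: "?K = (\<lambda>x. B2 +>\<^bsub>T2\<^esub> x) ` ?Z"
    using im[OF subset_refl] by (simp add: Int_absorb1)
  have grade: "grade U p \<inter> ?K = (\<lambda>x. B2 +>\<^bsub>T2\<^esub> x) ` (grade T2 p \<inter> ?Z)" for p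
    unfolding nonab_tensor_simps(5) by (rule im[OF grade_tensor_power_closed])
  have ring: "mult U = undefined" "one U = undefined"
    by (simp_all add: nonab_tensor_def nonab_tensor_supermodule_def quot_supermodule_def with_grade_def
        quot_mod_def module.defs supermodule.defs leibniz_superalgebra.defs)
  show ?thesis
    by (rule supermodule.equality)
      (simp_all add: leibniz_homology_def quot_supermodule_def sub_supermodule_simps nonab_tensor_simps
        quot_mod_def with_grade_def module.defs supermodule.defs coset sum ring grade[unfolded nonab_tensor_simps(5) K] K a_rcosets_eq fun_eq_iff)
qed

end

theorem theorem2p16:
  fixes R :: "('r, 'x) ring_scheme"
    and L :: "('r, 'a) leibniz_superalgebra"
  assumes "leibniz_superalgebra R L"
    and "perfect R L"
  shows "universal_central_extension TYPE('m) R (nonab_tensor R L) L (nonab_delta2 R L) \<and>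
    sub_supermodule (nonab_tensor R L) (a_kernel (nonab_tensor R L) L (nonab_delta2 R L))
      = leibniz_homology R L 2"
proof -
  interpret leibniz_superalgebra R L by fact
  show ?thesis
    unfolding universal_central_extension_def
    using nonab_central_extension[OF assms(2)] nonab_universal[OF assms(2)] nonab_kernel_eq_homology
    by blast
qed

end
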